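(* Let $H_{[-1,1]}$ be the finite Hilbert transformation on $L^2(-1,1)$ and $U=\Gamma\mathcal{F}^{-1}\Gamma^{-1}$ the unitary operator on $L^2(-1,1)$, both defined in the context. The spectral representation $$H_{[-1,1]}=U\,M(\operatorname{id}_{[-1,1]})\,U^{-1}$$ holds, where $M(\operatorname{id}_{[-1,1]})$ is the operator of multiplication by the identity function, $k(t)\mapsto t\,k(t)$, on $L^2(-1,1)$.
   Context: $H_{[-1,1]}$ is the bounded operator on $L^2(-1,1)$ $$(H_{[-1,1]}g)(x)=\frac1{i\pi}\int_{-1}^1\frac{g(y)}{y-x}\,dy$$ (principal value at $x$). $\mathcal{F}$ is the unitary Fourier transformation on $L^2(\mathbb{R})$ with $\mathcal{F}f(x)=(2\pi)^{-1/2}\int e^{-ixy}f(y)\,dy$ for $f\in L^1\cap L^2$. $\Gamma:L^2(\mathbb{R})\to L^2(-1,1)$ is the Hilbert space isomorphism $(\Gamma f)(x)=\sqrt{|\gamma'(x)|}\,f(\gamma(x))$ with $\gamma:\,]-1,1[\to\mathbb{R}$, $\gamma(x)=\sqrt{\tfrac1{2\pi}}\ln\big(\tfrac{1+x}{1-x}\big)$. The operator $U=\Gamma\mathcal{F}^{-1}\Gamma^{-1}$ is the integral operator $Uk=\operatorname{l.i.m.}_{0<\alpha,\alpha'\to0}\int_{-1+\alpha}^{1-\alpha'}Q'(t,\cdot)k(t)\,dt$ with $Q'(t,u)=\tfrac1\pi(1-t^2)^{-1/2}(1-u^2)^{-1/2}\exp\big(\tfrac{i}{2\pi}\ln\big(\tfrac{1-t}{1+t}\big)\ln\big(\tfrac{1-u}{1+u}\big)\big)$.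 *)

theory Defs
  imports "HOL-Analysis.Analysis"
begin

section \<open>The Hilbert space of square-integrable functions\<close>

definition sq_integrable :: "'a measure \<Rightarrow> ('a \<Rightarrow> complex) set" where
  "sq_integrable M = {f \<in> borel_measurable M. integrable M (\<lambda>x. (cmod (f x))\<^sup>2)}"

definition ae_rel :: "'a measure \<Rightarrow> (('a \<Rightarrow> complex) \<times> ('a \<Rightarrow> complex)) set" where
  "ae_rel M = {(f, g). f \<in> sq_integrable M \<and> g \<in> sq_integrable M \<and> (AE x in M. f x = g x)}"

lemma equiv_ae_rel: "equiv (sq_integrable M) (ae_rel M)"
proof (rule equivI)
  show "refl_on (sq_integrable M) (ae_rel M)"
    by (auto simp: refl_on_def ae_rel_def)
  show "sym (ae_rel M)"
    by (auto simp: sym_def ae_rel_def elim: AE_mp)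
  show "trans (ae_rel M)"
    unfolding trans_def ae_rel_def by (auto elim: AE_mp)
  show "ae_rel M \<subseteq> sq_integrable M \<times> sq_integrable M"
    by (auto simp: ae_rel_def)
qed

text \<open>Elements of the Hilbert space are equivalence classes of functions.  The class
  of a function that is not square-integrable is the empty set, which is not an
  element of the Hilbert space.\<close>

definition L2 :: "'a measure \<Rightarrow> ('a \<Rightarrow> complex) set set" where
  "L2 M = sq_integrable M // ae_rel M"

definition L2_class :: "'a measure \<Rightarrow> ('a \<Rightarrow> complex) \<Rightarrow> ('a \<Rightarrow> complex) set" where
  "L2_class M f = ae_rel M `` {f}"

text \<open>Linearity and preservation of the inner product are expressed through arbitrary
  representatives f, g of two vectors and f', g' of their images.\<close>

definition unitary_L2 ::
  "'a measure \<Rightarrow> 'b measure \<Rightarrow> (('a \<Rightarrow> complex) set \<Rightarrow> ('b \<Rightarrow> complex) set) \<Rightarrow> bool" where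
  "unitary_L2 M N T \<longleftrightarrow>
     bij_betw T (L2 M) (L2 N) \<and>
     (\<forall>f \<in> sq_integrable M. \<forall>g \<in> sq_integrable M.
      \<forall>f' \<in> T (L2_class M f). \<forall>g' \<in> T (L2_class M g).
        (\<forall>c. T (L2_class M (\<lambda>x. c * f x + g x)) = L2_class N (\<lambda>y. c * f' y + g' y)) \<and>
        (LINT y|N. cnj (f' y) * g' y) = (LINT x|M. cnj (f x) * g x))"

definition L2_mult ::
  "'a measure \<Rightarrow> ('a \<Rightarrow> complex) \<Rightarrow> ('a \<Rightarrow> complex) set \<Rightarrow> ('a \<Rightarrow> complex) set" where
  "L2_mult M \<phi> A = (\<Union>f\<in>A. L2_class M (\<lambda>t. \<phi> t * f t))"

section \<open>The Fourier transformation\<close>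

definition fourier_integral :: "(real \<Rightarrow> complex) \<Rightarrow> real \<Rightarrow> complex" where
  "fourier_integral f x =
     complex_of_real (1 / sqrt (2 * pi)) *
     (LINT y|lborel. exp (- (\<i> * complex_of_real (x * y))) * f y)"

text \<open>The description is unique because the integrable functions are dense; it is made
  extensional since only values on the Hilbert space are determined.\<close>

definition fourier_L2 :: "(real \<Rightarrow> complex) set \<Rightarrow> (real \<Rightarrow> complex) set" where
  "fourier_L2 = (THE T. T \<in> extensional (L2 lborel) \<and> unitary_L2 lborel lborel T \<and>
     (\<forall>f \<in> sq_integrable lborel. integrable lborel f \<longrightarrow>
        T (L2_class lborel f) = L2_class lborel (fourier_integral f)))"

section \<open>Operators on the interval\<close>

definition interval_measure_11 :: "real measure" where
  "interval_measure_11 = restrict_space lborel {-1<..<1}"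

definition gamma_map :: "real \<Rightarrow> real" where
  "gamma_map x = sqrt (1 / (2 * pi)) * ln ((1 + x) / (1 - x))"

definition Gamma_op :: "(real \<Rightarrow> complex) set \<Rightarrow> (real \<Rightarrow> complex) set" where
  "Gamma_op A = (\<Union>f\<in>A. L2_class interval_measure_11
     (\<lambda>x. complex_of_real (sqrt \<bar>deriv gamma_map x\<bar>) * f (gamma_map x)))"

definition U_op :: "(real \<Rightarrow> complex) set \<Rightarrow> (real \<Rightarrow> complex) set" where
  "U_op = Gamma_op \<circ> inv_into (L2 lborel) fourier_L2 \<circ> inv_into (L2 lborel) Gamma_op"

definition has_principal_value :: "(real \<Rightarrow> complex) \<Rightarrow> real \<Rightarrow> complex \<Rightarrow> bool" where
  "has_principal_value g x l \<longleftrightarrow>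
     ((\<lambda>\<epsilon>. LINT y : {-1<..<1} - {x - \<epsilon>..x + \<epsilon>} | lborel. g y / complex_of_real (y - x))
        \<longlongrightarrow> l) (at_right 0)"

text \<open>Convergence of the principal value almost everywhere is part of the definition:
  if it failed, the value would be the empty set.\<close>

definition finite_hilbert :: "(real \<Rightarrow> complex) set \<Rightarrow> (real \<Rightarrow> complex) set" where
  "finite_hilbert A = {h \<in> sq_integrable interval_measure_11. \<exists>g\<in>A.
     AE x in interval_measure_11. \<exists>l. has_principal_value g x l \<and>
       h x = 1 / (\<i> * complex_of_real pi) * l}"

end

theory Submission
  imports Defs
begin

text \<open>Substituting \<open>x = tanh (sqrt (pi / 2) * s)\<close> turns the finite Hilbert transformation into
  convolution with a multiple of \<open>1 / sinh (sqrt (pi / 2) * s)\<close>, whose Fourier multiplier is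
  \<open>tanh (sqrt (pi / 2) * \<xi>)\<close>; this is the function which \<open>\<Gamma>\<close> carries to the identity on the interval.

  The almost everywhere existence of the principal value needs no maximal inequality.  Let \<open>T\<close> be the
  bounded operator with multiplier \<open>tanh\<close>.  By Plancherel, the Poisson integral of \<open>T G\<close> equals
  the convolution of \<open>G\<close> with the inverse Fourier transform of \<open>tanh\<close> times an Abel factor.  Writing
  \<open>tanh = sgn + \<rho>\<close> with \<open>\<rho>\<close> exponentially small, this is the conjugate Poisson integral of \<open>G\<close> plus
  a square-integrable kernel, and the conjugate Poisson kernel differs from the truncated
  kernel \<open>1 / v\<close> by at most the Poisson kernel.  So the principal value exists and has the right value
  wherever both \<open>G\<close> and \<open>T G\<close> have a Lebesgue point.\<close>

section \<open>Lebesgue points\<close>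

text \<open>The scale sqrt (pi / 2) is forced twice. It makes \<open>gamma_map\<close> equal to
  artanh divided by \<open>acon\<close>; and, up to a constant factor, convolution with acon / sinh
  (acon * v) has the multiplier tanh (pi * \<xi> / (2 * acon)), which is tanh (acon * \<xi>) exactly
  because the square of \<open>acon\<close> is pi / 2. The square root in \<open>Gamma_op\<close>
  shares the Jacobian equally between the two variables, and this turns 1 / (y - x) into a function
  of t - s alone. Three obstacles shape the rest. \<open>fourier_L2\<close> is a definite
  description, so Plancherel, inversion and uniqueness must be available before it can be evaluated
  at all. \<open>finite_hilbert\<close> speaks of limits at individual points, so convergence in
  mean square is not enough; Lebesgue points of the function and of its image supply the pointwise
  information. Finally, \<open>gamma_map\<close> does not preserve midpoints: a cut symmetric about
  x becomes an asymmetric cut about the image point. Differentiability makes the ratio of its two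
  arms tend to 1, and at a Lebesgue point the resulting error vanishes.\<close>

lemma negligible_upper_derivate_pos:
  fixes \<mu> :: "real measure"
  assumes "finite_measure \<mu>" and sets: "sets \<mu> = sets borel"
    and A: "A \<in> sets borel" "emeasure \<mu> A = 0" and "\<eta> > 0"
  shows "negligible {x \<in> A. \<forall>d>0. \<exists>h. 0 < h \<and> h < d \<and> emeasure \<mu> (cball x h) > ennreal (\<eta> * h)}"
    (is "negligible ?N")
  unfolding negligible_outer_le
proof (intro allI impI)
  fix e :: real assume "e > 0"
  interpret finite_measure \<mu> by fact
  \<comment> \<open>An interval of radius h in the family below has length 2 * h, less than 2 /
    \<eta> times its \<mu>-measure. So \<mu>-measure below e * \<eta> / 2 forces total length at
    most e.\<close>
  define e' where "e' = e * \<eta> / 2"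
  have "e' > 0" using \<open>e > 0\<close> \<open>\<eta> > 0\<close> by (simp add: e'_def)
  have "(INF U \<in> {U. A \<subseteq> U \<and> open U}. emeasure \<mu> U) < ennreal e'"
    using outer_regular[OF sets _ A(1)] A(2) \<open>e' > 0\<close> by simp
  then obtain V where V: "A \<subseteq> V" "open V" "emeasure \<mu> V < ennreal e'"
    by (auto simp: INF_less_iff)
  \<comment> \<open>Arbitrarily small bad intervals about each point of \<open>?N\<close> lie inside
    \<open>V\<close>, so they form a Vitali cover. A countable disjoint subfamily covers
    \<open>?N\<close> up to a negligible set, and its total \<mu>-measure is at most that of
    \<open>V\<close>.\<close>
  define K where "K = {(x,h). 0 < h \<and> cball x h \<subseteq> V \<and> emeasure \<mu> (cball x h) > ennreal (\<eta> * h)}"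
  have cover: "\<exists>i. i \<in> K \<and> x \<in> cball (fst i) (snd i) \<and> snd i < d" if x: "x \<in> ?N" and "0 < d" for x d
  proof -
    have "x \<in> V" using x V(1) by blast
    then obtain r where r: "r > 0" "cball x r \<subseteq> V"
      using V(2) open_contains_cball by blast
    from x have "\<forall>d>0. \<exists>h. 0 < h \<and> h < d \<and> emeasure \<mu> (cball x h) > ennreal (\<eta> * h)" by simp
    then obtain h where "0 < h" "h < min d r" "emeasure \<mu> (cball x h) > ennreal (\<eta> * h)"
      using \<open>d > 0\<close> r(1) by (force dest: spec[of _ "min d r"])
    moreover then have "cball x h \<subseteq> cball x r" by (auto intro: subset_cball)
    ultimately show ?thesis using r by (intro exI[of _ "(x,h)"]) (auto simp: K_def)
  qed
  obtain C where C: "countable C" "C \<subseteq> K"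
     "pairwise (\<lambda>i j. disjnt (cball (fst i) (snd i)) (cball (fst j) (snd j))) C"
     "negligible (?N - (\<Union>i \<in> C. cball (fst i) (snd i)))"
  proof (rule Vitali_covering_theorem_cballs[of K snd ?N fst])
    show "0 < snd i" if "i \<in> K" for i using that by (auto simp: K_def)
  qed (use cover in blast)+
  define B where "B = (\<lambda>i::real\<times>real. cball (fst i) (snd i))"
  have disj: "disjoint_family_on B C"
    using C(3) by (auto simp: disjoint_family_on_def pairwise_def disjnt_def B_def)
  have leb: "emeasure lborel (B i) \<le> ennreal (2/\<eta>) * emeasure \<mu> (B i)" if "i \<in> C" for i
  proof -
    obtain x h where i: "i = (x,h)" by force
    with that C(2) have h: "h > 0" "emeasure \<mu> (cball x h) > ennreal (\<eta> * h)" by (auto simp: K_def)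
    have "emeasure lborel (B i) = ennreal (2 * h)"
      using h by (simp add: B_def i cball_eq_atLeastAtMost)
    also have "\<dots> = ennreal (2/\<eta>) * ennreal (\<eta> * h)"
      using h \<open>\<eta> > 0\<close> by (subst ennreal_mult[symmetric]) (auto simp: field_simps)
    also have "\<dots> \<le> ennreal (2/\<eta>) * emeasure \<mu> (B i)"
      using h by (intro mult_left_mono) (auto simp: B_def i)
    finally show ?thesis .
  qed
  have BV: "(\<Union>i\<in>C. B i) \<subseteq> V" using C(2) by (force simp: K_def B_def subset_iff)
  have Um: "(\<Union>i\<in>C. B i) \<in> sets borel"
    using C(1) by (intro sets.countable_UN'') (auto simp: B_def)
  have "emeasure lborel (\<Union>i\<in>C. B i) = (\<integral>\<^sup>+i. emeasure lborel (B i) \<partial>count_space C)"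
    using C(1) disj by (intro emeasure_UN_countable) (auto simp: B_def)
  also have "\<dots> \<le> (\<integral>\<^sup>+i. ennreal (2/\<eta>) * emeasure \<mu> (B i) \<partial>count_space C)"
    using leb by (intro nn_integral_mono) auto
  also have "\<dots> = ennreal (2/\<eta>) * (\<integral>\<^sup>+i. emeasure \<mu> (B i) \<partial>count_space C)"
    by (simp add: nn_integral_cmult)
  also have "(\<integral>\<^sup>+i. emeasure \<mu> (B i) \<partial>count_space C) = emeasure \<mu> (\<Union>i\<in>C. B i)"
    using C(1) disj sets by (intro emeasure_UN_countable[symmetric]) (auto simp: B_def)
  also have "ennreal (2/\<eta>) * emeasure \<mu> (\<Union>i\<in>C. B i) \<le> ennreal (2/\<eta>) * emeasure \<mu> V"
    using BV V sets by (intro mult_left_mono emeasure_mono) auto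
  also have "ennreal (2/\<eta>) * emeasure \<mu> V \<le> ennreal (2/\<eta>) * ennreal e'"
    using V(3) by (intro mult_left_mono) auto
  also have "\<dots> = ennreal e"
    using \<open>\<eta> > 0\<close> \<open>e > 0\<close> by (subst ennreal_mult[symmetric]) (auto simp: e'_def)
  finally have Ue: "emeasure lborel (\<Union>i\<in>C. B i) \<le> ennreal e" .
  have Ul: "(\<Union>i\<in>C. B i) \<in> lmeasurable" "measure lebesgue (\<Union>i\<in>C. B i) \<le> e"
  proof -
    have "emeasure lebesgue (\<Union>i\<in>C. B i) \<le> ennreal e" using Ue Um by simp
    then show "(\<Union>i\<in>C. B i) \<in> lmeasurable" using Um
      by (auto simp: fmeasurable_def intro: le_less_trans)
    show "measure lebesgue (\<Union>i\<in>C. B i) \<le> e"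
      using \<open>emeasure lebesgue (\<Union>i\<in>C. B i) \<le> ennreal e\<close> \<open>e > 0\<close>
      by (simp add: measure_def enn2real_leI)
  qed
  let ?T = "(\<Union>i\<in>C. B i) \<union> (?N - (\<Union>i\<in>C. B i))"
  have neg: "negligible (?N - (\<Union>i\<in>C. B i))" using C(4) by (simp add: B_def)
  then have "?N - (\<Union>i\<in>C. B i) \<in> lmeasurable" "measure lebesgue (?N - (\<Union>i\<in>C. B i)) = 0"
    by (simp_all add: negligible_imp_measurable negligible_imp_measure0)
  then have "?T \<in> lmeasurable" "measure lebesgue ?T \<le> e"
    using Ul measure_Un_le[of "(\<Union>i\<in>C. B i)" lebesgue "?N - (\<Union>i\<in>C. B i)"]
    by (auto intro: fmeasurable.Un simp: fmeasurableD simp del: Un_Diff_cancel)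
  then show "\<exists>T. ?N \<subseteq> T \<and> T \<in> lmeasurable \<and> measure lebesgue T \<le> e" by (intro exI[of _ ?T]) auto
qed

text \<open>Comparing with e * h instead of dividing by the length 2 * h changes nothing, since e is
  arbitrary. The extended nonnegative integral avoids any integrability condition.\<close>

definition lebesgue_pt :: "(real \<Rightarrow> complex) \<Rightarrow> real \<Rightarrow> bool" where
  "lebesgue_pt f x \<longleftrightarrow> (\<forall>e>0. \<exists>d>0. \<forall>h. 0 < h \<and> h < d \<longrightarrow>
     (\<integral>\<^sup>+t. ennreal (cmod (f t - f x)) * indicator {x-h..x+h} t \<partial>lborel) \<le> ennreal (e * h))"

text \<open>\<open>ennreal\<close> cuts off negative values, so the measure with density g gives the
  set where g is nonpositive mass 0; its upper derivative vanishes at almost every point of that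
  set.\<close>

lemma AE_average_excess:
  fixes g :: "real \<Rightarrow> real"
  assumes [measurable]: "g \<in> borel_measurable borel" and "(\<integral>\<^sup>+t. ennreal (g t) \<partial>lborel) < \<infinity>"
    and "\<eta> > 0"
  shows "AE x in lborel. g x \<le> 0 \<longrightarrow> (\<exists>d>0. \<forall>h. 0 < h \<and> h < d \<longrightarrow>
     (\<integral>\<^sup>+t. ennreal (g t) * indicator {x-h..x+h} t \<partial>lborel) \<le> ennreal (\<eta> * h))"
proof -
  let ?\<mu> = "density lborel (\<lambda>t. ennreal (g t))"
  let ?A = "{x. g x \<le> 0}"
  have fin: "finite_measure ?\<mu>"
    using assms(2) by (intro finite_measureI) (auto simp: emeasure_density)
  have "AE x in lborel. ennreal (g x) * indicator ?A x = 0"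
    by (auto simp: indicator_def ennreal_neg)
  then have A0: "emeasure ?\<mu> ?A = 0"
    by (simp add: emeasure_density nn_integral_0_iff_AE)
  have "negligible {x \<in> ?A. \<forall>d>0. \<exists>h. 0 < h \<and> h < d \<and> emeasure ?\<mu> (cball x h) > ennreal (\<eta> * h)}"
    using fin A0 \<open>\<eta> > 0\<close> by (intro negligible_upper_derivate_pos) auto
  then have "AE x in lebesgue. x \<notin> {x \<in> ?A. \<forall>d>0. \<exists>h. 0 < h \<and> h < d \<and> emeasure ?\<mu> (cball x h) > ennreal (\<eta> * h)}"
    by (intro AE_not_in) (simp add: negligible_iff_null_sets)
  then have "AE x in lborel. x \<notin> {x \<in> ?A. \<forall>d>0. \<exists>h. 0 < h \<and> h < d \<and> emeasure ?\<mu> (cball x h) > ennreal (\<eta> * h)}"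
    by (simp add: AE_completion_iff)
  then show ?thesis
  proof eventually_elim
    case (elim x)
    then have "g x \<le> 0 \<longrightarrow> (\<exists>d>0. \<forall>h. 0 < h \<and> h < d \<longrightarrow> emeasure ?\<mu> (cball x h) \<le> ennreal (\<eta> * h))"
      by (simp add: not_less) (metis not_less)
    then show ?case by (simp add: emeasure_density cball_eq_atLeastAtMost)
  qed
qed

text \<open>The null set must not depend on the value f x. Hence the excess of cmod (f t - c) over 1
  / Suc k is treated for countably many centres c and all k at once. At a good x one picks c so
  close to f x that the excess is nonpositive there. The cut at n makes the excess
  integrable.\<close>

lemma AE_lebesgue_pt:
  assumes [measurable]: "f \<in> borel_measurable borel"
    and fin: "\<And>n::nat. (\<integral>\<^sup>+t. ennreal (cmod (f t)) * indicator {-real n..real n} t \<partial>lborel) < \<infinity>"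
  shows "AE x in lborel. lebesgue_pt f x"
proof -
  define D :: "complex set" where "D = (\<lambda>(p,q). Complex p q) ` (\<rat> \<times> \<rat>)"
  have cD: "countable D" by (auto simp: D_def countable_rat)
  have dense: "\<exists>c\<in>D. cmod (z - c) < e" if e: "e > 0" for z e
  proof -
    obtain p where p: "p \<in> \<rat>" "Re z - e/2 < p" "p < Re z" using Rats_dense_in_real[of "Re z - e/2" "Re z"] e by force
    obtain q where q: "q \<in> \<rat>" "Im z - e/2 < q" "q < Im z" using Rats_dense_in_real[of "Im z - e/2" "Im z"] e by force
    have "cmod (z - Complex p q) \<le> \<bar>Re (z - Complex p q)\<bar> + \<bar>Im (z - Complex p q)\<bar>" by (rule cmod_le)
    then have "cmod (z - Complex p q) < e" using p q by (simp add: abs_if split: if_splits)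
    then show ?thesis using p q by (auto simp: D_def)
  qed
  define g where "g = (\<lambda>c (k::nat) (n::nat) (t::real). if \<bar>t\<bar> \<le> real n then cmod (f t - c) - 1 / Suc k else 0)"
  have "AE x in lborel. \<forall>c\<in>D. \<forall>k. \<forall>n. g c k n x \<le> 0 \<longrightarrow> (\<exists>d>0. \<forall>h. 0 < h \<and> h < d \<longrightarrow>
     (\<integral>\<^sup>+t. ennreal (g c k n t) * indicator {x-h..x+h} t \<partial>lborel) \<le> ennreal (1/Suc k * h))"
  proof (subst AE_ball_countable[OF cD], subst AE_all_countable, subst AE_all_countable, intro ballI allI AE_average_excess)
    fix c k and n :: nat
    show "g c k n \<in> borel_measurable borel" unfolding g_def by measurable
    have "(\<integral>\<^sup>+t. ennreal (g c k n t) \<partial>lborel) \<le>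
       (\<integral>\<^sup>+t. ennreal (cmod (f t)) * indicator {-real n..real n} t + ennreal (cmod c) * indicator {-real n..real n} t \<partial>lborel)"
    proof (intro nn_integral_mono)
      fix t :: real
      have "cmod (f t - c) - 1/Suc k \<le> cmod (f t) + cmod c" using norm_triangle_ineq4[of "f t" c]
        by (smt (verit) divide_nonneg_nonneg of_nat_0_le_iff)
      then show "ennreal (g c k n t) \<le> ennreal (cmod (f t)) * indicator {-real n..real n} t + ennreal (cmod c) * indicator {-real n..real n} t"
        by (auto simp: g_def indicator_def ennreal_plus[symmetric] simp del: ennreal_plus intro!: ennreal_leI)
    qed
    also have "\<dots> < \<infinity>"
      using fin[of n] by (subst nn_integral_add) (auto simp: nn_integral_cmult ennreal_mult_less_top)
    finally show "(\<integral>\<^sup>+t. ennreal (g c k n t) \<partial>lborel) < \<infinity>" .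
  qed auto
  then show ?thesis
  proof eventually_elim
    case (elim x)
    show ?case unfolding lebesgue_pt_def
    proof (intro allI impI)
      fix e :: real assume "e > 0"
      \<comment> \<open>The 5 collects 1 from the averaged excess and 4 from the constant 2 / Suc k
        integrated over length 2 * h.\<close>
      obtain k where k: "1 / Suc k < e/5" using \<open>e > 0\<close> nat_approx_posE[of "e/5"] by (auto simp: inverse_eq_divide)
      obtain c where c: "c \<in> D" "cmod (f x - c) < 1/Suc k" using dense[of "1/Suc k" "f x"] by auto
      \<comment> \<open>The margin 1 keeps every window of radius below 1 inside the region where
        the excess is not cut off.\<close>
      obtain n :: nat where n: "\<bar>x\<bar> + 1 < n" using reals_Archimedean2 by blast
      have "g c k n x \<le> 0" using c by (simp add: g_def)
      with elim c(1) obtain d where d: "d > 0" "\<And>h. 0 < h \<Longrightarrow> h < d \<Longrightarrow>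
         (\<integral>\<^sup>+t. ennreal (g c k n t) * indicator {x-h..x+h} t \<partial>lborel) \<le> ennreal (1/Suc k * h)" by blast
      have "(\<integral>\<^sup>+t. ennreal (cmod (f t - f x)) * indicator {x-h..x+h} t \<partial>lborel) \<le> ennreal (e * h)"
        if h: "0 < h" "h < min d 1" for h
      proof -
        have "(\<integral>\<^sup>+t. ennreal (cmod (f t - f x)) * indicator {x-h..x+h} t \<partial>lborel) \<le>
          (\<integral>\<^sup>+t. ennreal (g c k n t) * indicator {x-h..x+h} t + ennreal (2/Suc k) * indicator {x-h..x+h} t \<partial>lborel)"
        proof (intro nn_integral_mono)
          fix t :: real
          show "ennreal (cmod (f t - f x)) * indicator {x-h..x+h} t \<le>
             ennreal (g c k n t) * indicator {x-h..x+h} t + ennreal (2/Suc k) * indicator {x-h..x+h} t"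
          proof (cases "t \<in> {x-h..x+h}")
            case True
            then have "\<bar>t\<bar> \<le> n" using n h by auto
            have "cmod (f t - f x) \<le> cmod (f t - c) + cmod (f x - c)"
              by (metis norm_minus_commute norm_triangle_sub add.commute diff_add_cancel norm_triangle_ineq4 diff_diff_eq2)
            also have "\<dots> \<le> g c k n t + 2/Suc k" using c \<open>\<bar>t\<bar> \<le> n\<close> by (simp add: g_def)
            finally have "ennreal (cmod (f t - f x)) \<le> ennreal (g c k n t + 2/Suc k)" by (rule ennreal_leI)
            also have "\<dots> \<le> ennreal (g c k n t) + ennreal (2/Suc k)"
              by (cases "g c k n t \<ge> 0") (auto simp: ennreal_plus[symmetric] ennreal_neg simp del: ennreal_plus intro!: ennreal_leI)
            finally show ?thesis using True by simp
          qed simp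
        qed
        also have "\<dots> = (\<integral>\<^sup>+t. ennreal (g c k n t) * indicator {x-h..x+h} t \<partial>lborel) + ennreal (2/Suc k) * ennreal (2*h)"
          using h by (subst nn_integral_add) (auto simp: nn_integral_cmult g_def)
        also have "\<dots> \<le> ennreal (1/Suc k * h) + ennreal (2/Suc k) * ennreal (2*h)"
          using d h by (intro add_mono) auto
        also have "\<dots> = ennreal (5 * (1/Suc k) * h)"
          using h by (simp add: ennreal_plus[symmetric] ennreal_mult[symmetric] del: ennreal_plus)
        also have "\<dots> \<le> ennreal (e * h)" using k h by (intro ennreal_leI mult_right_mono) auto
        finally show ?thesis .
      qed
      then show "\<exists>d>0. \<forall>h. 0 < h \<and> h < d \<longrightarrow>
         (\<integral>\<^sup>+t. ennreal (cmod (f t - f x)) * indicator {x-h..x+h} t \<partial>lborel) \<le> ennreal (e * h)"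
        using d(1) by - (rule exI[of _ "min d 1"], auto)
    qed
  qed
qed

section \<open>The Poisson kernel at a Lebesgue point\<close>

text \<open>The Poisson kernel without the factor 1 / pi, so its total mass is pi.\<close>

definition pker :: "real \<Rightarrow> real \<Rightarrow> real" where
  "pker \<epsilon> v = \<epsilon> / (\<epsilon>\<^sup>2 + v\<^sup>2)"

lemma pker_measurable [measurable]: "pker \<epsilon> \<in> borel_measurable borel"
  unfolding pker_def[abs_def] by measurable

lemma pker_nonneg: "0 \<le> \<epsilon> \<Longrightarrow> 0 \<le> pker \<epsilon> v"
  by (simp add: pker_def)

lemma pker_minus: "pker \<epsilon> (- v) = pker \<epsilon> v"
  by (simp add: pker_def)

lemma sum_sq_pos: "0 < \<epsilon> \<Longrightarrow> 0 < \<epsilon>\<^sup>2 + (v::real)\<^sup>2"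
  by (simp add: sum_power2_gt_zero_iff)

lemma nn_integral_even:
  fixes f :: "real \<Rightarrow> ennreal"
  assumes [measurable]: "f \<in> borel_measurable borel" and even: "\<And>x. f (- x) = f x"
  shows "(\<integral>\<^sup>+x. f x \<partial>lborel) = 2 * (\<integral>\<^sup>+x. f x * indicator {0..} x \<partial>lborel)"
proof -
  have 1: "(\<integral>\<^sup>+x. f x * indicator {..0} x \<partial>lborel) = (\<integral>\<^sup>+x. f x * indicator {0..} x \<partial>lborel)"
  proof -
    have "(\<integral>\<^sup>+x. f x * indicator {..0} x \<partial>lborel) =
      ennreal \<bar>- 1\<bar> * (\<integral>\<^sup>+x. f (0 + (- 1) * x) * indicator {..0} (0 + (- 1) * x) \<partial>lborel)"
      by (rule nn_integral_real_affine[of "\<lambda>x. f x * indicator {..0} x" "- 1" 0]) simp_all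
    also have "(\<integral>\<^sup>+x. f (0 + (- 1) * x) * indicator {..0} (0 + (- 1) * x) \<partial>lborel) =
      (\<integral>\<^sup>+x. f x * indicator {0..} x \<partial>lborel)"
      by (rule nn_integral_cong) (use even in \<open>simp add: indicator_def\<close>)
    finally show ?thesis by simp
  qed
  have "(\<integral>\<^sup>+x. f x \<partial>lborel) = (\<integral>\<^sup>+x. f x * indicator {..0} x + f x * indicator {0..} x \<partial>lborel)"
    by (intro nn_integral_cong_AE eventually_mono[OF AE_lborel_singleton[of 0]]) (auto simp: indicator_def)
  also have "\<dots> = 2 * (\<integral>\<^sup>+x. f x * indicator {0..} x \<partial>lborel)"
    by (subst nn_integral_add) (auto simp: 1 mult_2)
  finally show ?thesis .
qed

lemma nn_integral_pker:
  assumes "\<epsilon> > 0"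
  shows "(\<integral>\<^sup>+v. ennreal (pker \<epsilon> v) \<partial>lborel) = ennreal pi"
proof -
  have "(\<integral>\<^sup>+v. ennreal (pker \<epsilon> v) * indicator {0..} v \<partial>lborel) = ennreal (pi/2 - arctan (0/\<epsilon>))"
  proof (intro nn_integral_FTC_atLeast)
    fix x :: real
    have "((\<lambda>v. arctan (v/\<epsilon>)) has_real_derivative inverse (1 + (x/\<epsilon>)\<^sup>2) * (1/\<epsilon>)) (at x)"
      by (rule DERIV_chain2[where g = "\<lambda>v. v/\<epsilon>", OF DERIV_arctan DERIV_cdivide[OF DERIV_ident]])
    moreover have "inverse (1 + (x/\<epsilon>)\<^sup>2) = \<epsilon>\<^sup>2 / (\<epsilon>\<^sup>2 + x\<^sup>2)"
      using assms by (simp add: power_divide divide_simps)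
    ultimately show "((\<lambda>v. arctan (v/\<epsilon>)) has_real_derivative pker \<epsilon> x) (at x)"
      using assms by (simp add: pker_def power2_eq_square)
    show "0 \<le> pker \<epsilon> x" using assms by (simp add: pker_nonneg)
    have "filterlim (\<lambda>v. v * inverse \<epsilon>) at_top at_top"
      using assms by (intro filterlim_at_top_mult_tendsto_pos[OF tendsto_const _ filterlim_ident]) simp
    then show "((\<lambda>v. arctan (v/\<epsilon>)) \<longlongrightarrow> pi/2) at_top"
      unfolding divide_inverse[of _ \<epsilon>] by (rule filterlim_compose[OF tendsto_arctan_at_top])
  qed simp
  then show ?thesis
    by (subst nn_integral_even) (auto simp: pker_minus numeral_mult_ennreal)
qed

lemma nn_integral_pker_shift:
  assumes "\<epsilon> > 0"
  shows "(\<integral>\<^sup>+t. ennreal (pker \<epsilon> (t - x)) \<partial>lborel) = ennreal pi"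
  using nn_integral_pker[OF assms] nn_integral_real_affine[of "\<lambda>v. ennreal (pker \<epsilon> v)" 1 "-x"] by simp

lemma integrable_pker_shift:
  assumes "\<epsilon> > 0"
  shows "integrable lborel (\<lambda>t. pker \<epsilon> (t - x))" "(LINT t|lborel. pker \<epsilon> (t - x)) = pi"
proof -
  show "integrable lborel (\<lambda>t. pker \<epsilon> (t - x))"
    using nn_integral_pker_shift[OF assms, of x] assms
    by (intro integrableI_nonneg) (auto simp: pker_nonneg)
  show "(LINT t|lborel. pker \<epsilon> (t - x)) = pi"
    using nn_integral_pker_shift[OF assms, of x] assms
    by (intro integral_eq_nn_integral[THEN trans]) (auto simp: pker_nonneg)
qed

text \<open>Layer-cake argument: the kernel is even and decreasing in the distance, hence a
  superposition of indicators of symmetric windows. Tonelli then reduces the weighted integral to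
  the averages that the hypothesis controls.\<close>

lemma pker_near:
  fixes \<phi> :: "real \<Rightarrow> real"
  assumes [measurable]: "\<phi> \<in> borel_measurable borel" and "\<epsilon> > 0" "\<eta> > 0" "e \<ge> 0"
    and av: "\<And>h. 0 < h \<Longrightarrow> h \<le> \<eta> \<Longrightarrow> (\<integral>\<^sup>+t. ennreal (\<phi> t) * indicator {x-h..x+h} t \<partial>lborel) \<le> ennreal (e * h)"
  shows "(\<integral>\<^sup>+t. ennreal (pker \<epsilon> (t - x)) * (ennreal (\<phi> t) * indicator {x-\<eta>..x+\<eta>} t) \<partial>lborel) \<le> ennreal (4 * e)"
proof -
  \<comment> \<open>Minus the derivative of \<open>pker \<epsilon>\<close> at r, so that
    \<open>pker \<epsilon> v\<close> is its integral over r \<ge> \<bar>v\<bar>.\<close>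
  let ?k = "\<lambda>r. 2 * \<epsilon> * r / (\<epsilon>\<^sup>2 + r\<^sup>2)\<^sup>2"
  have pos: "\<epsilon>\<^sup>2 + r\<^sup>2 > 0" for r using sum_sq_pos[OF \<open>\<epsilon> > 0\<close>] .
  have layer: "(\<integral>\<^sup>+r. ennreal (?k r) * indicator {\<bar>v\<bar>..} r \<partial>lborel) = ennreal (pker \<epsilon> v)" for v
  proof -
    have "(\<integral>\<^sup>+r. ennreal (?k r) * indicator {\<bar>v\<bar>..} r \<partial>lborel) = ennreal (0 - (- pker \<epsilon> \<bar>v\<bar>))"
    proof (rule nn_integral_FTC_atLeast[where F = "\<lambda>r. - pker \<epsilon> r"])
      fix r :: real assume "\<bar>v\<bar> \<le> r"
      then show "0 \<le> ?k r" using \<open>\<epsilon> > 0\<close> by simp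
      show "((\<lambda>r. - pker \<epsilon> r) has_real_derivative ?k r) (at r)"
        unfolding pker_def using pos[of r]
        by (auto intro!: derivative_eq_intros simp: power2_eq_square)
    next
      have "((\<lambda>r. - (\<epsilon> / (\<epsilon>\<^sup>2 + r\<^sup>2))) \<longlongrightarrow> - 0) at_top"
        by (intro tendsto_minus tendsto_divide_0[OF tendsto_const] filterlim_at_top_imp_at_infinity
            filterlim_tendsto_add_at_top[OF tendsto_const] filterlim_pow_at_top filterlim_ident) simp
      then show "((\<lambda>r. - pker \<epsilon> r) \<longlongrightarrow> 0) at_top" by (simp add: pker_def)
    qed simp
    then show ?thesis by (simp add: pker_def)
  qed
  have "(\<integral>\<^sup>+t. ennreal (pker \<epsilon> (t - x)) * (ennreal (\<phi> t) * indicator {x-\<eta>..x+\<eta>} t) \<partial>lborel) =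
     (\<integral>\<^sup>+t. (\<integral>\<^sup>+r. ennreal (?k r) * indicator {0..} (r - \<bar>t-x\<bar>) * (ennreal (\<phi> t) * indicator {x-\<eta>..x+\<eta>} t) \<partial>lborel) \<partial>lborel)"
    by (subst layer[symmetric], subst nn_integral_multc[symmetric])
       (auto intro!: nn_integral_cong simp: indicator_def)
  also have "\<dots> = (\<integral>\<^sup>+r. (\<integral>\<^sup>+t. ennreal (?k r) * indicator {0..} (r - \<bar>t-x\<bar>) * (ennreal (\<phi> t) * indicator {x-\<eta>..x+\<eta>} t) \<partial>lborel) \<partial>lborel)"
    by (intro lborel_pair.Fubini') measurable
  also have "\<dots> \<le> (\<integral>\<^sup>+r. ennreal e * (ennreal (2 * \<epsilon> * r\<^sup>2 / (\<epsilon>\<^sup>2 + r\<^sup>2)\<^sup>2) * indicator {0..} r) \<partial>lborel)"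
  proof (intro nn_integral_mono)
    fix r :: real
    have "(\<integral>\<^sup>+t. ennreal (?k r) * indicator {0..} (r - \<bar>t-x\<bar>) * (ennreal (\<phi> t) * indicator {x-\<eta>..x+\<eta>} t) \<partial>lborel)
       = ennreal (?k r) * (\<integral>\<^sup>+t. ennreal (\<phi> t) * indicator {x-min r \<eta>..x+min r \<eta>} t \<partial>lborel)"
      by (subst nn_integral_cmult[symmetric]) (auto intro!: nn_integral_cong simp: indicator_def abs_le_iff)
    also have "\<dots> \<le> ennreal e * (ennreal (2 * \<epsilon> * r\<^sup>2 / (\<epsilon>\<^sup>2 + r\<^sup>2)\<^sup>2) * indicator {0..} r)"
    proof (cases "r > 0")
      case True
      have "ennreal (?k r) * (\<integral>\<^sup>+t. ennreal (\<phi> t) * indicator {x-min r \<eta>..x+min r \<eta>} t \<partial>lborel)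
        \<le> ennreal (?k r) * ennreal (e * min r \<eta>)"
        using True \<open>\<eta> > 0\<close> by (intro mult_left_mono av) auto
      also have "\<dots> \<le> ennreal (?k r) * ennreal (e * r)"
        using True \<open>e \<ge> 0\<close> by (intro mult_left_mono ennreal_leI) auto
      also have "\<dots> = ennreal e * ennreal (2 * \<epsilon> * r\<^sup>2 / (\<epsilon>\<^sup>2 + r\<^sup>2)\<^sup>2)"
        using True \<open>e \<ge> 0\<close> \<open>\<epsilon> > 0\<close> by (subst (1 2) ennreal_mult[symmetric]) (auto simp: field_simps power2_eq_square)
      finally show ?thesis using True by simp
    next
      \<comment> \<open>For r \<le> 0 the weight is nonpositive and \<open>ennreal\<close> sends it
        to 0.\<close>
      case False
      then have "?k r \<le> 0" using \<open>\<epsilon> > 0\<close> by (auto simp: divide_nonpos_nonneg mult_nonneg_nonpos)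
      then show ?thesis by (simp add: ennreal_neg)
    qed
    finally show "(\<integral>\<^sup>+t. ennreal (?k r) * indicator {0..} (r - \<bar>t-x\<bar>) * (ennreal (\<phi> t) * indicator {x-\<eta>..x+\<eta>} t) \<partial>lborel)
       \<le> ennreal e * (ennreal (2 * \<epsilon> * r\<^sup>2 / (\<epsilon>\<^sup>2 + r\<^sup>2)\<^sup>2) * indicator {0..} r)" .
  qed
  also have "\<dots> = ennreal e * (\<integral>\<^sup>+r. ennreal (2 * \<epsilon> * r\<^sup>2 / (\<epsilon>\<^sup>2 + r\<^sup>2)\<^sup>2) * indicator {0..} r \<partial>lborel)"
    by (rule nn_integral_cmult) measurable
  \<comment> \<open>Bounding one factor \<open>r\<^sup>2\<close> by
    \<open>\<epsilon>\<^sup>2 + r\<^sup>2\<close> leaves twice the Poisson kernel, whose half-line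
    integral is pi; the 4 in the claim only rounds pi up.\<close>
  also have "\<dots> \<le> ennreal e * ennreal pi"
  proof (intro mult_left_mono)
    have "(\<integral>\<^sup>+r. ennreal (2 * \<epsilon> * r\<^sup>2 / (\<epsilon>\<^sup>2 + r\<^sup>2)\<^sup>2) * indicator {0..} r \<partial>lborel)
       \<le> (\<integral>\<^sup>+r. ennreal 2 * (ennreal (pker \<epsilon> r) * indicator {0..} r) \<partial>lborel)"
    proof (intro nn_integral_mono)
      fix r :: real
      have "2 * \<epsilon> * r\<^sup>2 / (\<epsilon>\<^sup>2 + r\<^sup>2)\<^sup>2 \<le> 2 * \<epsilon> * (\<epsilon>\<^sup>2 + r\<^sup>2) / (\<epsilon>\<^sup>2 + r\<^sup>2)\<^sup>2"
        using \<open>\<epsilon> > 0\<close> by (intro divide_right_mono mult_left_mono) auto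
      also have "\<dots> = 2 * pker \<epsilon> r" using pos[of r] by (simp add: pker_def power2_eq_square)
      finally show "ennreal (2 * \<epsilon> * r\<^sup>2 / (\<epsilon>\<^sup>2 + r\<^sup>2)\<^sup>2) * indicator {0..} r \<le> ennreal 2 * (ennreal (pker \<epsilon> r) * indicator {0..} r)"
        using \<open>\<epsilon> > 0\<close> by (auto simp: indicator_def ennreal_mult[symmetric] pker_nonneg simp del: ennreal_numeral intro!: ennreal_leI)
    qed
    also have "\<dots> = 2 * (\<integral>\<^sup>+r. ennreal (pker \<epsilon> r) * indicator {0..} r \<partial>lborel)"
      by (subst nn_integral_cmult) auto
    also have "\<dots> = ennreal pi"
      using nn_integral_even[of "\<lambda>v. ennreal (pker \<epsilon> v)"] nn_integral_pker[OF \<open>\<epsilon> > 0\<close>] by (simp add: pker_minus)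
    finally show "(\<integral>\<^sup>+r. ennreal (2 * \<epsilon> * r\<^sup>2 / (\<epsilon>\<^sup>2 + r\<^sup>2)\<^sup>2) * indicator {0..} r \<partial>lborel) \<le> ennreal pi" .
  qed simp
  also have "\<dots> \<le> ennreal (4 * e)"
    using mult_left_mono[OF less_imp_le[OF pi_less_4] \<open>e \<ge> 0\<close>] \<open>e \<ge> 0\<close>
    by (subst ennreal_mult[symmetric]) (auto intro!: ennreal_leI simp: mult.commute)
  finally show ?thesis .
qed

text \<open>Away from 0 the kernel is below \<epsilon> / v^2, and there 1 / v^2 is comparable with
  the fixed kernel \<open>pker 1\<close>. The explicit factor \<epsilon> makes distant contributions
  vanish.\<close>

lemma pker_far:
  assumes "\<epsilon> > 0" "\<eta> > 0" "\<eta> < \<bar>v\<bar>"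
  shows "pker \<epsilon> v \<le> \<epsilon> * ((1 + 1 / \<eta>\<^sup>2) * pker 1 v)"
proof -
  have v: "v\<^sup>2 > \<eta>\<^sup>2" using assms by (metis abs_of_pos power2_abs power_strict_mono order_less_imp_le zero_less_numeral)
  then have v0: "v\<^sup>2 > 0" using assms by (smt (verit) zero_less_power)
  have "1 + v\<^sup>2 \<le> (1 + 1/\<eta>\<^sup>2) * v\<^sup>2"
    using v assms by (simp add: field_simps)
  then have "1 \<le> (1 + 1/\<eta>\<^sup>2) * v\<^sup>2 / (1 + v\<^sup>2)"
    using sum_sq_pos[of 1 v] by (simp add: pos_le_divide_eq)
  then have "1 / v\<^sup>2 \<le> ((1 + 1/\<eta>\<^sup>2) * v\<^sup>2 / (1 + v\<^sup>2)) / v\<^sup>2"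
    by (rule divide_right_mono) simp
  also have "\<dots> = (1 + 1 / \<eta>\<^sup>2) * pker 1 v"
    using v0 by (simp add: pker_def)
  finally have "1 / v\<^sup>2 \<le> (1 + 1 / \<eta>\<^sup>2) * pker 1 v" .
  moreover have "1 / (\<epsilon>\<^sup>2 + v\<^sup>2) \<le> 1 / v\<^sup>2"
    using v0 assms by (intro divide_left_mono mult_pos_pos) (auto intro: add_pos_pos)
  ultimately have "1 / (\<epsilon>\<^sup>2 + v\<^sup>2) \<le> (1 + 1 / \<eta>\<^sup>2) * pker 1 v" by linarith
  then have "\<epsilon> * (1 / (\<epsilon>\<^sup>2 + v\<^sup>2)) \<le> \<epsilon> * ((1 + 1 / \<eta>\<^sup>2) * pker 1 v)"
    using assms by (intro mult_left_mono) auto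
  then show ?thesis by (simp add: pker_def)
qed

lemma pker_le_1: "pker 1 v \<le> 1"
  using sum_sq_pos[of 1 v] by (simp add: pker_def divide_le_eq_1)

text \<open>The part near x is controlled by the averages at the Lebesgue point. The distant part is
  of order \<epsilon>: since cmod (f t) is at most 1 plus its square and \<open>pker 1\<close> is at
  most 1, square integrability of f is all that is needed there.\<close>

lemma pker_approximate_identity:
  assumes [measurable]: "f \<in> borel_measurable borel"
    and fin: "(\<integral>\<^sup>+t. ennreal ((cmod (f t))\<^sup>2) \<partial>lborel) < \<infinity>"
    and pt: "lebesgue_pt f x"
  shows "((\<lambda>\<epsilon>. \<integral>\<^sup>+t. ennreal (pker \<epsilon> (t - x) * cmod (f t - f x)) \<partial>lborel) \<longlongrightarrow> 0) (at_right 0)"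
proof (rule order_tendstoI)
  fix y :: ennreal assume "0 < y"
  obtain e :: real where e: "e > 0" "ennreal e < y"
  proof -
    obtain z where z: "0 < z" "z < y" using dense[OF \<open>0 < y\<close>] by blast
    then obtain r where "z = ennreal r" "r \<ge> 0" by (cases z) auto
    with z show ?thesis by (intro that[of r]) auto
  qed
  \<comment> \<open>The near estimate multiplies the average bound by 4, so e / 8 uses up e / 2 and
    leaves e / 2 for the distant part.\<close>
  have "e / 8 > 0" using e by simp
  with pt obtain d where d: "d > 0" "\<And>h. 0 < h \<Longrightarrow> h < d \<Longrightarrow>
     (\<integral>\<^sup>+t. ennreal (cmod (f t - f x)) * indicator {x-h..x+h} t \<partial>lborel) \<le> ennreal (e / 8 * h)"
    unfolding lebesgue_pt_def by meson
  \<comment> \<open>The Lebesgue condition holds for radii strictly below d, while the near estimate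
    includes the radius \<eta> itself.\<close>
  define \<eta> where "\<eta> = d / 2"
  have \<eta>: "\<eta> > 0" "\<And>h. 0 < h \<Longrightarrow> h \<le> \<eta> \<Longrightarrow>
     (\<integral>\<^sup>+t. ennreal (cmod (f t - f x)) * indicator {x-h..x+h} t \<partial>lborel) \<le> ennreal (e / 8 * h)"
    using d by (auto simp: \<eta>_def)
  define C where "C = (\<integral>\<^sup>+t. ennreal ((cmod (f t))\<^sup>2) \<partial>lborel) + ennreal (1 + cmod (f x)) * ennreal pi"
  have "C < top" using fin by (simp add: C_def ennreal_mult_less_top)
  then obtain c where c: "C = ennreal c" "c \<ge> 0" by (cases C) auto
  define c' where "c' = (1 + 1/\<eta>\<^sup>2) * c"
  have "c' \<ge> 0" using c by (simp add: c'_def)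
  have far: "(\<integral>\<^sup>+t. ennreal (pker \<epsilon> (t - x) * cmod (f t - f x)) * indicator (- {x-\<eta>..x+\<eta>}) t \<partial>lborel) \<le> ennreal (\<epsilon> * c')"
    if "\<epsilon> > 0" for \<epsilon>
  proof -
    have "(\<integral>\<^sup>+t. ennreal (pker \<epsilon> (t - x) * cmod (f t - f x)) * indicator (- {x-\<eta>..x+\<eta>}) t \<partial>lborel) \<le>
       (\<integral>\<^sup>+t. ennreal (\<epsilon> * (1 + 1/\<eta>\<^sup>2)) * (ennreal ((cmod (f t))\<^sup>2) + ennreal (1 + cmod (f x)) * ennreal (pker 1 (t - x))) \<partial>lborel)"
    proof (intro nn_integral_mono)
      fix t :: real
      show "ennreal (pker \<epsilon> (t - x) * cmod (f t - f x)) * indicator (- {x-\<eta>..x+\<eta>}) t \<le>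
         ennreal (\<epsilon> * (1 + 1/\<eta>\<^sup>2)) * (ennreal ((cmod (f t))\<^sup>2) + ennreal (1 + cmod (f x)) * ennreal (pker 1 (t - x)))"
      proof (cases "t \<in> {x-\<eta>..x+\<eta>}")
        case False
        then have "\<eta> < \<bar>t - x\<bar>" by auto
        have "cmod (f t) \<le> 1 + (cmod (f t))\<^sup>2"
          by (smt (verit) norm_ge_zero power2_eq_square mult_left_le_one_le self_le_power zero_le_power2 one_le_power power_one_right pos2)
        then have "cmod (f t - f x) \<le> (cmod (f t))\<^sup>2 + (1 + cmod (f x))"
          using norm_triangle_ineq4[of "f t" "f x"] by linarith
        then have "pker 1 (t - x) * cmod (f t - f x) \<le> pker 1 (t-x) * ((cmod (f t))\<^sup>2 + (1 + cmod (f x)))"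
          by (intro mult_left_mono) (auto simp: pker_nonneg)
        also have "\<dots> \<le> (cmod (f t))\<^sup>2 + (1 + cmod (f x)) * pker 1 (t - x)"
          using mult_right_mono[OF pker_le_1[of "t-x"], of "(cmod (f t))\<^sup>2"] by (simp add: algebra_simps)
        finally have *: "pker 1 (t - x) * cmod (f t - f x) \<le> (cmod (f t))\<^sup>2 + (1 + cmod (f x)) * pker 1 (t - x)" .
        have "pker \<epsilon> (t - x) * cmod (f t - f x) \<le> (\<epsilon> * ((1 + 1 / \<eta>\<^sup>2) * pker 1 (t-x))) * cmod (f t - f x)"
          using pker_far[OF that \<eta>(1) \<open>\<eta> < \<bar>t - x\<bar>\<close>] by (intro mult_right_mono) auto
        also have "\<dots> = (\<epsilon> * (1 + 1 / \<eta>\<^sup>2)) * (pker 1 (t-x) * cmod (f t - f x))" by (simp add: mult_ac)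
        also have "\<dots> \<le> (\<epsilon> * (1 + 1 / \<eta>\<^sup>2)) * ((cmod (f t))\<^sup>2 + (1 + cmod (f x)) * pker 1 (t - x))"
          using that by (intro mult_left_mono *) auto
        finally have "ennreal (pker \<epsilon> (t - x) * cmod (f t - f x)) \<le>
           ennreal ((\<epsilon> * (1 + 1 / \<eta>\<^sup>2)) * ((cmod (f t))\<^sup>2 + (1 + cmod (f x)) * pker 1 (t - x)))" by (rule ennreal_leI)
        also have "\<dots> = ennreal (\<epsilon> * (1 + 1/\<eta>\<^sup>2)) * (ennreal ((cmod (f t))\<^sup>2) + ennreal (1 + cmod (f x)) * ennreal (pker 1 (t - x)))"
          using that by (subst ennreal_mult, simp, simp add: pker_nonneg, subst ennreal_plus)
             (simp_all add: pker_nonneg ennreal_mult del: ennreal_plus)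
        finally show ?thesis using False by (simp add: indicator_def)
      qed simp
    qed
    also have "\<dots> = ennreal (\<epsilon> * (1 + 1/\<eta>\<^sup>2)) * C"
      unfolding C_def nn_integral_pker_shift[OF zero_less_one, of x, symmetric]
      by (subst nn_integral_cmult, simp, subst nn_integral_add, simp, simp, subst nn_integral_cmult, simp_all)
    also have "\<dots> = ennreal (\<epsilon> * c')"
      using that c by (simp add: c'_def ennreal_mult[symmetric] mult.assoc)
    finally show ?thesis .
  qed
  \<comment> \<open>The threshold makes \<epsilon> * c' at most e / 2; the summand 1 keeps the
    quotient meaningful when c' = 0.\<close>
  have bound: "(\<integral>\<^sup>+t. ennreal (pker \<epsilon> (t - x) * cmod (f t - f x)) \<partial>lborel) \<le> ennreal e"
    if \<epsilon>: "0 < \<epsilon>" "\<epsilon> < e / (2 * (c' + 1))" for \<epsilon>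
  proof -
    have "(\<integral>\<^sup>+t. ennreal (pker \<epsilon> (t - x) * cmod (f t - f x)) \<partial>lborel) =
      (\<integral>\<^sup>+t. ennreal (pker \<epsilon> (t - x)) * (ennreal (cmod (f t - f x)) * indicator {x-\<eta>..x+\<eta>} t)
        + ennreal (pker \<epsilon> (t - x) * cmod (f t - f x)) * indicator (- {x-\<eta>..x+\<eta>}) t \<partial>lborel)"
      using \<epsilon>(1) by (intro nn_integral_cong) (auto simp: indicator_def ennreal_mult pker_nonneg)
    also have "\<dots> = (\<integral>\<^sup>+t. ennreal (pker \<epsilon> (t - x)) * (ennreal (cmod (f t - f x)) * indicator {x-\<eta>..x+\<eta>} t) \<partial>lborel)
        + (\<integral>\<^sup>+t. ennreal (pker \<epsilon> (t - x) * cmod (f t - f x)) * indicator (- {x-\<eta>..x+\<eta>}) t \<partial>lborel)"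
      by (rule nn_integral_add) measurable
    also have "\<dots> \<le> ennreal (4 * (e/8)) + ennreal (\<epsilon> * c')"
      using \<epsilon>(1) \<eta> e(1) by (intro add_mono far pker_near) auto
    also have "\<dots> = ennreal (e/2 + \<epsilon> * c')"
      using \<epsilon>(1) e(1) \<open>c' \<ge> 0\<close> by (subst ennreal_plus[symmetric]) auto
    also have "\<dots> \<le> ennreal e"
    proof (rule ennreal_leI)
      have "\<epsilon> * (2 * (c' + 1)) < e" using \<epsilon> \<open>c' \<ge> 0\<close> by (simp add: pos_less_divide_eq)
      then show "e/2 + \<epsilon> * c' \<le> e" using \<epsilon>(1) by (simp add: algebra_simps)
    qed
    finally show ?thesis .
  qed
  have "e / (2 * (c' + 1)) > 0" using e(1) \<open>c' \<ge> 0\<close> by simp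
  then have "\<forall>\<^sub>F \<epsilon> in at_right 0. \<epsilon> \<in> {0<..<e / (2 * (c' + 1))}" by (rule eventually_at_right_real)
  then show "\<forall>\<^sub>F \<epsilon> in at_right 0. (\<integral>\<^sup>+t. ennreal (pker \<epsilon> (t - x) * cmod (f t - f x)) \<partial>lborel) < y"
    by eventually_elim (use bound e(2) in \<open>auto intro: le_less_trans\<close>)
qed simp

text \<open>Formulated for any family dominated by the Poisson kernel, since it serves twice: for
  the Poisson kernel itself and for the difference between the truncated kernel 1 / v and the
  conjugate Poisson kernel. A non-integrable integrand has integral 0, so the norm bound holds in
  that case too.\<close>

lemma pker_dominated_tendsto:
  assumes [measurable]: "f \<in> borel_measurable borel"
    and fin: "(\<integral>\<^sup>+t. ennreal ((cmod (f t))\<^sup>2) \<partial>lborel) < \<infinity>"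
    and pt: "lebesgue_pt f x"
    and k: "\<And>\<epsilon> t. \<epsilon> > 0 \<Longrightarrow> cmod (k \<epsilon> t) \<le> pker \<epsilon> (t - x)"
  shows "((\<lambda>\<epsilon>. LINT t|lborel. k \<epsilon> t * (f t - f x)) \<longlongrightarrow> 0) (at_right 0)"
proof -
  have le: "ennreal (cmod (LINT t|lborel. k \<epsilon> t * (f t - f x))) \<le> (\<integral>\<^sup>+t. ennreal (pker \<epsilon> (t - x) * cmod (f t - f x)) \<partial>lborel)"
    if "\<epsilon> > 0" for \<epsilon>
  proof (cases "integrable lborel (\<lambda>t. k \<epsilon> t * (f t - f x))")
    case True
    then have "ennreal (cmod (LINT t|lborel. k \<epsilon> t * (f t - f x))) \<le> (\<integral>\<^sup>+t. ennreal (cmod (k \<epsilon> t * (f t - f x))) \<partial>lborel)"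
      by (rule integral_norm_bound_ennreal)
    also have "\<dots> \<le> (\<integral>\<^sup>+t. ennreal (pker \<epsilon> (t - x) * cmod (f t - f x)) \<partial>lborel)"
      using k[OF that] by (intro nn_integral_mono ennreal_leI) (simp add: norm_mult mult_right_mono)
    finally show ?thesis .
  qed (simp add: not_integrable_integral_eq)
  have "((\<lambda>\<epsilon>. ennreal (cmod (LINT t|lborel. k \<epsilon> t * (f t - f x)))) \<longlongrightarrow> 0) (at_right 0)"
  proof (rule tendsto_sandwich[OF _ _ tendsto_const pker_approximate_identity[OF assms(1-3)]])
    show "\<forall>\<^sub>F \<epsilon> in at_right 0. ennreal (cmod (LINT t|lborel. k \<epsilon> t * (f t - f x))) \<le> (\<integral>\<^sup>+t. ennreal (pker \<epsilon> (t - x) * cmod (f t - f x)) \<partial>lborel)"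
      using eventually_at_right_less[of "0::real"] by eventually_elim (rule le)
  qed simp
  then have "((\<lambda>\<epsilon>. cmod (LINT t|lborel. k \<epsilon> t * (f t - f x))) \<longlongrightarrow> 0) (at_right 0)"
    by (subst (asm) ennreal_0[symmetric], subst (asm) tendsto_ennreal_iff) auto
  then show ?thesis by (simp add: tendsto_norm_zero_iff)
qed

section \<open>Square-integrable functions\<close>

text \<open>The squared norm is used throughout, which avoids square roots. The triangle inequality
  then carries factors 2, harmless because it only serves to show that something tends to 0.\<close>

definition sqn :: "'a measure \<Rightarrow> ('a \<Rightarrow> complex) \<Rightarrow> real" where
  "sqn M f = (LINT x|M. (cmod (f x))\<^sup>2)"

definition l2inner :: "'a measure \<Rightarrow> ('a \<Rightarrow> complex) \<Rightarrow> ('a \<Rightarrow> complex) \<Rightarrow> complex" where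
  "l2inner M f g = (LINT x|M. cnj (f x) * g x)"

lemma borel_measurable_cnj [measurable (raw)]:
  "f \<in> borel_measurable M \<Longrightarrow> (\<lambda>x. cnj (f x)) \<in> borel_measurable M"
  by (rule measurable_compose[OF _ borel_measurable_continuous_onI]) (auto intro: continuous_intros)

lemma sq_integrableD:
  assumes "f \<in> sq_integrable M"
  shows "f \<in> borel_measurable M" "integrable M (\<lambda>x. (cmod (f x))\<^sup>2)"
  using assms by (auto simp: sq_integrable_def)

lemma sq_integrableI:
  assumes "f \<in> borel_measurable M" "(\<integral>\<^sup>+x. ennreal ((cmod (f x))\<^sup>2) \<partial>M) < \<infinity>"
  shows "f \<in> sq_integrable M"
  using assms by (auto simp: sq_integrable_def intro!: integrableI_nonneg)

lemma nn_integral_sqn: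
  assumes "f \<in> sq_integrable M"
  shows "(\<integral>\<^sup>+x. ennreal ((cmod (f x))\<^sup>2) \<partial>M) = ennreal (sqn M f)"
  unfolding sqn_def using sq_integrableD[OF assms] by (intro nn_integral_eq_integral) auto

lemma sqn_nonneg: "0 \<le> sqn M f"
  by (simp add: sqn_def)

lemma sq_integrable_bound:
  assumes "g \<in> sq_integrable M" "f \<in> borel_measurable M" "AE x in M. cmod (f x) \<le> C * cmod (g x)"
  shows "f \<in> sq_integrable M"
proof -
  have "integrable M (\<lambda>x. C\<^sup>2 * (cmod (g x))\<^sup>2)" using sq_integrableD[OF assms(1)] by simp
  then have "integrable M (\<lambda>x. (cmod (f x))\<^sup>2)"
  proof (rule Bochner_Integration.integrable_bound)
    show "AE x in M. norm ((cmod (f x))\<^sup>2) \<le> norm (C\<^sup>2 * (cmod (g x))\<^sup>2)"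
      using assms(3) by eventually_elim (simp add: power_mult_distrib[symmetric] power_mono)
  qed (use assms(2) in simp)
  then show ?thesis using assms(2) by (simp add: sq_integrable_def)
qed

lemma sq_integrable_cong_AE:
  assumes "g \<in> sq_integrable M" "f \<in> borel_measurable M" "AE x in M. f x = g x"
  shows "f \<in> sq_integrable M"
  by (rule sq_integrable_bound[OF assms(1,2), of 1]) (use assms(3) in auto)

lemma sq_integrable_scale: "f \<in> sq_integrable M \<Longrightarrow> (\<lambda>x. c * f x) \<in> sq_integrable M"
  by (frule sq_integrableD(1), rule sq_integrable_bound[where C="cmod c" and g=f]) (auto simp: norm_mult)

lemma sq_integrable_cnj: "f \<in> sq_integrable M \<Longrightarrow> (\<lambda>x. cnj (f x)) \<in> sq_integrable M"
  by (frule sq_integrableD(1), rule sq_integrable_bound[where C=1 and g=f]) auto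

lemma cmod_add_sq_le: "(cmod (a + b))\<^sup>2 \<le> 2 * (cmod a)\<^sup>2 + 2 * (cmod b)\<^sup>2"
proof -
  have "(cmod (a + b))\<^sup>2 \<le> (cmod a + cmod b)\<^sup>2" by (intro power_mono norm_triangle_ineq) auto
  also have "\<dots> \<le> 2 * (cmod a)\<^sup>2 + 2 * (cmod b)\<^sup>2"
    using zero_le_power2[of "cmod a - cmod b"] by (simp add: power2_eq_square algebra_simps)
  finally show ?thesis .
qed

lemma sq_integrable_add:
  assumes "f \<in> sq_integrable M" "g \<in> sq_integrable M"
  shows "(\<lambda>x. f x + g x) \<in> sq_integrable M"
proof -
  note [measurable] = sq_integrableD(1)[OF assms(1)] sq_integrableD(1)[OF assms(2)]
  have "integrable M (\<lambda>x. 2 * (cmod (f x))\<^sup>2 + 2 * (cmod (g x))\<^sup>2)"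
    using sq_integrableD[OF assms(1)] sq_integrableD[OF assms(2)] by simp
  then have "integrable M (\<lambda>x. (cmod (f x + g x))\<^sup>2)"
    by (rule Bochner_Integration.integrable_bound) (use cmod_add_sq_le in auto)
  then show ?thesis by (simp add: sq_integrable_def)
qed

lemma sq_integrable_minus: "f \<in> sq_integrable M \<Longrightarrow> (\<lambda>x. - f x) \<in> sq_integrable M"
  using sq_integrable_scale[of f M "-1"] by simp

lemma sq_integrable_diff:
  "f \<in> sq_integrable M \<Longrightarrow> g \<in> sq_integrable M \<Longrightarrow> (\<lambda>x. f x - g x) \<in> sq_integrable M"
  using sq_integrable_add[of f M "\<lambda>x. - g x"] sq_integrable_minus[of g M] by simp

lemma sq_integrable_lin:
  "f \<in> sq_integrable M \<Longrightarrow> g \<in> sq_integrable M \<Longrightarrow> (\<lambda>x. c * f x + g x) \<in> sq_integrable M"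
  by (intro sq_integrable_add sq_integrable_scale)

lemma integrable_l2mult:
  assumes "f \<in> sq_integrable M" "g \<in> sq_integrable M"
  shows "integrable M (\<lambda>x. f x * g x)"
proof -
  note [measurable] = sq_integrableD(1)[OF assms(1)] sq_integrableD(1)[OF assms(2)]
  have "integrable M (\<lambda>x. (cmod (f x))\<^sup>2 + (cmod (g x))\<^sup>2)"
    using sq_integrableD[OF assms(1)] sq_integrableD[OF assms(2)] by simp
  then show ?thesis
  proof (rule Bochner_Integration.integrable_bound)
    have "cmod a * cmod b \<le> (cmod a)\<^sup>2 + (cmod b)\<^sup>2" for a b
      using sum_squares_bound[of "cmod a" "cmod b"] mult_nonneg_nonneg[of "cmod a" "cmod b"]
      unfolding mult.assoc by (smt (verit) norm_ge_zero)
    then show "AE x in M. norm (f x * g x) \<le> norm ((cmod (f x))\<^sup>2 + (cmod (g x))\<^sup>2)"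
      by (simp add: norm_mult)
  qed simp
qed

lemma integrable_l2inner:
  "f \<in> sq_integrable M \<Longrightarrow> g \<in> sq_integrable M \<Longrightarrow> integrable M (\<lambda>x. cnj (f x) * g x)"
  by (intro integrable_l2mult sq_integrable_cnj)

lemma Cauchy_Schwarz_l2:
  assumes "f \<in> sq_integrable M" "g \<in> sq_integrable M"
  shows "(cmod (LINT x|M. f x * g x))\<^sup>2 \<le> sqn M f * sqn M g"
proof -
  note [measurable] = sq_integrableD(1)[OF assms(1)] sq_integrableD(1)[OF assms(2)]
  have "ennreal (cmod (LINT x|M. f x * g x)) \<le> (\<integral>\<^sup>+x. ennreal (cmod (f x)) * ennreal (cmod (g x)) \<partial>M)"
    using integral_norm_bound_ennreal[OF integrable_l2mult[OF assms]] by (simp add: norm_mult ennreal_mult)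
  then have "(ennreal (cmod (LINT x|M. f x * g x)))\<^sup>2 \<le> (\<integral>\<^sup>+x. ennreal (cmod (f x)) * ennreal (cmod (g x)) \<partial>M)\<^sup>2"
    by (intro power_mono) auto
  also have "\<dots> \<le> (\<integral>\<^sup>+x. ennreal (cmod (f x)) ^ 2 \<partial>M) * (\<integral>\<^sup>+x. ennreal (cmod (g x)) ^ 2 \<partial>M)"
    by (intro Cauchy_Schwarz_nn_integral) auto
  also have "\<dots> = ennreal (sqn M f * sqn M g)"
    using nn_integral_sqn[OF assms(1)] nn_integral_sqn[OF assms(2)] by (simp add: ennreal_power ennreal_mult sqn_nonneg)
  finally show ?thesis by (simp add: ennreal_power sqn_nonneg)
qed

lemma Cauchy_Schwarz_l2inner:
  assumes "f \<in> sq_integrable M" "g \<in> sq_integrable M"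
  shows "(cmod (l2inner M f g))\<^sup>2 \<le> sqn M f * sqn M g"
  using Cauchy_Schwarz_l2[OF sq_integrable_cnj[OF assms(1)] assms(2)] by (simp add: l2inner_def sqn_def)

lemma sqn_lin_expand:
  assumes "f \<in> sq_integrable M" "g \<in> sq_integrable M"
  shows "sqn M (\<lambda>x. c * f x + g x) = (cmod c)\<^sup>2 * sqn M f + 2 * Re (cnj c * l2inner M f g) + sqn M g"
proof -
  have "(cmod (c * a + b))\<^sup>2 = (cmod c)\<^sup>2 * (cmod a)\<^sup>2 + 2 * Re (cnj c * (cnj a * b)) + (cmod b)\<^sup>2" for a b
    unfolding cmod_power2 by (simp add: power2_eq_square algebra_simps)
  moreover define B where "B = (\<lambda>x. Re (cnj c * (cnj (f x) * g x)))"
  ultimately have "sqn M (\<lambda>x. c * f x + g x) =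
     (LINT x|M. (cmod c)\<^sup>2 * (cmod (f x))\<^sup>2 + 2 * B x + (cmod (g x))\<^sup>2)"
    by (simp add: sqn_def)
  also have "integrable M B"
    unfolding B_def using integrable_l2inner[OF assms] by (intro integrable_Re) simp
  then have "(LINT x|M. (cmod c)\<^sup>2 * (cmod (f x))\<^sup>2 + 2 * B x + (cmod (g x))\<^sup>2) =
      (cmod c)\<^sup>2 * sqn M f + 2 * (LINT x|M. B x) + sqn M g"
    using sq_integrableD[OF assms(1)] sq_integrableD[OF assms(2)] by (simp add: sqn_def)
  also have "(LINT x|M. B x) = (LINT x|M. Re (cnj c * (cnj (f x) * g x)))" by (simp add: B_def)
  also have "(LINT x|M. Re (cnj c * (cnj (f x) * g x))) = Re (LINT x|M. cnj c * (cnj (f x) * g x))"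
    using integrable_l2inner[OF assms] by (intro integral_Re) simp
  finally show ?thesis by (simp add: l2inner_def)
qed

lemma sqn_add_le:
  assumes "f \<in> sq_integrable M" "g \<in> sq_integrable M"
  shows "sqn M (\<lambda>x. f x + g x) \<le> 2 * sqn M f + 2 * sqn M g"
proof -
  have "sqn M (\<lambda>x. f x + g x) \<le> (LINT x|M. 2 * (cmod (f x))\<^sup>2 + 2 * (cmod (g x))\<^sup>2)"
    unfolding sqn_def
    using sq_integrableD[OF assms(1)] sq_integrableD[OF assms(2)] sq_integrableD[OF sq_integrable_add[OF assms]]
    by (intro integral_mono cmod_add_sq_le) auto
  then show ?thesis
    using sq_integrableD[OF assms(1)] sq_integrableD[OF assms(2)] by (simp add: sqn_def)
qed

lemma sqn_minus_commute: "sqn M (\<lambda>x. f x - g x) = sqn M (\<lambda>x. g x - f x)"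
  by (simp add: sqn_def norm_minus_commute)

lemma sqn_triangle:
  assumes "f \<in> sq_integrable M" "g \<in> sq_integrable M" "h \<in> sq_integrable M"
  shows "sqn M (\<lambda>x. f x - h x) \<le> 2 * sqn M (\<lambda>x. f x - g x) + 2 * sqn M (\<lambda>x. g x - h x)"
  using sqn_add_le[OF sq_integrable_diff[OF assms(1,2)] sq_integrable_diff[OF assms(2,3)]] by simp

lemma sqn_cong_AE:
  assumes "f \<in> borel_measurable M" "g \<in> borel_measurable M" "AE x in M. f x = g x"
  shows "sqn M f = sqn M g"
  unfolding sqn_def using assms by (intro integral_cong_AE) auto

lemma l2inner_cong_AE:
  assumes "f \<in> borel_measurable M" "g \<in> borel_measurable M" "AE x in M. f x = f' x"
    "f' \<in> borel_measurable M" "g' \<in> borel_measurable M" "AE x in M. g x = g' x"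
  shows "l2inner M f g = l2inner M f' g'"
  unfolding l2inner_def using assms by (intro integral_cong_AE) auto

lemma sqn_eq_0D:
  assumes "f \<in> sq_integrable M" "sqn M f \<le> 0"
  shows "AE x in M. f x = 0"
proof -
  have "(\<integral>\<^sup>+x. ennreal ((cmod (f x))\<^sup>2) \<partial>M) = 0"
    using nn_integral_sqn[OF assms(1)] assms(2) by (simp add: ennreal_neg)
  then show ?thesis using sq_integrableD(1)[OF assms(1)] by (subst (asm) nn_integral_0_iff_AE) auto
qed

section \<open>Convergence in mean square and completeness\<close>

definition l2lim :: "'a measure \<Rightarrow> (nat \<Rightarrow> 'a \<Rightarrow> complex) \<Rightarrow> ('a \<Rightarrow> complex) \<Rightarrow> bool" where
  "l2lim M F g \<longleftrightarrow> (\<lambda>n. sqn M (\<lambda>x. F n x - g x)) \<longlonglongrightarrow> 0"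

lemma l2lim_cong_AE:
  assumes "\<And>n. F n \<in> borel_measurable M" "\<And>n. G n \<in> borel_measurable M" "f \<in> borel_measurable M" "g \<in> borel_measurable M"
    "\<And>n. AE x in M. F n x = G n x" "AE x in M. f x = g x" "l2lim M F f"
  shows "l2lim M G g"
proof -
  have "sqn M (\<lambda>x. F n x - f x) = sqn M (\<lambda>x. G n x - g x)" for n
  proof (rule sqn_cong_AE)
    show "AE x in M. F n x - f x = G n x - g x" using assms(5)[of n] assms(6) by eventually_elim simp
  qed (use assms in auto)
  then show ?thesis using assms(7) by (simp add: l2lim_def)
qed

lemma l2lim_unique:
  assumes "\<And>n. F n \<in> sq_integrable M" "f \<in> sq_integrable M" "g \<in> sq_integrable M" "l2lim M F f" "l2lim M F g"
  shows "AE x in M. f x = g x"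
proof -
  have "sqn M (\<lambda>x. f x - g x) \<le> 0"
  proof (rule LIMSEQ_le[OF tendsto_const])
    have "(\<lambda>n. 2 * sqn M (\<lambda>x. F n x - f x) + 2 * sqn M (\<lambda>x. F n x - g x)) \<longlonglongrightarrow> 2 * 0 + 2 * 0"
      using assms(4,5) unfolding l2lim_def by (intro tendsto_intros)
    then show "(\<lambda>n. 2 * sqn M (\<lambda>x. F n x - f x) + 2 * sqn M (\<lambda>x. F n x - g x)) \<longlonglongrightarrow> 0"
      by simp
    have "sqn M (\<lambda>x. f x - g x) \<le> 2 * sqn M (\<lambda>x. F n x - f x) + 2 * sqn M (\<lambda>x. F n x - g x)" for n
      using sqn_triangle[OF assms(2) assms(1) assms(3), of n] sqn_minus_commute[of M f "F n"] by simp
    then show "\<exists>N. \<forall>n\<ge>N. sqn M (\<lambda>x. f x - g x) \<le> 2 * sqn M (\<lambda>x. F n x - f x) + 2 * sqn M (\<lambda>x. F n x - g x)"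
      by simp
  qed
  from sqn_eq_0D[OF sq_integrable_diff[OF assms(2,3)] this] show ?thesis by simp
qed

lemma l2lim_lin:
  assumes "\<And>n. F n \<in> sq_integrable M" "f \<in> sq_integrable M" "\<And>n. G n \<in> sq_integrable M" "g \<in> sq_integrable M" "l2lim M F f" "l2lim M G g"
  shows "l2lim M (\<lambda>n x. c * F n x + G n x) (\<lambda>x. c * f x + g x)"
  unfolding l2lim_def
proof (rule tendsto_sandwich[OF _ _ tendsto_const])
  let ?u = "\<lambda>n. 2 * ((cmod c)\<^sup>2 * sqn M (\<lambda>x. F n x - f x)) + 2 * sqn M (\<lambda>x. G n x - g x)"
  have "sqn M (\<lambda>x. (c * F n x + G n x) - (c * f x + g x)) \<le> ?u n" for n
  proof -
    have "sqn M (\<lambda>x. c * (F n x - f x) + (G n x - g x)) \<le> 2 * sqn M (\<lambda>x. c * (F n x - f x)) + 2 * sqn M (\<lambda>x. G n x - g x)"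
      by (intro sqn_add_le sq_integrable_scale sq_integrable_diff assms)
    moreover have "sqn M (\<lambda>x. c * (F n x - f x)) = (cmod c)\<^sup>2 * sqn M (\<lambda>x. F n x - f x)"
      by (simp add: sqn_def norm_mult power_mult_distrib)
    moreover have "(\<lambda>x. (c * F n x + G n x) - (c * f x + g x)) = (\<lambda>x. c * (F n x - f x) + (G n x - g x))"
      by (simp add: algebra_simps)
    ultimately show ?thesis by simp
  qed
  then show "\<forall>\<^sub>F n in sequentially. sqn M (\<lambda>x. (c * F n x + G n x) - (c * f x + g x)) \<le> ?u n" by simp
  have "?u \<longlonglongrightarrow> 2 * ((cmod c)\<^sup>2 * 0) + 2 * 0"
    using assms(5,6) unfolding l2lim_def by (intro tendsto_intros)
  then show "?u \<longlonglongrightarrow> 0" by simp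
qed (simp add: sqn_nonneg)

lemma l2lim_inner:
  assumes "\<And>n. F n \<in> sq_integrable M" "f \<in> sq_integrable M" "g \<in> sq_integrable M" "l2lim M F f"
  shows "(\<lambda>n. l2inner M g (F n)) \<longlonglongrightarrow> l2inner M g f"
proof -
  have "(\<lambda>n. (cmod (l2inner M g (F n) - l2inner M g f))\<^sup>2) \<longlonglongrightarrow> 0"
  proof (rule tendsto_sandwich[OF _ _ tendsto_const])
    have "(cmod (l2inner M g (F n) - l2inner M g f))\<^sup>2 \<le> sqn M g * sqn M (\<lambda>x. F n x - f x)" for n
    proof -
      have "l2inner M g (F n) - l2inner M g f = l2inner M g (\<lambda>x. F n x - f x)"
        using integrable_l2inner[OF assms(3,1)] integrable_l2inner[OF assms(3,2)]
        by (simp add: l2inner_def algebra_simps)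
      then show ?thesis using Cauchy_Schwarz_l2inner[OF assms(3) sq_integrable_diff[OF assms(1,2)]] by simp
    qed
    then show "\<forall>\<^sub>F n in sequentially. (cmod (l2inner M g (F n) - l2inner M g f))\<^sup>2 \<le> sqn M g * sqn M (\<lambda>x. F n x - f x)" by simp
    have "(\<lambda>n. sqn M g * sqn M (\<lambda>x. F n x - f x)) \<longlonglongrightarrow> sqn M g * 0"
      using assms(4) unfolding l2lim_def by (intro tendsto_intros)
    then show "(\<lambda>n. sqn M g * sqn M (\<lambda>x. F n x - f x)) \<longlonglongrightarrow> 0" by simp
  qed simp
  then have "(\<lambda>n. l2inner M g (F n) - l2inner M g f) \<longlonglongrightarrow> 0"
    by (simp add: power_tendsto_0_iff tendsto_norm_zero_iff)
  then show ?thesis by (simp add: LIM_zero_iff)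
qed

lemma l2lim_sqn:
  assumes "\<And>n. F n \<in> sq_integrable M" "f \<in> sq_integrable M" "l2lim M F f"
  shows "(\<lambda>n. sqn M (F n)) \<longlonglongrightarrow> sqn M f"
proof -
  have "sqn M (F n) = sqn M f + 2 * Re (l2inner M f (F n) - l2inner M f f) + sqn M (\<lambda>x. F n x - f x)" for n
    using sqn_lin_expand[OF assms(2) sq_integrable_diff[OF assms(1)[of n] assms(2)], of 1]
      integrable_l2inner[OF assms(2,1)] integrable_l2inner[OF assms(2,2)]
    by (simp add: l2inner_def right_diff_distrib)
  moreover have "(\<lambda>n. sqn M f + 2 * Re (l2inner M f (F n) - l2inner M f f) + sqn M (\<lambda>x. F n x - f x)) \<longlonglongrightarrow>
      sqn M f + 2 * Re (l2inner M f f - l2inner M f f) + 0"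
    using assms(3) l2lim_inner[OF assms(1,2,2,3)] unfolding l2lim_def by (intro tendsto_intros)
  ultimately show ?thesis by simp
qed

lemma sq_integrable_Fatou:
  assumes "\<And>n. F n \<in> sq_integrable M" "f \<in> borel_measurable M" "AE x in M. (\<lambda>n. F n x) \<longlonglongrightarrow> f x"
    "\<forall>\<^sub>F n in sequentially. sqn M (F n) \<le> e"
  shows "f \<in> sq_integrable M" "sqn M f \<le> e"
proof -
  have [measurable]: "F n \<in> borel_measurable M" for n using sq_integrableD(1)[OF assms(1)] .
  have "(\<integral>\<^sup>+x. ennreal ((cmod (f x))\<^sup>2) \<partial>M) = (\<integral>\<^sup>+x. liminf (\<lambda>n. ennreal ((cmod (F n x))\<^sup>2)) \<partial>M)"
  proof (rule nn_integral_cong_AE)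
    show "AE x in M. ennreal ((cmod (f x))\<^sup>2) = liminf (\<lambda>n. ennreal ((cmod (F n x))\<^sup>2))"
      using assms(3)
    proof eventually_elim
      case (elim x)
      then have "(\<lambda>n. ennreal ((cmod (F n x))\<^sup>2)) \<longlonglongrightarrow> ennreal ((cmod (f x))\<^sup>2)"
        by (intro tendsto_intros)
      then show ?case by (intro lim_imp_Liminf[symmetric]) simp_all
    qed
  qed
  also have "\<dots> \<le> liminf (\<lambda>n. \<integral>\<^sup>+x. ennreal ((cmod (F n x))\<^sup>2) \<partial>M)"
    by (rule nn_integral_liminf) simp
  also have "\<dots> \<le> liminf (\<lambda>n. ennreal e)"
    using assms(4) by (intro Liminf_mono) (auto simp: nn_integral_sqn[OF assms(1)] ennreal_leI elim!: eventually_mono)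
  finally have le: "(\<integral>\<^sup>+x. ennreal ((cmod (f x))\<^sup>2) \<partial>M) \<le> ennreal e"
    by (simp add: Liminf_const)
  then show sq: "f \<in> sq_integrable M" using assms(2) by (intro sq_integrableI) (auto intro: le_less_trans)
  obtain n where "sqn M (F n) \<le> e" using assms(4) by (auto simp: eventually_sequentially)
  then have "e \<ge> 0" using sqn_nonneg[of M "F n"] by linarith
  then show "sqn M f \<le> e" using le by (simp add: nn_integral_sqn[OF sq])
qed

text \<open>Fatou applied to F n - h bounds the squared norm of f - h by every positive e. This
  identifies pointwise limits with limits in mean square without passing to a subsequence.\<close>

lemma l2lim_AE_unique:
  assumes "\<And>n. F n \<in> sq_integrable M" "f \<in> borel_measurable M" "AE x in M. (\<lambda>n. F n x) \<longlonglongrightarrow> f x"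
    "h \<in> sq_integrable M" "l2lim M F h"
  shows "AE x in M. f x = h x" "f \<in> sq_integrable M"
proof -
  have *: "(\<lambda>x. f x - h x) \<in> sq_integrable M \<and> sqn M (\<lambda>x. f x - h x) \<le> e" if "e > 0" for e
  proof -
    have "AE x in M. (\<lambda>n. F n x - h x) \<longlonglongrightarrow> f x - h x"
      using assms(3) by eventually_elim (intro tendsto_intros)
    moreover have "\<forall>\<^sub>F n in sequentially. sqn M (\<lambda>x. F n x - h x) \<le> e"
      using order_tendstoD(2)[OF assms(5)[unfolded l2lim_def] that] by eventually_elim simp
    ultimately show ?thesis
      using sq_integrable_Fatou[of "\<lambda>n x. F n x - h x" M "\<lambda>x. f x - h x" e] assms(2) sq_integrableD(1)[OF assms(4)]
        sq_integrable_diff[OF assms(1,4)] by auto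
  qed
  then have "sqn M (\<lambda>x. f x - h x) \<le> 0" by (meson dense_ge)
  from sqn_eq_0D[OF _ this] *[OF zero_less_one] have "AE x in M. f x - h x = 0" by blast
  then show "AE x in M. f x = h x" by simp
  then show "f \<in> sq_integrable M" by (rule sq_integrable_cong_AE[OF assms(4,2)])
qed

lemma l2lim_dominated:
  assumes "\<And>n. F n \<in> borel_measurable M" "f \<in> borel_measurable M" "AE x in M. (\<lambda>n. F n x) \<longlonglongrightarrow> f x"
    "w \<in> sq_integrable M" "\<And>n. AE x in M. cmod (F n x) \<le> cmod (w x)"
  shows "l2lim M F f"
proof -
  note [measurable] = assms(1,2)
  have AE: "AE x in M. \<forall>n. cmod (F n x) \<le> cmod (w x)" using assms(5) by (simp add: AE_all_countable)
  have "(\<lambda>n. LINT x|M. (cmod (F n x - f x))\<^sup>2) \<longlonglongrightarrow> (LINT x|M. (0::real))"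
  proof (rule integral_dominated_convergence[where w="\<lambda>x. 4 * (cmod (w x))\<^sup>2"])
    show "integrable M (\<lambda>x. 4 * (cmod (w x))\<^sup>2)" using sq_integrableD[OF assms(4)] by simp
    show "AE x in M. (\<lambda>n. (cmod (F n x - f x))\<^sup>2) \<longlonglongrightarrow> 0"
      using assms(3)
    proof eventually_elim
      case (elim x)
      then have "(\<lambda>n. (cmod (F n x - f x))\<^sup>2) \<longlonglongrightarrow> (cmod (f x - f x))\<^sup>2" by (intro tendsto_intros)
      then show ?case by simp
    qed
    show "AE x in M. norm ((cmod (F n x - f x))\<^sup>2) \<le> 4 * (cmod (w x))\<^sup>2" for n
      using AE assms(3)
    proof eventually_elim
      case (elim x)
      have "cmod (f x) \<le> cmod (w x)"
        using elim by (intro tendsto_upperbound[OF tendsto_norm[OF elim(2)]]) auto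
      then have "cmod (F n x - f x) \<le> 2 * cmod (w x)"
        using norm_triangle_ineq4[of "F n x" "f x"] elim(1) by (smt (verit))
      then have "(cmod (F n x - f x))\<^sup>2 \<le> (2 * cmod (w x))\<^sup>2" by (intro power_mono) auto
      then show ?case by (simp add: power_mult_distrib)
    qed
  qed simp_all
  then show ?thesis by (simp add: l2lim_def sqn_def)
qed

text \<open>Riesz-Fischer: along a subsequence the increments a k have squared norm at most 1 / 4^k.
  The sum of 2^k * (a k)^2 then has finite integral, so it is finite almost everywhere, and this
  forces pointwise convergence of the subsequence.\<close>

lemma l2_complete:
  assumes F: "\<And>n. F n \<in> sq_integrable M"
    and Cauchy: "\<And>e. e > 0 \<Longrightarrow> \<exists>N. \<forall>m\<ge>N. \<forall>n\<ge>N. sqn M (\<lambda>x. F m x - F n x) < e"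
  obtains g where "g \<in> sq_integrable M" "l2lim M F g"
proof -
  have [measurable]: "F n \<in> borel_measurable M" for n using sq_integrableD(1)[OF F] .
  have "\<forall>k. \<exists>N. \<forall>m\<ge>N. \<forall>n\<ge>N. sqn M (\<lambda>x. F m x - F n x) < (1/4)^k" using Cauchy by simp
  then obtain N where N: "\<And>k m n. m \<ge> N k \<Longrightarrow> n \<ge> N k \<Longrightarrow> sqn M (\<lambda>x. F m x - F n x) < (1/4)^k" by metis
  \<comment> \<open>Summing N j + 1 gives indices that increase, dominate N k and are at least
    k.\<close>
  define r where "r = (\<lambda>k. \<Sum>j\<le>k. N j + 1)"
  have rN: "r k \<ge> N k" for k by (induction k) (auto simp: r_def)
  have r_ge: "r k \<ge> k" for k by (induction k) (auto simp: r_def)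
  have r_mono: "r k \<le> r (Suc k)" for k by (simp add: r_def)
  define a where "a = (\<lambda>k x. cmod (F (r (Suc k)) x - F (r k) x))"
  have [measurable]: "a k \<in> borel_measurable M" for k unfolding a_def by measurable
  have a: "(\<integral>\<^sup>+x. ennreal ((a k x)\<^sup>2) \<partial>M) \<le> ennreal ((1/4)^k)" for k
    unfolding a_def using nn_integral_sqn[OF sq_integrable_diff[OF F F], of "r (Suc k)" "r k"] N[of k "r (Suc k)" "r k"] rN[of k] r_mono[of k]
    by (auto intro!: ennreal_leI)
  have "(\<integral>\<^sup>+x. (\<Sum>k. ennreal (2^k * (a k x)\<^sup>2)) \<partial>M) = (\<Sum>k. \<integral>\<^sup>+x. ennreal (2^k * (a k x)\<^sup>2) \<partial>M)"
    by (rule nn_integral_suminf) simp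
  also have "\<dots> \<le> (\<Sum>k. ennreal ((1/2)^k))"
  proof (intro suminf_le)
    fix k
    have "(\<integral>\<^sup>+x. ennreal (2^k * (a k x)\<^sup>2) \<partial>M) = ennreal (2^k) * (\<integral>\<^sup>+x. ennreal ((a k x)\<^sup>2) \<partial>M)"
      by (subst nn_integral_cmult[symmetric]) (auto simp: ennreal_mult)
    also have "\<dots> \<le> ennreal (2^k) * ennreal ((1/4)^k)" by (intro mult_left_mono a) auto
    also have "\<dots> = ennreal ((1/2)^k)"
      by (simp add: ennreal_mult[symmetric] power_mult_distrib[symmetric] del: ennreal_power)
    finally show "(\<integral>\<^sup>+x. ennreal (2^k * (a k x)\<^sup>2) \<partial>M) \<le> ennreal ((1/2)^k)" .
  qed auto
  also have "\<dots> = ennreal (\<Sum>k. (1/2)^k)" by (intro suminf_ennreal2) (auto simp: summable_geometric)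
  also have "\<dots> < \<infinity>" by simp
  finally have "AE x in M. (\<Sum>k. ennreal (2^k * (a k x)\<^sup>2)) \<noteq> \<infinity>"
    by (intro nn_integral_noteq_infinite) auto
  then have conv: "AE x in M. convergent (\<lambda>k. F (r k) x)"
  proof eventually_elim
    case (elim x)
    have "summable (\<lambda>k. 2^k * (a k x)\<^sup>2)" using elim by (intro summable_suminf_not_top) auto
    then have "summable (\<lambda>k. 2^k * (a k x)\<^sup>2 + (1/2)^k)" by (intro summable_add) (auto simp: summable_geometric)
    then have "summable (\<lambda>k. F (r (Suc k)) x - F (r k) x)"
    proof (rule summable_comparison_test'[where N=0])
      fix k :: nat
      \<comment> \<open>Completing the square bounds 2 * a k by 2^k * (a k)^2 + 1 / 2^k, both
        summable.\<close>
      have "0 \<le> (2^k * a k x - 1)\<^sup>2 / 2^k" by simp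
      also have "\<dots> = 2^k * (a k x)\<^sup>2 - 2 * a k x + (1/2)^k"
        by (simp add: power2_eq_square field_simps)
      finally show "norm (F (r (Suc k)) x - F (r k) x) \<le> 2^k * (a k x)\<^sup>2 + (1/2)^k"
        unfolding a_def[symmetric] by (smt (verit) a_def norm_ge_zero)
    qed
    then have "convergent (\<lambda>n. (\<Sum>k<n. F (r (Suc k)) x - F (r k) x))" by (simp add: summable_iff_convergent)
    then have "convergent (\<lambda>n. F (r n) x - F (r 0) x)" by (simp only: sum_lessThan_telescope[of "\<lambda>k. F (r k) x"])
    then have "convergent (\<lambda>n. F (r 0) x + (F (r n) x - F (r 0) x))" by (intro convergent_add convergent_const)
    then show ?case by simp
  qed
  define g where "g = (\<lambda>x. lim (\<lambda>k. F (r k) x))"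
  have [measurable]: "g \<in> borel_measurable M" unfolding g_def by measurable
  have lim: "AE x in M. (\<lambda>k. F (r k) x) \<longlonglongrightarrow> g x"
    using conv by eventually_elim (simp add: g_def convergent_LIMSEQ_iff)
  \<comment> \<open>With n fixed, Fatou lets the other index run to infinity along the
    subsequence.\<close>
  have main: "(\<lambda>x. F n x - g x) \<in> sq_integrable M \<and> sqn M (\<lambda>x. F n x - g x) \<le> e"
    if "\<forall>m\<ge>N. \<forall>n\<ge>N. sqn M (\<lambda>x. F m x - F n x) < e" "n \<ge> N" for N n e
  proof -
    have "AE x in M. (\<lambda>k. F n x - F (r k) x) \<longlonglongrightarrow> F n x - g x"
      using lim by eventually_elim (intro tendsto_intros)
    moreover have "\<forall>\<^sub>F k in sequentially. sqn M (\<lambda>x. F n x - F (r k) x) \<le> e"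
    proof (rule eventually_sequentiallyI[of N])
      fix k assume "k \<ge> N"
      then have "r k \<ge> N" using r_ge[of k] by linarith
      then show "sqn M (\<lambda>x. F n x - F (r k) x) \<le> e" using that by (intro less_imp_le) blast
    qed
    ultimately show ?thesis
      using sq_integrable_Fatou[of "\<lambda>k x. F n x - F (r k) x" M "\<lambda>x. F n x - g x" e] sq_integrable_diff[OF F F] by auto
  qed
  obtain N0 where "\<forall>m\<ge>N0. \<forall>n\<ge>N0. sqn M (\<lambda>x. F m x - F n x) < 1" using Cauchy[of 1] by auto
  then have "(\<lambda>x. F N0 x - g x) \<in> sq_integrable M" using main by blast
  from sq_integrable_diff[OF F[of N0] this] have "g \<in> sq_integrable M" by simp
  moreover have "l2lim M F g" unfolding l2lim_def
  proof (rule LIMSEQ_I)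
    fix e :: real assume "e > 0"
    then obtain N where N: "\<forall>m\<ge>N. \<forall>n\<ge>N. sqn M (\<lambda>x. F m x - F n x) < e/2" using Cauchy[of "e/2"] by auto
    show "\<exists>N. \<forall>n\<ge>N. norm (sqn M (\<lambda>x. F n x - g x) - 0) < e"
    proof (intro exI[of _ N] allI impI)
      fix n assume "n \<ge> N"
      then show "norm (sqn M (\<lambda>x. F n x - g x) - 0) < e"
        using main[OF N, of n] \<open>e > 0\<close> sqn_nonneg[of M "\<lambda>x. F n x - g x"] by simp
    qed
  qed
  ultimately show ?thesis using that by blast
qed

section \<open>Equivalence classes and polarization\<close>

lemma L2_class_self: "f \<in> sq_integrable M \<Longrightarrow> f \<in> L2_class M f"
  by (simp add: L2_class_def ae_rel_def)

lemma mem_L2_class_iff: "g \<in> L2_class M f \<longleftrightarrow> f \<in> sq_integrable M \<and> g \<in> sq_integrable M \<and> (AE x in M. f x = g x)"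
  by (simp add: L2_class_def ae_rel_def)

lemma L2_class_in_L2: "f \<in> sq_integrable M \<Longrightarrow> L2_class M f \<in> L2 M"
  by (simp add: L2_class_def L2_def quotientI)

lemma L2_E:
  assumes "A \<in> L2 M" obtains f where "f \<in> sq_integrable M" "A = L2_class M f"
  using assms by (auto simp: L2_class_def L2_def elim: quotientE)

lemma L2_class_eqI:
  assumes "f \<in> sq_integrable M" "g \<in> sq_integrable M" "AE x in M. f x = g x"
  shows "L2_class M f = L2_class M g"
  unfolding L2_class_def using assms by (intro equiv_class_eq[OF equiv_ae_rel]) (auto simp: ae_rel_def)

lemma L2_class_eqD:
  assumes "L2_class M f = L2_class M g" "f \<in> sq_integrable M" "g \<in> sq_integrable M"
  shows "AE x in M. f x = g x"
  using L2_class_self[OF assms(3)] unfolding assms(1)[symmetric] mem_L2_class_iff by simp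

text \<open>Expanding the squared norm of c * f + g leaves only the mixed term; c = 1 recovers the
  real part of the inner product and c = \<i> the imaginary part.\<close>

lemma polarization:
  assumes T: "\<And>f. f \<in> S \<Longrightarrow> f \<in> sq_integrable M" "\<And>f. f \<in> S \<Longrightarrow> T f \<in> sq_integrable N"
    and S: "\<And>f g c. f \<in> S \<Longrightarrow> g \<in> S \<Longrightarrow> (\<lambda>x. c * f x + g x) \<in> S"
    and lin: "\<And>f g c. f \<in> S \<Longrightarrow> g \<in> S \<Longrightarrow> AE y in N. T (\<lambda>x. c * f x + g x) y = c * T f y + T g y"
    and iso: "\<And>f. f \<in> S \<Longrightarrow> sqn N (T f) = sqn M f"
    and fg: "f \<in> S" "g \<in> S"
  shows "l2inner N (T f) (T g) = l2inner M f g"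
proof -
  have *: "Re (cnj c * l2inner N (T f) (T g)) = Re (cnj c * l2inner M f g)" for c
  proof -
    have "sqn N (T (\<lambda>x. c * f x + g x)) = sqn N (\<lambda>y. c * T f y + T g y)"
      using lin[OF fg, of c] by (intro sqn_cong_AE) (auto intro!: sq_integrableD(1) T S fg sq_integrable_lin)
    then have "sqn N (\<lambda>y. c * T f y + T g y) = sqn M (\<lambda>x. c * f x + g x)" using iso S fg by simp
    then show ?thesis using sqn_lin_expand[of "T f" N "T g" c] sqn_lin_expand[of f M g c] T fg iso by auto
  qed
  show ?thesis using *[of 1] *[of \<i>] by (simp add: complex_eq_iff)
qed

section \<open>Fourier integrals and Abel summation\<close>

text \<open>The kernels below are all computed from this integral, after the line has been folded
  onto the half-line.\<close>

lemma exp_integral_half_line: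
  fixes w :: complex assumes w: "Re w > 0"
  shows "integrable lborel (\<lambda>x. indicator {0..} x *\<^sub>R exp (- (w * complex_of_real x)))"
    and "(LINT x|lborel. indicator {0..} x *\<^sub>R exp (- (w * complex_of_real x))) = 1 / w"
proof -
  let ?f = "\<lambda>x. indicator {0..} x *\<^sub>R exp (- (w * complex_of_real x))"
  have "w \<noteq> 0" using w by auto
  have norm: "cmod (exp (- (w * complex_of_real x))) = exp (- (Re w * x))" for x
    by (simp add: norm_exp_eq_Re)
  have lim: "((\<lambda>x. exp (- (Re w * x))) \<longlongrightarrow> 0) at_top"
    by (rule filterlim_compose[OF exp_at_bot], rule filterlim_compose[OF filterlim_uminus_at_bot_at_top],
        rule filterlim_tendsto_pos_mult_at_top[OF tendsto_const w filterlim_ident])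
  have "(\<integral>\<^sup>+x. ennreal (exp (- (Re w * x))) * indicator {0..} x \<partial>lborel) = ennreal (0 - (- exp (- (Re w * 0)) / Re w))"
  proof (rule nn_integral_FTC_atLeast[where F = "\<lambda>x. - exp (- (Re w * x)) / Re w"])
    show "((\<lambda>x. - exp (- (Re w * x)) / Re w) has_real_derivative exp (- (Re w * x))) (at x)" for x
      using w by (auto intro!: derivative_eq_intros)
    show "((\<lambda>x. - exp (- (Re w * x)) / Re w) \<longlongrightarrow> 0) at_top"
      using tendsto_divide[OF tendsto_minus[OF lim] tendsto_const[of "Re w"]] w by simp
  qed auto
  then have "(\<integral>\<^sup>+x. ennreal (norm (?f x)) \<partial>lborel) < \<infinity>"
    by (simp add: norm mult.commute indicator_mult_ennreal[symmetric] flip: ennreal_indicator)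
  then show int: "integrable lborel ?f" by (intro integrableI_bounded) auto
  have "(\<lambda>n. LINT x|lborel. indicator {0..real n} x *\<^sub>R exp (- (w * complex_of_real x))) \<longlonglongrightarrow> (LINT x|lborel. ?f x)"
  proof (rule integral_dominated_convergence[where w="\<lambda>x. norm (?f x)"])
    show "AE x in lborel. (\<lambda>n. indicator {0..real n} x *\<^sub>R exp (- (w * complex_of_real x))) \<longlonglongrightarrow> ?f x"
    proof (intro AE_I2 tendsto_eventually)
      fix x :: real
      show "\<forall>\<^sub>F n in sequentially. indicator {0..real n} x *\<^sub>R exp (- (w * complex_of_real x)) = ?f x"
        using eventually_ge_at_top[of "nat \<lceil>x\<rceil>"]
        by eventually_elim (auto simp: indicator_def nat_ceiling_le_eq)
    qed
    show "integrable lborel (\<lambda>x. norm (?f x))" by (rule integrable_norm[OF int])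
  qed (auto simp: indicator_def)
  moreover have "(LINT x|lborel. indicator {0..real n} x *\<^sub>R exp (- (w * complex_of_real x))) = - exp (- (w * complex_of_real n)) / w - - exp (- (w * complex_of_real 0)) / w" for n
  proof (rule integral_FTC_Icc[where F = "\<lambda>x. - exp (- (w * complex_of_real x)) / w"])
    fix x
    show "((\<lambda>x. - exp (- (w * complex_of_real x)) / w) has_vector_derivative exp (- (w * complex_of_real x))) (at x within {0..real n})"
      by (rule has_vector_derivative_real_field) (use \<open>w \<noteq> 0\<close> in \<open>auto intro!: derivative_eq_intros\<close>)
  qed (auto intro!: continuous_intros)
  moreover have "(\<lambda>n. - exp (- (w * complex_of_real n)) / w - - exp (- (w * complex_of_real 0)) / w) \<longlonglongrightarrow> - 0 / w - - exp (- (w * complex_of_real 0)) / w"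
  proof (intro tendsto_intros)
    have "(\<lambda>n. exp (- (Re w * real n))) \<longlonglongrightarrow> 0"
      by (rule filterlim_compose[OF lim filterlim_real_sequentially])
    then have "(\<lambda>n. cmod (exp (- (w * complex_of_real (real n))))) \<longlonglongrightarrow> 0" by (simp only: norm)
    then show "(\<lambda>n. exp (- (w * complex_of_real (real n)))) \<longlonglongrightarrow> 0" by (rule tendsto_norm_zero_cancel)
  qed (use \<open>w \<noteq> 0\<close> in auto)
  ultimately show "(LINT x|lborel. ?f x) = 1 / w"
    using LIMSEQ_unique by fastforce
qed

lemma lborel_integral_uminus:
  fixes f :: "real \<Rightarrow> 'a::{banach,second_countable_topology}"
  shows "(LINT x|lborel. f (- x)) = (LINT x|lborel. f x)"
  using lborel_integral_real_affine[of "-1" f 0] by simp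

lemma lborel_integrable_uminus:
  fixes f :: "real \<Rightarrow> 'a::{banach,second_countable_topology}"
  shows "integrable lborel f \<Longrightarrow> integrable lborel (\<lambda>x. f (- x))"
  using lborel_integrable_real_affine[of f "-1" 0] by simp

lemma AE_lborel_uminus:
  assumes "AE x in (lborel :: real measure). P x" shows "AE x in lborel. P (- x)"
proof -
  obtain N where N: "N \<in> sets lborel" "emeasure lborel N = 0" "{x. \<not> P x} \<subseteq> N"
    using assms by (auto elim!: AE_E)
  have [measurable]: "N \<in> sets borel" using N by simp
  have "AE x in distr lborel borel uminus. x \<notin> N"
    unfolding lborel_distr_uminus by (rule AE_not_in) (use N in \<open>auto simp: null_sets_def\<close>)
  then have "AE x in lborel. - x \<notin> N" by (subst (asm) AE_distr_iff) auto
  then show ?thesis by eventually_elim (use N(3) in auto)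
qed

lemma lborel_integral_fold:
  fixes h :: "real \<Rightarrow> complex"
  assumes h: "integrable lborel h"
  shows "(LINT x|lborel. h x) = (LINT x|lborel. indicator {0..} x *\<^sub>R (h x + h (- x)))"
proof -
  have i1: "integrable lborel (\<lambda>x. indicator {0..} x *\<^sub>R h x)" "integrable lborel (\<lambda>x. indicator {..0} x *\<^sub>R h x)"
    using h by (auto intro!: integrable_mult_indicator)
  have "(LINT x|lborel. h x) = (LINT x|lborel. indicator {0..} x *\<^sub>R h x + indicator {..0} x *\<^sub>R h x)"
    using borel_measurable_integrable[OF h]
    by (intro integral_cong_AE eventually_mono[OF AE_lborel_singleton[of 0]]) (auto simp: indicator_def)
  also have "\<dots> = (LINT x|lborel. indicator {0..} x *\<^sub>R h x) + (LINT x|lborel. indicator {..0} x *\<^sub>R h x)"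
    by (rule Bochner_Integration.integral_add[OF i1])
  also have "(LINT x|lborel. indicator {..0} x *\<^sub>R h x) = (LINT x|lborel. indicator {0..} x *\<^sub>R h (- x))"
    using lborel_integral_uminus[of "\<lambda>x. indicator {..0} x *\<^sub>R h x"] by (simp add: indicator_def)
  also have "(LINT x|lborel. indicator {0..} x *\<^sub>R h x) + (LINT x|lborel. indicator {0..} x *\<^sub>R h (- x)) =
     (LINT x|lborel. indicator {0..} x *\<^sub>R h x + indicator {0..} x *\<^sub>R h (- x))"
    using i1(1) h lborel_integrable_uminus[OF h] by (intro Bochner_Integration.integral_add[symmetric] integrable_mult_indicator) auto
  finally show ?thesis by (simp add: scaleR_add_right)
qed

text \<open>The Abel summation factor. Its Fourier integral is a Poisson kernel, so damping in
  frequency is Poisson smoothing in space.\<close>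

definition abel :: "real \<Rightarrow> real \<Rightarrow> real" where
  "abel \<epsilon> \<xi> = exp (- (\<epsilon> * \<bar>\<xi>\<bar>))"

lemma abel_measurable [measurable]: "abel \<epsilon> \<in> borel_measurable borel"
  unfolding abel_def[abs_def] by measurable

lemma abel_pos: "0 < abel \<epsilon> \<xi>" by (simp add: abel_def)

lemma abel_le_1: "0 \<le> \<epsilon> \<Longrightarrow> abel \<epsilon> \<xi> \<le> 1" by (simp add: abel_def)

lemma integrable_abel: assumes "\<epsilon> > 0" shows "integrable lborel (abel \<epsilon>)"
proof -
  have i: "integrable lborel (\<lambda>x. indicator {0..} x *\<^sub>R exp (- (complex_of_real \<epsilon> * complex_of_real x)))"
    using assms by (intro exp_integral_half_line) simp
  have "integrable lborel (\<lambda>x. norm (indicator {0..} x *\<^sub>R exp (- (complex_of_real \<epsilon> * complex_of_real x)))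
      + norm (indicator {0..} (-x) *\<^sub>R exp (- (complex_of_real \<epsilon> * complex_of_real (-x)))))"
    using i lborel_integrable_uminus[OF i] by (intro Bochner_Integration.integrable_add integrable_norm)
  then show ?thesis
  proof (rule Bochner_Integration.integrable_bound)
    show "AE x in lborel. norm (abel \<epsilon> x) \<le> norm (norm (indicator {0..} x *\<^sub>R exp (- (complex_of_real \<epsilon> * complex_of_real x)))
      + norm (indicator {0..} (-x) *\<^sub>R exp (- (complex_of_real \<epsilon> * complex_of_real (-x)))))"
      by (auto simp: indicator_def abel_def norm_exp_eq_Re)
  qed simp
qed

lemma integrable_bounded_mult:
  fixes f g :: "'a \<Rightarrow> complex"
  assumes "integrable M f" "g \<in> borel_measurable M" "\<And>x. cmod (g x) \<le> C"
  shows "integrable M (\<lambda>x. g x * f x)"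
proof -
  have "integrable M (\<lambda>x. C * norm (f x))" using assms(1) by (intro integrable_mult_right integrable_norm)
  then show ?thesis
  proof (rule Bochner_Integration.integrable_bound)
    have "C \<ge> 0" using assms(3) norm_ge_zero order_trans by blast
    then show "AE x in M. norm (g x * f x) \<le> norm (C * norm (f x))"
      using assms(3) by (intro AE_I2) (simp add: norm_mult mult_right_mono)
  qed (use assms in auto)
qed

lemma integral_abel_exp:
  assumes "\<epsilon> > 0"
  shows "(LINT \<xi>|lborel. exp (\<i> * complex_of_real (u * \<xi>)) * complex_of_real (abel \<epsilon> \<xi>)) = complex_of_real (2 * pker \<epsilon> u)"
proof -
  let ?w = "Complex \<epsilon> (-u)" and ?w' = "Complex \<epsilon> u"
  have "integrable lborel (\<lambda>\<xi>. exp (\<i> * complex_of_real (u * \<xi>)) * complex_of_real (abel \<epsilon> \<xi>))"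
    using integrable_abel[OF assms] by (intro integrable_bounded_mult[where C=1]) auto
  from lborel_integral_fold[OF this]
  have "(LINT \<xi>|lborel. exp (\<i> * complex_of_real (u * \<xi>)) * complex_of_real (abel \<epsilon> \<xi>)) =
     (LINT \<xi>|lborel. indicator {0..} \<xi> *\<^sub>R exp (- (?w * complex_of_real \<xi>)) + indicator {0..} \<xi> *\<^sub>R exp (- (?w' * complex_of_real \<xi>)))"
  proof (rule trans, intro Bochner_Integration.integral_cong refl)
    fix \<xi> :: real
    have "exp (\<i> * complex_of_real (u * \<xi>)) * complex_of_real (abel \<epsilon> \<xi>) = exp (- (?w * complex_of_real \<xi>))" if "\<xi> \<ge> 0"
      using that unfolding abel_def exp_of_real[symmetric] exp_add[symmetric]
      by (intro arg_cong[where f=exp]) (simp add: complex_eq_iff)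
    moreover have "exp (\<i> * complex_of_real (u * (-\<xi>))) * complex_of_real (abel \<epsilon> (-\<xi>)) = exp (- (?w' * complex_of_real \<xi>))" if "\<xi> \<ge> 0"
      using that unfolding abel_def exp_of_real[symmetric] exp_add[symmetric]
      by (intro arg_cong[where f=exp]) (simp add: complex_eq_iff)
    ultimately show "indicator {0..} \<xi> *\<^sub>R (exp (\<i> * complex_of_real (u * \<xi>)) * complex_of_real (abel \<epsilon> \<xi>) + exp (\<i> * complex_of_real (u * - \<xi>)) * complex_of_real (abel \<epsilon> (- \<xi>))) =
         indicator {0..} \<xi> *\<^sub>R exp (- (?w * complex_of_real \<xi>)) + indicator {0..} \<xi> *\<^sub>R exp (- (?w' * complex_of_real \<xi>))"
      by (simp add: indicator_def)
  qed
  also have "\<dots> = 1 / ?w + 1 / ?w'"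
    using exp_integral_half_line[of ?w] exp_integral_half_line[of ?w'] assms by simp
  also have "\<dots> = complex_of_real (2 * pker \<epsilon> u)"
    using assms sum_sq_pos[OF assms, of u]
    by (simp add: complex_eq_iff Re_divide Im_divide pker_def power2_eq_square)
  finally show ?thesis .
qed

section \<open>Fourier integrals of integrable functions\<close>

lemma fourier_integrable_kernel:
  assumes "integrable lborel f"
  shows "integrable lborel (\<lambda>y. exp (- (\<i> * complex_of_real (x * y))) * f y)"
  using assms by (intro integrable_bounded_mult[where C=1]) auto

lemma fourier_measurable [measurable]:
  assumes [measurable]: "f \<in> borel_measurable borel"
  shows "fourier_integral f \<in> borel_measurable borel"
  unfolding fourier_integral_def[abs_def] by measurable

lemma fourier_bounded:
  assumes "integrable lborel f"
  shows "cmod (fourier_integral f x) \<le> LINT y|lborel. cmod (f y)"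
proof -
  have "1 \<le> sqrt (2 * pi)" using pi_gt3 by simp
  then have "\<bar>1 / sqrt (2 * pi)\<bar> \<le> 1" by simp
  then have "cmod (fourier_integral f x) \<le> 1 * cmod (LINT y|lborel. exp (- (\<i> * complex_of_real (x * y))) * f y)"
    unfolding fourier_integral_def norm_mult norm_of_real by (intro mult_right_mono) auto
  also have "\<dots> \<le> (LINT y|lborel. cmod (exp (- (\<i> * complex_of_real (x * y))) * f y))"
    by (simp add: integral_norm_bound)
  finally show ?thesis by (simp add: norm_mult)
qed

lemma fourier_lin:
  assumes "integrable lborel f" "integrable lborel g"
  shows "fourier_integral (\<lambda>x. c * f x + g x) \<xi> = c * fourier_integral f \<xi> + fourier_integral g \<xi>"
proof -
  have "(LINT y|lborel. exp (- (\<i> * complex_of_real (\<xi> * y))) * (c * f y + g y)) =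
    (LINT y|lborel. c * (exp (- (\<i> * complex_of_real (\<xi> * y))) * f y) + exp (- (\<i> * complex_of_real (\<xi> * y))) * g y)"
    by (simp add: algebra_simps)
  also have "\<dots> = c * (LINT y|lborel. exp (- (\<i> * complex_of_real (\<xi> * y))) * f y) + (LINT y|lborel. exp (- (\<i> * complex_of_real (\<xi> * y))) * g y)"
    using assms[THEN fourier_integrable_kernel, of \<xi>] by simp
  finally show ?thesis by (simp add: fourier_integral_def algebra_simps)
qed

lemma fourier_refl: "fourier_integral (\<lambda>x. f (- x)) \<xi> = fourier_integral f (- \<xi>)"
  using lborel_integral_uminus[of "\<lambda>y. exp (- (\<i> * complex_of_real (- \<xi> * y))) * f y"]
  by (simp add: fourier_integral_def)

lemma fourier_cnj: "cnj (fourier_integral f \<xi>) = fourier_integral (\<lambda>x. cnj (f x)) (- \<xi>)"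
  unfolding fourier_integral_def complex_cnj_mult Bochner_Integration.integral_cnj[symmetric] by (simp add: exp_cnj)

text \<open>Fubini together with the symmetry of the kernel in its two variables. Both Abel-summed
  inversion and the damped Plancherel identity are obtained from it.\<close>

lemma fourier_multiplication:
  assumes f: "integrable lborel f" and g: "integrable lborel g"
  shows "(LINT \<xi>|lborel. fourier_integral f \<xi> * g \<xi>) = (LINT x|lborel. f x * fourier_integral g x)"
proof -
  have [measurable]: "f \<in> borel_measurable borel" "g \<in> borel_measurable borel"
    using borel_measurable_integrable[OF f] borel_measurable_integrable[OF g] by auto
  have int: "integrable (lborel \<Otimes>\<^sub>M lborel) (\<lambda>(x, \<xi>). exp (- (\<i> * complex_of_real (x * \<xi>))) * f x * g \<xi>)"
  proof (rule lborel_pair.Fubini_integrable)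
    have "(\<lambda>x. LINT \<xi>|lborel. norm (exp (- (\<i> * complex_of_real (x * \<xi>))) * f x * g \<xi>)) = (\<lambda>x. cmod (f x) * (LINT \<xi>|lborel. cmod (g \<xi>)))"
      by (simp add: norm_mult)
    then show "integrable lborel (\<lambda>x. LINT \<xi>|lborel. norm (case (x, \<xi>) of (x, \<xi>) \<Rightarrow> exp (- (\<i> * complex_of_real (x * \<xi>))) * f x * g \<xi>))"
      using f by simp
    show "AE x in lborel. integrable lborel (\<lambda>\<xi>. case (x, \<xi>) of (x, \<xi>) \<Rightarrow> exp (- (\<i> * complex_of_real (x * \<xi>))) * f x * g \<xi>)"
    proof (intro AE_I2)
      fix x
      have "integrable lborel (\<lambda>\<xi>. (exp (- (\<i> * complex_of_real (x * \<xi>))) * g \<xi>) * f x)"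
        by (intro integrable_mult_left fourier_integrable_kernel g)
      then show "integrable lborel (\<lambda>\<xi>. case (x, \<xi>) of (x, \<xi>) \<Rightarrow> exp (- (\<i> * complex_of_real (x * \<xi>))) * f x * g \<xi>)"
        by (simp add: mult_ac)
    qed
  qed measurable
  have "(LINT \<xi>|lborel. fourier_integral f \<xi> * g \<xi>) =
     complex_of_real (1 / sqrt (2 * pi)) * (LINT \<xi>|lborel. LINT x|lborel. exp (- (\<i> * complex_of_real (x * \<xi>))) * f x * g \<xi>)"
    by (simp add: fourier_integral_def mult_ac flip: integral_mult_left_zero integral_mult_right_zero)
  also have "(LINT \<xi>|lborel. LINT x|lborel. exp (- (\<i> * complex_of_real (x * \<xi>))) * f x * g \<xi>) =
      (LINT x|lborel. LINT \<xi>|lborel. exp (- (\<i> * complex_of_real (x * \<xi>))) * f x * g \<xi>)"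
    by (rule lborel_pair.Fubini_integral[OF int])
  also have "complex_of_real (1 / sqrt (2 * pi)) * \<dots> = (LINT x|lborel. f x * fourier_integral g x)"
    by (simp add: fourier_integral_def mult_ac flip: integral_mult_left_zero integral_mult_right_zero)
  finally show ?thesis .
qed

lemma pker_bound: assumes "\<epsilon> > 0" shows "pker \<epsilon> v \<le> 1 / \<epsilon>"
  using assms sum_sq_pos[OF assms, of v] by (simp add: pker_def field_simps power2_eq_square)

lemma pker_sq_integrable:
  assumes "\<epsilon> > 0" shows "(\<lambda>t. complex_of_real (pker \<epsilon> (t - x))) \<in> sq_integrable lborel"
proof -
  have "integrable lborel (\<lambda>t. 1 / \<epsilon> * pker \<epsilon> (t - x))"
    using integrable_pker_shift[OF assms] by simp
  then have "integrable lborel (\<lambda>t. (pker \<epsilon> (t - x))\<^sup>2)"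
  proof (rule Bochner_Integration.integrable_bound)
    have "norm ((pker \<epsilon> (t - x))\<^sup>2) \<le> norm (1 / \<epsilon> * pker \<epsilon> (t - x))" for t
      using mult_right_mono[OF pker_bound[OF assms, of "t - x"] pker_nonneg[of \<epsilon> "t - x"]] assms
      by (simp add: power2_eq_square pker_nonneg)
    then show "AE t in lborel. norm ((pker \<epsilon> (t - x))\<^sup>2) \<le> norm (1 / \<epsilon> * pker \<epsilon> (t - x))" by simp
  qed simp
  then show ?thesis by (simp add: sq_integrable_def)
qed

lemma AE_lebesgue_pt_sq:
  assumes f: "f \<in> sq_integrable lborel" shows "AE x in lborel. lebesgue_pt f x"
proof (rule AE_lebesgue_pt)
  show [measurable]: "f \<in> borel_measurable borel" using sq_integrableD(1)[OF f] by simp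
  fix n :: nat
  have "(\<integral>\<^sup>+t. ennreal (cmod (f t)) * indicator {-real n..real n} t \<partial>lborel)
      \<le> (\<integral>\<^sup>+t. ennreal ((cmod (f t))\<^sup>2) + indicator {-real n..real n} t \<partial>lborel)"
  proof (intro nn_integral_mono)
    fix t
    have "cmod (f t) \<le> (cmod (f t))\<^sup>2 + 1"
      using zero_le_power2[of "cmod (f t) - 1/2"] by (simp add: power2_eq_square algebra_simps)
    then have "ennreal (cmod (f t)) \<le> ennreal ((cmod (f t))\<^sup>2 + 1)" by (rule ennreal_leI)
    then show "ennreal (cmod (f t)) * indicator {-real n..real n} t \<le> ennreal ((cmod (f t))\<^sup>2) + indicator {-real n..real n} t"
      by (auto simp: indicator_def)
  qed
  also have "\<dots> < \<infinity>"
    by (subst nn_integral_add) (auto simp: nn_integral_sqn[OF f])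
  finally show "(\<integral>\<^sup>+t. ennreal (cmod (f t)) * indicator {-real n..real n} t \<partial>lborel) < \<infinity>" .
qed

text \<open>Replacing f t by f t - f x costs pi * f x, the mass of the kernel times f x; the
  remainder is covered by the domination lemma.\<close>

lemma poisson_tendsto:
  fixes f :: "real \<Rightarrow> complex"
  assumes f: "f \<in> sq_integrable lborel" and pt: "lebesgue_pt f x"
  shows "((\<lambda>\<epsilon>. LINT t|lborel. complex_of_real (pker \<epsilon> (t - x)) * f t) \<longlongrightarrow> pi * f x) (at_right 0)"
proof -
  have [measurable]: "f \<in> borel_measurable borel" using sq_integrableD(1)[OF f] by simp
  have "((\<lambda>\<epsilon>. LINT t|lborel. complex_of_real (pker \<epsilon> (t - x)) * (f t - f x)) \<longlongrightarrow> 0) (at_right 0)"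
    using nn_integral_sqn[OF f] pt by (intro pker_dominated_tendsto) (auto simp: pker_nonneg)
  then have "((\<lambda>\<epsilon>. (LINT t|lborel. complex_of_real (pker \<epsilon> (t - x)) * (f t - f x)) + pi * f x) \<longlongrightarrow> 0 + pi * f x) (at_right 0)"
    by (intro tendsto_intros)
  moreover have "\<forall>\<^sub>F \<epsilon> in at_right 0. (LINT t|lborel. complex_of_real (pker \<epsilon> (t - x)) * (f t - f x)) + pi * f x
      = (LINT t|lborel. complex_of_real (pker \<epsilon> (t - x)) * f t)"
    using eventually_at_right_less[of "0::real"]
  proof eventually_elim
    case (elim \<epsilon>)
    have "integrable lborel (\<lambda>t. complex_of_real (pker \<epsilon> (t - x)) * f t)"
      by (intro integrable_l2mult pker_sq_integrable elim f)
    moreover have "(LINT t|lborel. complex_of_real (pker \<epsilon> (t - x)) * f x) = pi * f x"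
      using integrable_pker_shift[OF elim, of x] by simp
    ultimately show ?case using integrable_pker_shift[OF elim, of x] by (simp add: right_diff_distrib)
  qed
  ultimately show ?thesis by (simp add: filterlim_cong[OF refl refl])
qed

section \<open>Plancherel's theorem for bounded functions of bounded support\<close>

text \<open>A single constant bounds both the values and the support. These functions are integrable
  and square-integrable, closed under linear combinations, and approximate every square-integrable
  function by truncation.\<close>

definition bc :: "(real \<Rightarrow> complex) set" where
  "bc = {f \<in> borel_measurable borel. \<exists>C. \<forall>x. cmod (f x) \<le> C \<and> (C < \<bar>x\<bar> \<longrightarrow> f x = 0)}"

lemma bcE:
  assumes "f \<in> bc"
  obtains C where "C \<ge> 0" "\<And>x. cmod (f x) \<le> C" "\<And>x. C < \<bar>x\<bar> \<Longrightarrow> f x = 0"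
proof -
  obtain C where C: "\<And>x. cmod (f x) \<le> C" "\<And>x. C < \<bar>x\<bar> \<Longrightarrow> f x = 0"
    using assms by (auto simp: bc_def)
  moreover from C(1)[of 0] have "C \<ge> 0" by (rule order_trans[OF norm_ge_zero])
  ultimately show ?thesis using that by blast
qed

lemma bc_measurable: "f \<in> bc \<Longrightarrow> f \<in> borel_measurable borel" by (simp add: bc_def)

lemma bc_integrable_aux:
  assumes "f \<in> bc"
  shows "integrable lborel f" "integrable lborel (\<lambda>x. (cmod (f x))\<^sup>2)"
proof -
  obtain C where C: "C \<ge> 0" "\<And>x. cmod (f x) \<le> C" "\<And>x. C < \<bar>x\<bar> \<Longrightarrow> f x = 0" using bcE[OF assms] by blast
  note [measurable] = bc_measurable[OF assms]
  have I: "integrable lborel (\<lambda>x. indicator {-C..C} x * K)" for K :: real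
    by (intro integrable_mult_left integrable_real_indicator) (auto simp: emeasure_lborel_Icc_eq)
  show "integrable lborel f"
  proof (rule Bochner_Integration.integrable_bound[OF I[of C]])
    show "AE x in lborel. norm (f x) \<le> norm (indicator {-C..C} x * C)"
      using C by (intro AE_I2) (auto simp: indicator_def abs_le_iff not_le)
  qed simp
  show "integrable lborel (\<lambda>x. (cmod (f x))\<^sup>2)"
  proof (rule Bochner_Integration.integrable_bound[OF I[of "C\<^sup>2"]])
    have "norm ((cmod (f x))\<^sup>2) \<le> norm (indicator {-C..C} x * C\<^sup>2)" for x
    proof (cases "C < \<bar>x\<bar>")
      case False
      then have "indicator {-C..C} x = (1::real)" by (auto simp: indicator_def)
      then show ?thesis using power_mono[OF C(2)[of x], of 2] by simp
    qed (use C in simp)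
    then show "AE x in lborel. norm ((cmod (f x))\<^sup>2) \<le> norm (indicator {-C..C} x * C\<^sup>2)" by simp
  qed simp
qed

lemma bc_integrable: "f \<in> bc \<Longrightarrow> integrable lborel f" by (rule bc_integrable_aux)

lemma bc_sq: "f \<in> bc \<Longrightarrow> f \<in> sq_integrable lborel"
  using bc_integrable_aux(2)[of f] bc_measurable[of f] by (simp add: sq_integrable_def)

lemma bc_lin: assumes "f \<in> bc" "g \<in> bc" shows "(\<lambda>x. c * f x + g x) \<in> bc"
proof -
  obtain C where C: "C \<ge> 0" "\<And>x. cmod (f x) \<le> C" "\<And>x. C < \<bar>x\<bar> \<Longrightarrow> f x = 0" using bcE[OF assms(1)] by blast
  obtain D where D: "D \<ge> 0" "\<And>x. cmod (g x) \<le> D" "\<And>x. D < \<bar>x\<bar> \<Longrightarrow> g x = 0" using bcE[OF assms(2)] by blast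
  note [measurable] = assms[THEN bc_measurable]
  have "cmod (c * f x + g x) \<le> cmod c * C + C + D" for x
  proof -
    have "cmod (c * f x + g x) \<le> cmod c * cmod (f x) + cmod (g x)"
      using norm_triangle_ineq[of "c * f x" "g x"] by (simp add: norm_mult)
    also have "\<dots> \<le> cmod c * C + D" using C D by (intro add_mono mult_left_mono) auto
    finally show ?thesis using C by simp
  qed
  moreover have "c * f x + g x = 0" if "cmod c * C + C + D < \<bar>x\<bar>" for x
    using that C(1) D(1) C(3)[of x] D(3)[of x] mult_nonneg_nonneg[OF norm_ge_zero[of c] C(1)] by simp
  ultimately show ?thesis unfolding bc_def by (auto intro!: exI[of _ "cmod c * C + C + D"])
qed

lemma bc_diff: assumes "f \<in> bc" "g \<in> bc" shows "(\<lambda>x. f x - g x) \<in> bc"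
  using bc_lin[OF assms(2,1), of "-1"] by simp

text \<open>Large values are set to 0, so the result is either f x or 0. It never exceeds f in
  modulus and at each point eventually equals it, as dominated convergence requires.\<close>

definition trunc :: "nat \<Rightarrow> (real \<Rightarrow> complex) \<Rightarrow> real \<Rightarrow> complex" where
  "trunc n f x = (if \<bar>x\<bar> \<le> n \<and> cmod (f x) \<le> n then f x else 0)"

lemma trunc_le: "cmod (trunc n f x) \<le> cmod (f x)" by (simp add: trunc_def)

lemma trunc_tendsto: "(\<lambda>n. trunc n f x) \<longlonglongrightarrow> f x"
proof (rule tendsto_eventually)
  obtain N :: nat where "\<bar>x\<bar> + cmod (f x) \<le> N" using real_arch_simple by blast
  then show "\<forall>\<^sub>F n in sequentially. trunc n f x = f x"
  proof (intro eventually_sequentiallyI)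
    fix n assume "\<bar>x\<bar> + cmod (f x) \<le> N" "N \<le> n"
    then have "\<bar>x\<bar> + cmod (f x) \<le> real n" by linarith
    then show "trunc n f x = f x" by (simp add: trunc_def) (smt (verit) norm_ge_zero)
  qed
qed

lemma trunc_measurable:
  assumes [measurable]: "f \<in> borel_measurable borel"
  shows "trunc n f \<in> borel_measurable borel"
  unfolding trunc_def[abs_def] by measurable

lemma trunc_bc: "f \<in> borel_measurable borel \<Longrightarrow> trunc n f \<in> bc"
  using trunc_measurable[of f n] unfolding bc_def by (auto simp: trunc_def intro!: exI[of _ "real n"])

lemma trunc_l2lim:
  assumes "f \<in> sq_integrable lborel" shows "l2lim lborel (\<lambda>n. trunc n f) f"
proof (rule l2lim_dominated[where w = f])
  have f: "f \<in> borel_measurable borel" using sq_integrableD(1)[OF assms] by simp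
  then show "f \<in> borel_measurable lborel" "\<And>n. trunc n f \<in> borel_measurable lborel"
    using trunc_measurable by auto
qed (auto simp: trunc_tendsto trunc_le assms)

text \<open>A sequence of parameters, so that dominated convergence applies and almost everywhere
  statements combine over countably many parameters.\<close>

definition seq0 :: "nat \<Rightarrow> real" where "seq0 n = 1 / real (Suc n)"

lemma seq0_pos: "seq0 n > 0" by (simp add: seq0_def)

lemma seq0_at_right: "filterlim seq0 (at_right 0) sequentially"
  unfolding filterlim_at using LIMSEQ_Suc[OF lim_1_over_n]
  by (auto simp: seq0_def[abs_def] inverse_eq_divide)

lemma abel_seq0_tendsto: "(\<lambda>n. abel (seq0 n) \<xi>) \<longlonglongrightarrow> 1"
proof -
  have "(\<lambda>n. exp (- (seq0 n * \<bar>\<xi>\<bar>))) \<longlonglongrightarrow> exp (- (0 * \<bar>\<xi>\<bar>))"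
    using seq0_at_right by (intro tendsto_intros) (simp add: filterlim_at)
  then show ?thesis by (simp add: abel_def)
qed

text \<open>Abel-summed inversion. The auxiliary g is the Abel factor modulated by y, whose
  transform is the Poisson kernel translated to y; the multiplication formula moves the transform
  from f to g. The argument - y turns the forward integral into the inverse one.\<close>

lemma fourier_abel_fourier:
  assumes f: "integrable lborel f" and "\<epsilon> > 0"
  shows "fourier_integral (\<lambda>\<xi>. complex_of_real (abel \<epsilon> \<xi>) * fourier_integral f \<xi>) (- y) =
     (LINT t|lborel. complex_of_real (pker \<epsilon> (t - y)) * f t) / pi"
proof -
  define g where "g = (\<lambda>\<xi>. exp (\<i> * complex_of_real (y * \<xi>)) * complex_of_real (abel \<epsilon> \<xi>))"
  have gi: "integrable lborel g"
    unfolding g_def using integrable_abel[OF \<open>\<epsilon> > 0\<close>] by (intro integrable_bounded_mult[where C=1]) auto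
  have Fg: "fourier_integral g x = complex_of_real (2 * pker \<epsilon> (x - y)) / sqrt (2 * pi)" for x
  proof -
    have "(LINT \<xi>|lborel. exp (- (\<i> * complex_of_real (x * \<xi>))) * g \<xi>) =
       (LINT \<xi>|lborel. exp (\<i> * complex_of_real ((y - x) * \<xi>)) * complex_of_real (abel \<epsilon> \<xi>))"
      unfolding g_def mult.assoc[symmetric] exp_add[symmetric] by (simp add: algebra_simps)
    also have "\<dots> = complex_of_real (2 * pker \<epsilon> (x - y))"
      using integral_abel_exp[OF \<open>\<epsilon> > 0\<close>, of "y - x"] pker_minus[of \<epsilon> "x - y"] by simp
    finally show ?thesis by (simp add: fourier_integral_def)
  qed
  have "fourier_integral (\<lambda>\<xi>. complex_of_real (abel \<epsilon> \<xi>) * fourier_integral f \<xi>) (- y) =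
     (LINT \<xi>|lborel. fourier_integral f \<xi> * g \<xi>) / sqrt (2 * pi)"
    by (simp add: fourier_integral_def g_def mult_ac)
  also have "\<dots> = (LINT t|lborel. f t * (complex_of_real (2 * pker \<epsilon> (t - y)) / sqrt (2 * pi))) / sqrt (2 * pi)"
    by (simp only: fourier_multiplication[OF f gi] Fg)
  also have "\<dots> = (LINT t|lborel. complex_of_real (pker \<epsilon> (t - y)) * f t) * (2 / (complex_of_real (sqrt (2 * pi)) * sqrt (2 * pi)))"
    by (simp add: mult_ac flip: integral_mult_left_zero integral_mult_right_zero)
  also have "complex_of_real (sqrt (2 * pi)) * sqrt (2 * pi) = 2 * pi"
    by (simp flip: of_real_mult)
  finally show ?thesis by simp
qed

lemma poisson_bound:
  assumes "\<And>x. cmod (f x) \<le> C" "\<epsilon> > 0" "f \<in> borel_measurable borel"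
  shows "cmod (LINT t|lborel. complex_of_real (pker \<epsilon> (t - y)) * f t) \<le> C * pi"
proof -
  have "cmod (LINT t|lborel. complex_of_real (pker \<epsilon> (t - y)) * f t) \<le> (LINT t|lborel. cmod (complex_of_real (pker \<epsilon> (t - y)) * f t))"
    by (rule integral_norm_bound)
  also have "\<dots> \<le> (LINT t|lborel. C * pker \<epsilon> (t - y))"
  proof (rule integral_mono)
    have i: "integrable lborel (\<lambda>t. f t * complex_of_real (pker \<epsilon> (t - y)))"
      using integrable_pker_shift[OF assms(2)] assms by (intro integrable_bounded_mult[where C=C]) auto
    then show "integrable lborel (\<lambda>t. cmod (complex_of_real (pker \<epsilon> (t - y)) * f t))"
      by (simp add: mult.commute)
    show "integrable lborel (\<lambda>t. C * pker \<epsilon> (t - y))" using integrable_pker_shift[OF assms(2)] by simp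
    show "cmod (complex_of_real (pker \<epsilon> (t - y)) * f t) \<le> C * pker \<epsilon> (t - y)" for t
      using assms by (simp add: norm_mult pker_nonneg mult.commute mult_right_mono)
  qed
  also have "\<dots> = C * pi" using integrable_pker_shift[OF assms(2)] by simp
  finally show ?thesis .
qed

text \<open>The conjugate of a transform is the reflected transform of the conjugate. After
  reflecting the variable, the multiplication formula and Abel-summed inversion turn the damped
  squared norm into a pairing of f with its Poisson mean.\<close>

lemma abel_plancherel:
  assumes f: "f \<in> bc" and "\<epsilon> > 0"
  shows "complex_of_real (LINT \<xi>|lborel. abel \<epsilon> \<xi> * (cmod (fourier_integral f \<xi>))\<^sup>2) =
     (LINT y|lborel. (LINT t|lborel. complex_of_real (pker \<epsilon> (t - y)) * f t) / pi * cnj (f y))"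
proof -
  note [measurable] = f[THEN bc_measurable]
  have fi: "integrable lborel f" using f by (rule bc_integrable)
  define h where "h = (\<lambda>\<xi>. complex_of_real (abel \<epsilon> \<xi>) * fourier_integral f \<xi>)"
  have hi: "integrable lborel h"
  proof -
    have "integrable lborel (\<lambda>\<xi>. fourier_integral f \<xi> * complex_of_real (abel \<epsilon> \<xi>))"
      using integrable_abel[OF \<open>\<epsilon> > 0\<close>] fourier_bounded[OF fi] by (intro integrable_bounded_mult) auto
    then show ?thesis by (simp add: h_def mult.commute)
  qed
  have "complex_of_real (LINT \<xi>|lborel. abel \<epsilon> \<xi> * (cmod (fourier_integral f \<xi>))\<^sup>2) =
     (LINT \<xi>|lborel. complex_of_real (abel \<epsilon> \<xi> * (cmod (fourier_integral f \<xi>))\<^sup>2))"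
    by (rule integral_complex_of_real[symmetric])
  also have "\<dots> = (LINT \<xi>|lborel. h \<xi> * cnj (fourier_integral f \<xi>))"
    by (simp only: h_def complex_norm_square of_real_mult mult.assoc)
  also have "\<dots> = (LINT \<xi>|lborel. h \<xi> * fourier_integral (\<lambda>x. cnj (f x)) (- \<xi>))"
    by (simp only: fourier_cnj)
  also have "\<dots> = (LINT \<xi>|lborel. fourier_integral (\<lambda>x. cnj (f x)) \<xi> * h (- \<xi>))"
    using lborel_integral_uminus[of "\<lambda>\<xi>. h \<xi> * fourier_integral (\<lambda>x. cnj (f x)) (- \<xi>)"] by (simp add: mult.commute)
  also have "\<dots> = (LINT y|lborel. cnj (f y) * fourier_integral (\<lambda>\<xi>. h (- \<xi>)) y)"
    using fi hi by (intro fourier_multiplication lborel_integrable_uminus) auto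
  also have "\<dots> = (LINT y|lborel. (LINT t|lborel. complex_of_real (pker \<epsilon> (t - y)) * f t) / pi * cnj (f y))"
    unfolding fourier_refl unfolding h_def fourier_abel_fourier[OF fi \<open>\<epsilon> > 0\<close>] by (simp add: mult.commute)
  finally show ?thesis .
qed

text \<open>The Abel parameter tends to 0 in the damped identity. On the space side the Poisson
  means converge at Lebesgue points and are bounded by C, so the integrands are dominated by C *
  cmod (f y).\<close>

lemma plancherel_bc:
  assumes f: "f \<in> bc"
  shows "fourier_integral f \<in> sq_integrable lborel" "sqn lborel (fourier_integral f) = sqn lborel f"
proof -
  note [measurable] = f[THEN bc_measurable]
  have fi: "integrable lborel f" and fs: "f \<in> sq_integrable lborel" using f by (auto intro: bc_integrable bc_sq)
  obtain C where C: "C \<ge> 0" "\<And>x. cmod (f x) \<le> C" "\<And>x. C < \<bar>x\<bar> \<Longrightarrow> f x = 0" using bcE[OF f] by blast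
  \<comment> \<open>Half the parameter: squaring the modulus doubles the exponent, so the squared
    norm carries exactly \<open>abel (seq0 n)\<close>.\<close>
  define F where "F = (\<lambda>n \<xi>. complex_of_real (abel (seq0 n / 2) \<xi>) * fourier_integral f \<xi>)"
  have [measurable]: "F n \<in> borel_measurable borel" for n unfolding F_def by measurable
  have abel2: "(abel (seq0 n / 2) \<xi>)\<^sup>2 = abel (seq0 n) \<xi>" for n \<xi>
    by (simp add: abel_def power2_eq_square flip: exp_add)
  have Fsq: "(cmod (F n \<xi>))\<^sup>2 = abel (seq0 n) \<xi> * (cmod (fourier_integral f \<xi>))\<^sup>2" for n \<xi>
    by (simp add: F_def norm_mult power_mult_distrib abel2)
  have F: "F n \<in> sq_integrable lborel" for n
  proof -
    have "integrable lborel (\<lambda>\<xi>. (LINT y|lborel. cmod (f y))\<^sup>2 * abel (seq0 n) \<xi>)"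
      using integrable_abel[OF seq0_pos] by simp
    then have "integrable lborel (\<lambda>\<xi>. (cmod (F n \<xi>))\<^sup>2)"
    proof (rule Bochner_Integration.integrable_bound)
      show "AE \<xi> in lborel. norm ((cmod (F n \<xi>))\<^sup>2) \<le> norm ((LINT y|lborel. cmod (f y))\<^sup>2 * abel (seq0 n) \<xi>)"
        unfolding Fsq using fourier_bounded[OF fi] abel_pos[of "seq0 n"]
        by (intro AE_I2) (auto simp: mult.commute[of "_\<^sup>2"] abs_mult intro!: mult_left_mono power_mono)
    qed simp
    then show ?thesis by (simp add: sq_integrable_def)
  qed
  have lim: "(\<lambda>n. sqn lborel (F n)) \<longlonglongrightarrow> sqn lborel f"
  proof -
    have "(\<lambda>n. LINT y|lborel. (LINT t|lborel. complex_of_real (pker (seq0 n) (t - y)) * f t) / pi * cnj (f y)) \<longlonglongrightarrow> (LINT y|lborel. f y * cnj (f y))"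
    proof (rule integral_dominated_convergence[where w = "\<lambda>y. C * cmod (f y)"])
      show "AE y in lborel. (\<lambda>n. (LINT t|lborel. complex_of_real (pker (seq0 n) (t - y)) * f t) / pi * cnj (f y)) \<longlonglongrightarrow> f y * cnj (f y)"
        using AE_lebesgue_pt_sq[OF fs]
      proof eventually_elim
        case (elim y)
        have "(\<lambda>n. (LINT t|lborel. complex_of_real (pker (seq0 n) (t - y)) * f t)) \<longlonglongrightarrow> pi * f y"
          by (rule filterlim_compose[OF poisson_tendsto[OF fs elim] seq0_at_right])
        then have "(\<lambda>n. (LINT t|lborel. complex_of_real (pker (seq0 n) (t - y)) * f t) / pi * cnj (f y)) \<longlonglongrightarrow> pi * f y / pi * cnj (f y)"
          by (intro tendsto_intros) auto
        then show ?case by simp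
      qed
      show "AE y in lborel. norm ((LINT t|lborel. complex_of_real (pker (seq0 n) (t - y)) * f t) / pi * cnj (f y)) \<le> C * cmod (f y)" for n
      proof (intro AE_I2)
        fix y
        have "norm ((LINT t|lborel. complex_of_real (pker (seq0 n) (t - y)) * f t) / pi) \<le> C"
          using poisson_bound[of f C "seq0 n" y] C seq0_pos[of n] by (simp add: norm_divide divide_le_eq)
        then show "norm ((LINT t|lborel. complex_of_real (pker (seq0 n) (t - y)) * f t) / pi * cnj (f y)) \<le> C * cmod (f y)"
          unfolding norm_mult complex_mod_cnj by (intro mult_right_mono) auto
      qed
    qed (use fi in auto)
    then have "(\<lambda>n. complex_of_real (sqn lborel (F n))) \<longlonglongrightarrow> (LINT y|lborel. f y * cnj (f y))"
      unfolding sqn_def Fsq abel_plancherel[OF f seq0_pos] .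
    also have "(LINT y|lborel. f y * cnj (f y)) = complex_of_real (sqn lborel f)"
      unfolding sqn_def integral_complex_of_real[symmetric] by (simp only: complex_norm_square)
    finally show ?thesis by (simp add: tendsto_of_real_iff)
  qed
  have Flim: "AE \<xi> in lborel. (\<lambda>n. F n \<xi>) \<longlonglongrightarrow> fourier_integral f \<xi>"
  proof (intro AE_I2)
    fix \<xi>
    have "abel (seq0 n / 2) \<xi> = sqrt (abel (seq0 n) \<xi>)" for n
      using abel2[of n \<xi>] abel_pos by (metis less_imp_le real_sqrt_unique)
    then have "(\<lambda>n. abel (seq0 n / 2) \<xi>) \<longlonglongrightarrow> sqrt 1"
      using tendsto_real_sqrt[OF abel_seq0_tendsto[of \<xi>]] by simp
    then have "(\<lambda>n. complex_of_real (abel (seq0 n / 2) \<xi>) * fourier_integral f \<xi>) \<longlonglongrightarrow> complex_of_real (sqrt 1) * fourier_integral f \<xi>"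
      by (intro tendsto_intros)
    then show "(\<lambda>n. F n \<xi>) \<longlonglongrightarrow> fourier_integral f \<xi>" by (simp add: F_def)
  qed
  \<comment> \<open>Fatou with the crude bound first puts the undamped transform into the space;
    only then can it act as its own majorant and give the exact norm.\<close>
  have "\<forall>\<^sub>F n in sequentially. sqn lborel (F n) \<le> sqn lborel f + 1"
    using order_tendstoD(2)[OF lim, of "sqn lborel f + 1"] by (auto elim: eventually_mono)
  from sq_integrable_Fatou(1)[OF F _ Flim this] show sq: "fourier_integral f \<in> sq_integrable lborel" by simp
  have "l2lim lborel F (fourier_integral f)"
  proof (rule l2lim_dominated[OF _ _ Flim sq])
    show "AE x in lborel. cmod (F n x) \<le> cmod (fourier_integral f x)" for n
      using abel_le_1[of "seq0 n / 2"] abel_pos[of "seq0 n / 2"] seq0_pos[of n]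
      by (intro AE_I2) (simp add: F_def norm_mult mult_left_le_one_le less_imp_le)
  qed auto
  from l2lim_sqn[OF F sq this] lim show "sqn lborel (fourier_integral f) = sqn lborel f"
    by (rule LIMSEQ_unique)
qed

section \<open>The Fourier transformation on the Hilbert space\<close>

lemma sqn_refl:
  fixes f :: "real \<Rightarrow> complex"
  shows "sqn lborel (\<lambda>x. f (- x)) = sqn lborel f"
  using lborel_integral_uminus[of "\<lambda>x. (cmod (f x))\<^sup>2"] by (simp add: sqn_def)

lemma sq_refl:
  fixes f :: "real \<Rightarrow> complex"
  assumes "f \<in> sq_integrable lborel" shows "(\<lambda>x. f (- x)) \<in> sq_integrable lborel"
proof -
  have [measurable]: "f \<in> borel_measurable borel" using sq_integrableD(1)[OF assms] by simp
  have "(\<lambda>x. f (- x)) \<in> borel_measurable borel" by measurable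
  then show ?thesis
    using lborel_integrable_uminus[OF sq_integrableD(2)[OF assms]] by (simp add: sq_integrable_def)
qed

lemma l2lim_refl:
  fixes f :: "real \<Rightarrow> complex"
  shows "l2lim lborel F f \<Longrightarrow> l2lim lborel (\<lambda>n x. F n (- x)) (\<lambda>x. f (- x))"
  unfolding l2lim_def using sqn_refl[of "\<lambda>x. F _ x - f x"] by simp

lemma sqn_fourier_diff:
  assumes "f \<in> bc" "g \<in> bc"
  shows "sqn lborel (\<lambda>\<xi>. fourier_integral f \<xi> - fourier_integral g \<xi>) = sqn lborel (\<lambda>x. f x - g x)"
proof -
  have "fourier_integral (\<lambda>x. f x - g x) = (\<lambda>\<xi>. fourier_integral f \<xi> - fourier_integral g \<xi>)"
    using fourier_lin[OF bc_integrable[OF assms(2)] bc_integrable[OF assms(1)], of "-1"] by auto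
  then show ?thesis using plancherel_bc(2)[OF bc_diff[OF assms]] by simp
qed

text \<open>Extension by continuity, on functions rather than classes: an arbitrary representative
  of the limit in mean square, so its properties hold only almost everywhere.\<close>

definition FT :: "(real \<Rightarrow> complex) \<Rightarrow> real \<Rightarrow> complex" where
  "FT f = (SOME g. g \<in> sq_integrable lborel \<and> l2lim lborel (\<lambda>n. fourier_integral (trunc n f)) g)"

lemma FT_exists:
  assumes f: "f \<in> sq_integrable lborel"
  shows "\<exists>g. g \<in> sq_integrable lborel \<and> l2lim lborel (\<lambda>n. fourier_integral (trunc n f)) g"
proof -
  have t: "trunc n f \<in> bc" for n using trunc_bc sq_integrableD(1)[OF f] by simp
  have "\<exists>N. \<forall>m\<ge>N. \<forall>n\<ge>N. sqn lborel (\<lambda>x. fourier_integral (trunc m f) x - fourier_integral (trunc n f) x) < e" if "e > 0" for e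
  proof -
    have "e / 4 > 0" using that by simp
    from order_tendstoD(2)[OF trunc_l2lim[OF f, unfolded l2lim_def] this]
    obtain N where N: "\<And>n. n \<ge> N \<Longrightarrow> sqn lborel (\<lambda>x. trunc n f x - f x) < e / 4"
      by (auto simp: eventually_sequentially)
    have "sqn lborel (\<lambda>x. fourier_integral (trunc m f) x - fourier_integral (trunc n f) x) < e" if "m \<ge> N" "n \<ge> N" for m n
      using sqn_triangle[OF bc_sq[OF t[of m]] f bc_sq[OF t[of n]]] N[OF that(1)] N[OF that(2)]
        sqn_minus_commute[of lborel f "trunc n f"] sqn_fourier_diff[OF t[of m] t[of n]] by linarith
    then show ?thesis by blast
  qed
  then obtain g where "g \<in> sq_integrable lborel" "l2lim lborel (\<lambda>n. fourier_integral (trunc n f)) g"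
    using l2_complete[of "\<lambda>n. fourier_integral (trunc n f)" lborel] plancherel_bc(1)[OF t] by blast
  then show ?thesis by blast
qed

lemma FT_sq: "f \<in> sq_integrable lborel \<Longrightarrow> FT f \<in> sq_integrable lborel"
  and FT_trunc_lim: "f \<in> sq_integrable lborel \<Longrightarrow> l2lim lborel (\<lambda>n. fourier_integral (trunc n f)) (FT f)"
  using someI_ex[OF FT_exists] unfolding FT_def by blast+

lemma FT_measurable: "f \<in> sq_integrable lborel \<Longrightarrow> FT f \<in> borel_measurable borel"
  using FT_sq[of f] sq_integrableD(1)[of "FT f" lborel] by simp

text \<open>Independence of the approximating sequence. Linearity relies on it, because a linear
  combination of truncations is not the truncation of the linear combination.\<close>

lemma FT_bc_lim:
  assumes F: "\<And>n. F n \<in> bc" and f: "f \<in> sq_integrable lborel" and lim: "l2lim lborel F f"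
  shows "l2lim lborel (\<lambda>n. fourier_integral (F n)) (FT f)"
  unfolding l2lim_def
proof (rule tendsto_sandwich[OF _ _ tendsto_const])
  have t: "trunc n f \<in> bc" for n using trunc_bc sq_integrableD(1)[OF f] by simp
  let ?u = "\<lambda>n. 2 * (2 * sqn lborel (\<lambda>x. F n x - f x) + 2 * sqn lborel (\<lambda>x. trunc n f x - f x))
     + 2 * sqn lborel (\<lambda>x. fourier_integral (trunc n f) x - FT f x)"
  have "sqn lborel (\<lambda>x. fourier_integral (F n) x - FT f x) \<le> ?u n" for n
  proof -
    have "sqn lborel (\<lambda>x. fourier_integral (F n) x - fourier_integral (trunc n f) x) \<le>
        2 * sqn lborel (\<lambda>x. F n x - f x) + 2 * sqn lborel (\<lambda>x. trunc n f x - f x)"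
      using sqn_triangle[OF bc_sq[OF F[of n]] f bc_sq[OF t[of n]]] sqn_minus_commute[of lborel f "trunc n f"]
        sqn_fourier_diff[OF F[of n] t[of n]] by simp
    then show ?thesis
      using sqn_triangle[OF plancherel_bc(1)[OF F[of n]] plancherel_bc(1)[OF t[of n]] FT_sq[OF f]] by simp
  qed
  then show "\<forall>\<^sub>F n in sequentially. sqn lborel (\<lambda>x. fourier_integral (F n) x - FT f x) \<le> ?u n" by simp
  have "?u \<longlonglongrightarrow> 2 * (2 * 0 + 2 * 0) + 2 * 0"
    using lim trunc_l2lim[OF f] FT_trunc_lim[OF f] unfolding l2lim_def by (intro tendsto_intros)
  then show "?u \<longlonglongrightarrow> 0" by simp
qed (simp add: sqn_nonneg)

lemma FT_sqn:
  assumes f: "f \<in> sq_integrable lborel" shows "sqn lborel (FT f) = sqn lborel f"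
proof -
  have t: "trunc n f \<in> bc" for n using trunc_bc sq_integrableD(1)[OF f] by simp
  have "(\<lambda>n. sqn lborel (fourier_integral (trunc n f))) \<longlonglongrightarrow> sqn lborel (FT f)"
    by (rule l2lim_sqn[OF plancherel_bc(1)[OF t] FT_sq[OF f] FT_trunc_lim[OF f]])
  moreover have "(\<lambda>n. sqn lborel (trunc n f)) \<longlonglongrightarrow> sqn lborel f"
    by (rule l2lim_sqn[OF bc_sq[OF t] f trunc_l2lim[OF f]])
  ultimately show ?thesis unfolding plancherel_bc(2)[OF t] by (rule LIMSEQ_unique)
qed

lemma FT_lin:
  assumes f: "f \<in> sq_integrable lborel" and g: "g \<in> sq_integrable lborel"
  shows "AE \<xi> in lborel. FT (\<lambda>x. c * f x + g x) \<xi> = c * FT f \<xi> + FT g \<xi>"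
proof -
  have t: "trunc n f \<in> bc" "trunc n g \<in> bc" for n using trunc_bc sq_integrableD(1)[OF f] sq_integrableD(1)[OF g] by auto
  have "l2lim lborel (\<lambda>n x. c * trunc n f x + trunc n g x) (\<lambda>x. c * f x + g x)"
    by (intro l2lim_lin bc_sq t f g trunc_l2lim)
  then have "l2lim lborel (\<lambda>n. fourier_integral (\<lambda>x. c * trunc n f x + trunc n g x)) (FT (\<lambda>x. c * f x + g x))"
    by (intro FT_bc_lim bc_lin t sq_integrable_lin f g)
  moreover have "l2lim lborel (\<lambda>n \<xi>. c * fourier_integral (trunc n f) \<xi> + fourier_integral (trunc n g) \<xi>) (\<lambda>\<xi>. c * FT f \<xi> + FT g \<xi>)"
    by (intro l2lim_lin plancherel_bc(1) t FT_sq f g FT_trunc_lim)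
  moreover have "fourier_integral (\<lambda>x. c * trunc n f x + trunc n g x) = (\<lambda>\<xi>. c * fourier_integral (trunc n f) \<xi> + fourier_integral (trunc n g) \<xi>)" for n
    using fourier_lin[OF bc_integrable[OF t(1)] bc_integrable[OF t(2)]] by auto
  ultimately show ?thesis
    by (intro l2lim_unique[where F="\<lambda>n \<xi>. c * fourier_integral (trunc n f) \<xi> + fourier_integral (trunc n g) \<xi>"])
       (auto intro!: sq_integrable_lin plancherel_bc(1) t FT_sq f g)
qed

lemma FT_diff_sqn:
  assumes f: "f \<in> sq_integrable lborel" and g: "g \<in> sq_integrable lborel"
  shows "sqn lborel (\<lambda>\<xi>. FT f \<xi> - FT g \<xi>) = sqn lborel (\<lambda>x. f x - g x)"
proof -
  have "sqn lborel (\<lambda>\<xi>. FT f \<xi> - FT g \<xi>) = sqn lborel (FT (\<lambda>x. (-1) * g x + f x))"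
  proof (rule sqn_cong_AE)
    show "AE \<xi> in lborel. FT f \<xi> - FT g \<xi> = FT (\<lambda>x. (-1) * g x + f x) \<xi>"
      using FT_lin[OF g f, of "-1"] by eventually_elim simp
  qed (use FT_measurable[OF f] FT_measurable[OF g] FT_measurable[OF sq_integrable_lin[OF g f, of "-1"]] in auto)
  then show ?thesis using FT_sqn[OF sq_integrable_lin[OF g f, of "-1"]] by simp
qed

lemma FT_cong:
  assumes f: "f \<in> sq_integrable lborel" and g: "g \<in> sq_integrable lborel" and "AE x in lborel. f x = g x"
  shows "AE \<xi> in lborel. FT f \<xi> = FT g \<xi>"
proof -
  have "sqn lborel (\<lambda>x. f x - g x) = sqn lborel (\<lambda>x::real. 0)"
    using sq_integrableD(1)[OF f] sq_integrableD(1)[OF g] by (intro sqn_cong_AE) (use assms(3) in auto)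
  then have "sqn lborel (\<lambda>\<xi>. FT f \<xi> - FT g \<xi>) \<le> 0"
    using FT_diff_sqn[OF f g] by (simp add: sqn_def)
  from sqn_eq_0D[OF sq_integrable_diff[OF FT_sq[OF f] FT_sq[OF g]] this] show ?thesis by simp
qed

lemma FT_lim:
  assumes F: "\<And>n. F n \<in> sq_integrable lborel" and f: "f \<in> sq_integrable lborel" and lim: "l2lim lborel F f"
  shows "l2lim lborel (\<lambda>n. FT (F n)) (FT f)"
  using lim unfolding l2lim_def FT_diff_sqn[OF F f] .

lemma FT_inner:
  assumes "f \<in> sq_integrable lborel" "g \<in> sq_integrable lborel"
  shows "l2inner lborel (FT f) (FT g) = l2inner lborel f g"
  by (rule polarization[where S = "sq_integrable lborel"])
     (auto intro: FT_sq sq_integrable_lin FT_lin FT_sqn assms)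

text \<open>The integrals of the truncations converge to the full integral at every point by
  domination, and to \<open>FT f\<close> in mean square by construction; the two limits agree almost
  everywhere.\<close>

lemma FT_integrable:
  assumes f: "f \<in> sq_integrable lborel" and fi: "integrable lborel f"
  shows "AE \<xi> in lborel. FT f \<xi> = fourier_integral f \<xi>" "fourier_integral f \<in> sq_integrable lborel"
proof -
  have [measurable]: "f \<in> borel_measurable borel" using sq_integrableD(1)[OF f] by simp
  have t: "trunc n f \<in> bc" for n by (simp add: trunc_bc)
  have lim: "(\<lambda>n. fourier_integral (trunc n f) \<xi>) \<longlonglongrightarrow> fourier_integral f \<xi>" for \<xi>
  proof -
    have "(\<lambda>n. LINT y|lborel. exp (- (\<i> * complex_of_real (\<xi> * y))) * trunc n f y) \<longlonglongrightarrow> (LINT y|lborel. exp (- (\<i> * complex_of_real (\<xi> * y))) * f y)"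
    proof (rule integral_dominated_convergence[where w = "\<lambda>y. cmod (f y)"])
      show "AE y in lborel. (\<lambda>n. exp (- (\<i> * complex_of_real (\<xi> * y))) * trunc n f y) \<longlonglongrightarrow> exp (- (\<i> * complex_of_real (\<xi> * y))) * f y"
        by (intro AE_I2 tendsto_intros trunc_tendsto)
      show "(\<lambda>y. exp (- (\<i> * complex_of_real (\<xi> * y))) * trunc n f y) \<in> borel_measurable lborel" for n
        using trunc_measurable[of f n] by simp
    qed (use fi trunc_le in \<open>auto simp: norm_mult\<close>)
    then show ?thesis unfolding fourier_integral_def by (rule tendsto_mult_left)
  qed
  from l2lim_AE_unique[OF plancherel_bc(1)[OF t] _ AE_I2[OF lim] FT_sq[OF f] FT_trunc_lim[OF f]]
  show "fourier_integral f \<in> sq_integrable lborel" "AE \<xi> in lborel. FT f \<xi> = fourier_integral f \<xi>"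
    by auto
qed

lemma FT_refl:
  assumes f: "f \<in> sq_integrable lborel"
  shows "AE \<xi> in lborel. FT (\<lambda>x. f (- x)) \<xi> = FT f (- \<xi>)"
proof -
  have t: "trunc n f \<in> bc" for n using trunc_bc sq_integrableD(1)[OF f] by simp
  have "trunc n (\<lambda>x. f (- x)) = (\<lambda>x. trunc n f (- x))" for n by (auto simp: trunc_def)
  then have "l2lim lborel (\<lambda>n \<xi>. fourier_integral (trunc n f) (- \<xi>)) (FT (\<lambda>x. f (- x)))"
    using FT_trunc_lim[OF sq_refl[OF f]] by (simp add: fourier_refl[abs_def])
  moreover have "l2lim lborel (\<lambda>n \<xi>. fourier_integral (trunc n f) (- \<xi>)) (\<lambda>\<xi>. FT f (- \<xi>))"
    by (rule l2lim_refl[OF FT_trunc_lim[OF f]])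
  ultimately show ?thesis
    by (intro l2lim_unique[where F="\<lambda>n \<xi>. fourier_integral (trunc n f) (- \<xi>)"])
       (auto intro!: sq_refl plancherel_bc(1) t FT_sq f)
qed

section \<open>Fourier inversion\<close>

definition FTi :: "(real \<Rightarrow> complex) \<Rightarrow> real \<Rightarrow> complex" where
  "FTi f x = FT f (- x)"

lemma FTi_sq: "f \<in> sq_integrable lborel \<Longrightarrow> FTi f \<in> sq_integrable lborel"
  unfolding FTi_def[abs_def] by (intro sq_refl FT_sq)

lemma FTi_cong:
  assumes "f \<in> sq_integrable lborel" "g \<in> sq_integrable lborel" "AE x in lborel. f x = g x"
  shows "AE \<xi> in lborel. FTi f \<xi> = FTi g \<xi>"
  unfolding FTi_def by (intro AE_lborel_uminus FT_cong assms)

lemma FTi_lim: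
  assumes F: "\<And>n. F n \<in> sq_integrable lborel" and f: "f \<in> sq_integrable lborel" and lim: "l2lim lborel F f"
  shows "l2lim lborel (\<lambda>n. FTi (F n)) (FTi f)"
  unfolding FTi_def[abs_def] by (intro l2lim_refl FT_lim assms)

lemma l2inner_refl:
  fixes f g :: "real \<Rightarrow> complex"
  shows "l2inner lborel (\<lambda>x. f (- x)) (\<lambda>x. g (- x)) = l2inner lborel f g"
  using lborel_integral_uminus[of "\<lambda>x. cnj (f x) * g x"] by (simp add: l2inner_def)

lemma FTi_inner:
  assumes "f \<in> sq_integrable lborel" "g \<in> sq_integrable lborel"
  shows "l2inner lborel (FTi f) (FTi g) = l2inner lborel f g"
  unfolding FTi_def[abs_def] l2inner_refl by (rule FT_inner[OF assms])

lemma FTi_integrable: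
  assumes "f \<in> sq_integrable lborel" "integrable lborel f"
  shows "AE x in lborel. FTi f x = fourier_integral f (- x)"
  unfolding FTi_def by (rule AE_lborel_uminus[OF FT_integrable(1)[OF assms]])

text \<open>The damped transforms h n are integrable, so their inverse transforms are the Poisson
  means of f, which tend to f at Lebesgue points. In mean square they tend to the inverse transform
  of the undamped function, and the limits must coincide.\<close>

lemma FTi_FT_bc:
  assumes f: "f \<in> bc"
  shows "AE x in lborel. FTi (FT f) x = f x"
proof -
  note [measurable] = bc_measurable[OF f]
  have fi: "integrable lborel f" and fs: "f \<in> sq_integrable lborel" using f by (auto intro: bc_integrable bc_sq)
  define h where "h = (\<lambda>n \<xi>. complex_of_real (abel (seq0 n) \<xi>) * fourier_integral f \<xi>)"
  have [measurable]: "h n \<in> borel_measurable borel" for n unfolding h_def by measurable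
  have hle: "cmod (h n \<xi>) \<le> cmod (fourier_integral f \<xi>)" for n \<xi>
    using abel_le_1[of "seq0 n"] abel_pos[of "seq0 n"] seq0_pos[of n]
    by (simp add: h_def norm_mult mult_left_le_one_le less_imp_le)
  have hs: "h n \<in> sq_integrable lborel" for n
    by (rule sq_integrable_bound[OF plancherel_bc(1)[OF f], where C=1]) (auto simp: hle)
  have hi: "integrable lborel (h n)" for n
  proof -
    have "integrable lborel (\<lambda>\<xi>. fourier_integral f \<xi> * complex_of_real (abel (seq0 n) \<xi>))"
      using integrable_abel[OF seq0_pos] fourier_bounded[OF fi] by (intro integrable_bounded_mult) auto
    then show ?thesis by (simp add: h_def mult.commute)
  qed
  have Fs: "fourier_integral f \<in> sq_integrable lborel" by (rule plancherel_bc(1)[OF f])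
  have "l2lim lborel h (fourier_integral f)"
  proof (rule l2lim_dominated[OF _ _ _ Fs])
    show "AE \<xi> in lborel. (\<lambda>n. h n \<xi>) \<longlonglongrightarrow> fourier_integral f \<xi>"
    proof (intro AE_I2)
      fix \<xi>
      have "(\<lambda>n. h n \<xi>) \<longlonglongrightarrow> complex_of_real 1 * fourier_integral f \<xi>"
        unfolding h_def by (intro tendsto_intros abel_seq0_tendsto)
      then show "(\<lambda>n. h n \<xi>) \<longlonglongrightarrow> fourier_integral f \<xi>" by simp
    qed
  qed (auto simp: hle)
  then have lim: "l2lim lborel (\<lambda>n. FTi (h n)) (FTi (fourier_integral f))"
    by (intro FTi_lim hs Fs)
  have "AE x in lborel. \<forall>n. FTi (h n) x = fourier_integral (h n) (- x)"
    using FTi_integrable[OF hs hi] by (simp add: AE_all_countable)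
  then have conv: "AE x in lborel. (\<lambda>n. FTi (h n) x) \<longlonglongrightarrow> f x"
    using AE_lebesgue_pt_sq[OF fs]
  proof eventually_elim
    case (elim x)
    have "(\<lambda>n. (LINT t|lborel. complex_of_real (pker (seq0 n) (t - x)) * f t)) \<longlonglongrightarrow> pi * f x"
      by (rule filterlim_compose[OF poisson_tendsto[OF fs elim(2)] seq0_at_right])
    then have "(\<lambda>n. (LINT t|lborel. complex_of_real (pker (seq0 n) (t - x)) * f t) / pi) \<longlonglongrightarrow> pi * f x / pi"
      by (intro tendsto_intros) auto
    then show ?case using elim(1) by (simp add: h_def fourier_abel_fourier[OF fi seq0_pos])
  qed
  have "AE x in lborel. f x = FTi (fourier_integral f) x"
    by (rule l2lim_AE_unique(1)[OF FTi_sq[OF hs] _ conv FTi_sq[OF Fs] lim]) simp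
  moreover have "AE x in lborel. FTi (FT f) x = FTi (fourier_integral f) x"
    by (intro FTi_cong FT_sq fs Fs FT_integrable(1) fi)
  ultimately show ?thesis by eventually_elim simp
qed

lemma FTi_FT:
  assumes f: "f \<in> sq_integrable lborel"
  shows "AE x in lborel. FTi (FT f) x = f x"
proof -
  have t: "trunc n f \<in> bc" for n using trunc_bc sq_integrableD(1)[OF f] by simp
  have "l2lim lborel (\<lambda>n. FTi (FT (trunc n f))) (FTi (FT f))"
    by (intro FTi_lim FT_lim FT_sq f bc_sq t trunc_l2lim)
  then have "l2lim lborel (\<lambda>n. trunc n f) (FTi (FT f))"
  proof (rule l2lim_cong_AE[rotated -1])
    show "AE x in lborel. FTi (FT (trunc n f)) x = trunc n f x" for n by (rule FTi_FT_bc[OF t])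
  qed (use sq_integrableD(1)[OF FTi_sq[OF FT_sq[OF bc_sq[OF t]]]] sq_integrableD(1)[OF bc_sq[OF t]]
      sq_integrableD(1)[OF FTi_sq[OF FT_sq[OF f]]] in auto)
  from l2lim_unique[OF bc_sq[OF t] _ f this trunc_l2lim[OF f]] show ?thesis
    using FTi_sq[OF FT_sq[OF f]] by blast
qed

lemma FT_FTi:
  assumes f: "f \<in> sq_integrable lborel"
  shows "AE x in lborel. FT (FTi f) x = f x"
proof -
  \<comment> \<open>Reflection commutes with the transform, so the right inverse comes from the left
    inverse.\<close>
  have "AE x in lborel. FT (FTi f) x = FTi (FT f) x"
    unfolding FTi_def[abs_def] by (rule FT_refl[OF FT_sq[OF f]])
  with FTi_FT[OF f] show ?thesis by eventually_elim simp
qed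

lemma FT_inj:
  assumes "f \<in> sq_integrable lborel" "g \<in> sq_integrable lborel" "AE x in lborel. FT f x = FT g x"
  shows "AE x in lborel. f x = g x"
  using FTi_FT[OF assms(1)] FTi_FT[OF assms(2)] FTi_cong[OF FT_sq FT_sq, OF assms] by eventually_elim simp

text \<open>\<open>restrict\<close> meets the extensionality clause in the description of
  \<open>fourier_L2\<close>.\<close>

definition FT_class :: "(real \<Rightarrow> complex) set \<Rightarrow> (real \<Rightarrow> complex) set" where
  "FT_class = restrict (\<lambda>A. L2_class lborel (FT (SOME f. f \<in> A))) (L2 lborel)"

lemma FT_class_eq:
  assumes f: "f \<in> sq_integrable lborel"
  shows "FT_class (L2_class lborel f) = L2_class lborel (FT f)"
proof -
  define g where "g = (SOME g. g \<in> L2_class lborel f)"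
  have "g \<in> L2_class lborel f" unfolding g_def by (rule someI[where P="\<lambda>g. g \<in> L2_class lborel f", OF L2_class_self[OF f]])
  then have g: "g \<in> sq_integrable lborel" "AE x in lborel. f x = g x" by (auto simp: mem_L2_class_iff)
  have "FT_class (L2_class lborel f) = L2_class lborel (FT g)"
    using L2_class_in_L2[OF f] by (simp add: FT_class_def g_def)
  also have "\<dots> = L2_class lborel (FT f)"
    using FT_cong[OF f g] by (intro L2_class_eqI FT_sq f g) auto
  finally show ?thesis .
qed

lemma FT_class_bij: "bij_betw FT_class (L2 lborel) (L2 lborel)"
  unfolding bij_betw_def
proof (rule conjI, rule inj_onI)
  fix A B assume "A \<in> L2 lborel" "B \<in> L2 lborel" and eq: "FT_class A = FT_class B"
  then obtain f g where f: "f \<in> sq_integrable lborel" "A = L2_class lborel f"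
    and g: "g \<in> sq_integrable lborel" "B = L2_class lborel g" by (metis L2_E)
  have "AE x in lborel. FT f x = FT g x"
    using eq f g FT_class_eq by (intro L2_class_eqD FT_sq) auto
  then show "A = B" unfolding f g by (intro L2_class_eqI[OF f(1) g(1)] FT_inj[OF f(1) g(1)])
next
  show "FT_class ` L2 lborel = L2 lborel"
  proof (intro equalityI subsetI)
  fix B assume "B \<in> FT_class ` L2 lborel"
  then obtain A where A: "A \<in> L2 lborel" "B = FT_class A" by blast
  from A(1) obtain f where f: "f \<in> sq_integrable lborel" "A = L2_class lborel f" by (rule L2_E)
  then show "B \<in> L2 lborel" unfolding A(2) using FT_class_eq[OF f(1)] L2_class_in_L2[OF FT_sq[OF f(1)]] by simp
next
  fix B :: "(real \<Rightarrow> complex) set" assume "B \<in> L2 lborel"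
  then obtain g where g: "g \<in> sq_integrable lborel" "B = L2_class lborel g" by (rule L2_E)
  have "FT_class (L2_class lborel (FTi g)) = B"
    using FT_class_eq[OF FTi_sq[OF g(1)]] L2_class_eqI[OF FT_sq[OF FTi_sq[OF g(1)]] g(1) FT_FTi[OF g(1)]] g(2) by simp
  then show "B \<in> FT_class ` L2 lborel" using L2_class_in_L2[OF FTi_sq[OF g(1)]] by blast
  qed
qed

lemma FT_class_unitary: "unitary_L2 lborel lborel FT_class"
  unfolding unitary_L2_def
proof (intro conjI ballI allI FT_class_bij)
  fix f g f' g' :: "real \<Rightarrow> complex"
  assume f: "f \<in> sq_integrable lborel" and g: "g \<in> sq_integrable lborel"
    and "f' \<in> FT_class (L2_class lborel f)" "g' \<in> FT_class (L2_class lborel g)"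
  then have f': "f' \<in> sq_integrable lborel" "AE x in lborel. FT f x = f' x"
    and g': "g' \<in> sq_integrable lborel" "AE x in lborel. FT g x = g' x"
    by (auto simp: FT_class_eq mem_L2_class_iff)
  show "FT_class (L2_class lborel (\<lambda>x. c * f x + g x)) = L2_class lborel (\<lambda>y. c * f' y + g' y)" for c
    unfolding FT_class_eq[OF sq_integrable_lin[OF f g]]
  proof (intro L2_class_eqI FT_sq sq_integrable_lin f g f' g')
    show "AE x in lborel. FT (\<lambda>x. c * f x + g x) x = c * f' x + g' x"
      using FT_lin[OF f g, of c] f'(2) g'(2) by eventually_elim simp
  qed
  have "l2inner lborel (FT f) (FT g) = l2inner lborel f' g'"
    using f' g' FT_sq[OF f] FT_sq[OF g] by (intro l2inner_cong_AE sq_integrableD) auto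
  then show "(LINT y|lborel. cnj (f' y) * g' y) = (LINT x|lborel. cnj (f x) * g x)"
    using FT_inner[OF f g] by (simp add: l2inner_def)
qed

text \<open>Such a T agrees with the Fourier integral on truncations and preserves norms of
  differences. Hence the integrals of the truncations tend to any representative of its value, as
  they do to \<open>FT f\<close>.\<close>

lemma unitary_L2_unique:
  assumes T: "T \<in> extensional (L2 lborel)" "unitary_L2 lborel lborel T"
    "\<And>f. f \<in> sq_integrable lborel \<Longrightarrow> integrable lborel f \<Longrightarrow> T (L2_class lborel f) = L2_class lborel (fourier_integral f)"
  shows "T = FT_class"
proof (rule extensionalityI[OF T(1)])
  have U: "(\<forall>c. T (L2_class lborel (\<lambda>x. c * f x + g x)) = L2_class lborel (\<lambda>y. c * f' y + g' y)) \<and>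
        (LINT y|lborel. cnj (f' y) * g' y) = (LINT x|lborel. cnj (f x) * g x)"
    if "f \<in> sq_integrable lborel" "g \<in> sq_integrable lborel" "f' \<in> T (L2_class lborel f)" "g' \<in> T (L2_class lborel g)"
    for f g f' g'
    using T(2) that unfolding unitary_L2_def by simp
  show "FT_class \<in> extensional (L2 lborel)" by (simp add: FT_class_def)
  fix A :: "(real \<Rightarrow> complex) set" assume "A \<in> L2 lborel"
  then obtain f where f: "f \<in> sq_integrable lborel" "A = L2_class lborel f" by (rule L2_E)
  have t: "trunc n f \<in> bc" for n using trunc_bc sq_integrableD(1)[OF f(1)] by simp
  have "T A \<in> L2 lborel" using T(2) \<open>A \<in> L2 lborel\<close> by (auto simp: unitary_L2_def bij_betw_def)
  then obtain f' where f': "f' \<in> sq_integrable lborel" "T A = L2_class lborel f'" by (rule L2_E)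
  have "sqn lborel (\<lambda>x. fourier_integral (trunc n f) x - f' x) = sqn lborel (\<lambda>x. trunc n f x - f x)" for n
  proof -
    \<comment> \<open>The difference is written with the scalar -1 to be an instance of the
      linearity clause; the inner product clause is then applied to it and itself.\<close>
    let ?d = "\<lambda>x. (-1) * f x + trunc n f x" and ?d' = "\<lambda>x. (-1) * f' x + fourier_integral (trunc n f) x"
    have in1: "f' \<in> T (L2_class lborel f)" using f' f L2_class_self by auto
    have in2: "fourier_integral (trunc n f) \<in> T (L2_class lborel (trunc n f))"
      using T(3)[OF bc_sq[OF t] bc_integrable[OF t]] L2_class_self[OF plancherel_bc(1)[OF t]] by simp
    have "T (L2_class lborel ?d) = L2_class lborel ?d'"
      using U[OF f(1) bc_sq[OF t] in1 in2] by blast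
    then have in3: "?d' \<in> T (L2_class lborel ?d)"
      using L2_class_self[OF sq_integrable_lin[OF f'(1) plancherel_bc(1)[OF t]]] by blast
    have "l2inner lborel ?d' ?d' = l2inner lborel ?d ?d"
      using U[OF sq_integrable_lin[OF f(1) bc_sq[OF t[of n]], of "-1"] sq_integrable_lin[OF f(1) bc_sq[OF t[of n]], of "-1"] in3 in3]
      unfolding l2inner_def by blast
    then have "complex_of_real (sqn lborel ?d') = complex_of_real (sqn lborel ?d)"
      unfolding l2inner_def sqn_def integral_complex_of_real[symmetric]
      by (simp only: complex_norm_square mult.commute)
    then show ?thesis by simp
  qed
  then have "l2lim lborel (\<lambda>n. fourier_integral (trunc n f)) f'"
    using trunc_l2lim[OF f(1)] by (simp add: l2lim_def)
  from l2lim_unique[OF plancherel_bc(1)[OF t] f'(1) FT_sq[OF f(1)] this FT_trunc_lim[OF f(1)]]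
  have "L2_class lborel f' = L2_class lborel (FT f)" by (intro L2_class_eqI f' FT_sq f)
  then show "T A = FT_class A" using f' f FT_class_eq by simp
qed

text \<open>Here the construction meets the definite description: existence and uniqueness together
  allow \<open>fourier_L2\<close> to be evaluated.\<close>

lemma fourier_L2_eq: "fourier_L2 = FT_class"
  unfolding fourier_L2_def
proof (rule the_equality)
  have "FT_class (L2_class lborel f) = L2_class lborel (fourier_integral f)"
    if "f \<in> sq_integrable lborel" "integrable lborel f" for f
    unfolding FT_class_eq[OF that(1)] using that by (intro L2_class_eqI FT_sq FT_integrable)
  then show "FT_class \<in> extensional (L2 lborel) \<and> unitary_L2 lborel lborel FT_class \<and>
     (\<forall>f \<in> sq_integrable lborel. integrable lborel f \<longrightarrow>
        FT_class (L2_class lborel f) = L2_class lborel (fourier_integral f))"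
    using FT_class_unitary by (simp add: FT_class_def)
qed (use unitary_L2_unique in blast)

section \<open>Transport to the interval\<close>

abbreviation I11 :: "real measure" where "I11 \<equiv> interval_measure_11"

text \<open>Chosen so that sqrt (1 / (2 * pi)) = 1 / (2 * acon), which makes
  \<open>gamma_map\<close> equal to artanh divided by \<open>acon\<close>.\<close>

definition acon :: real where "acon = sqrt (pi / 2)"

text \<open>Plays two roles: the inverse of \<open>gamma_map\<close> and the Fourier multiplier of
  the transported operator.\<close>

definition tanh_a :: "real \<Rightarrow> real" where "tanh_a s = tanh (acon * s)"

text \<open>The derivative of \<open>gamma_map\<close> on the open interval, hence the Jacobian of
  the substitution.\<close>

definition dgamma :: "real \<Rightarrow> real" where "dgamma x = 1 / (acon * (1 - x\<^sup>2))"

lemma acon_pos: "acon > 0" by (simp add: acon_def)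

lemma acon_sq: "acon * acon = pi / 2" by (simp add: acon_def)

lemma acon_gamma: "sqrt (1 / (2 * pi)) = 1 / (2 * acon)"
proof (rule real_sqrt_unique)
  show "(1 / (2 * acon))\<^sup>2 = 1 / (2 * pi)"
    by (simp add: power2_eq_square acon_sq)
qed (use acon_pos in simp)

lemma tanh_a_bounds: "-1 < tanh_a s" "tanh_a s < 1"
  by (simp_all add: tanh_a_def tanh_real_gt_neg1 tanh_real_lt_1)

lemma tanh_a_measurable [measurable]: "tanh_a \<in> borel_measurable borel"
proof -
  have "continuous_on UNIV tanh_a"
    unfolding tanh_a_def[abs_def] by (intro continuous_intros) auto
  then show ?thesis by (rule borel_measurable_continuous_onI)
qed

lemma gamma_map_artanh: "gamma_map x = artanh x / acon"
  by (simp add: gamma_map_def artanh_def acon_gamma)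

lemma gamma_tanh_a [simp]: "gamma_map (tanh_a s) = s"
  using acon_pos by (simp add: gamma_map_artanh tanh_a_def artanh_tanh_real)

lemma tanh_a_gamma: assumes "-1 < x" "x < 1" shows "tanh_a (gamma_map x) = x"
proof -
  define y where "y = (1 + x) / (1 - x)"
  have y: "y > 0" using assms by (simp add: y_def)
  have "tanh_a (gamma_map x) = tanh (ln (sqrt y))"
    using acon_pos y by (simp add: gamma_map_artanh tanh_a_def artanh_def y_def[symmetric] ln_sqrt)
  also have "\<dots> = (y - 1) / (y + 1)"
    using y by (simp add: tanh_ln_real)
  also have "\<dots> = x"
    using assms by (simp add: y_def field_simps)
  finally show ?thesis .
qed

lemma gamma_map_measurable [measurable]: "gamma_map \<in> borel_measurable borel"
  unfolding gamma_map_def[abs_def] by measurable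

lemma dgamma_measurable [measurable]: "dgamma \<in> borel_measurable borel"
  unfolding dgamma_def[abs_def] by measurable

lemma dgamma_pos: assumes "-1 < x" "x < 1" shows "dgamma x > 0"
proof -
  have "x\<^sup>2 < 1" using assms by (simp add: abs_square_less_1)
  then show ?thesis using acon_pos by (simp add: dgamma_def)
qed

lemma DERIV_gamma_map:
  assumes "-1 < x" "x < 1" shows "(gamma_map has_real_derivative dgamma x) (at x)"
proof -
  have "(artanh has_real_derivative 1 / (1 - x\<^sup>2)) (at x)"
    using assms by (intro artanh_real_has_field_derivative) auto
  from DERIV_cdivide[OF this, of acon] show ?thesis
    by (simp add: gamma_map_artanh[abs_def] dgamma_def mult.commute)
qed

lemma deriv_gamma_map: "-1 < x \<Longrightarrow> x < 1 \<Longrightarrow> deriv gamma_map x = dgamma x"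
  by (intro DERIV_imp_deriv DERIV_gamma_map)

lemma gamma_map_less_iff:
  assumes "-1 < x" "x < 1" shows "gamma_map x < u \<longleftrightarrow> x < tanh_a u" "l < gamma_map x \<longleftrightarrow> tanh_a l < x"
proof -
  have "tanh_a (gamma_map x) < tanh_a u \<longleftrightarrow> gamma_map x < u" "tanh_a l < tanh_a (gamma_map x) \<longleftrightarrow> l < gamma_map x"
    using acon_pos by (simp_all add: tanh_a_def)
  then show "gamma_map x < u \<longleftrightarrow> x < tanh_a u" "l < gamma_map x \<longleftrightarrow> tanh_a l < x"
    by (simp_all add: tanh_a_gamma[OF assms])
qed

lemma space_I11 [simp]: "space I11 = {-1<..<1}"
  by (simp add: interval_measure_11_def space_restrict_space)

lemma borel_measurable_I11: "f \<in> borel_measurable borel \<Longrightarrow> f \<in> borel_measurable I11"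
  by (simp add: interval_measure_11_def measurable_restrict_space1)

lemma measurable_tanh_a_I11: "tanh_a \<in> measurable borel I11"
  unfolding interval_measure_11_def
  by (rule measurable_restrict_space2) (use tanh_a_bounds in auto)

lemma integral_I11: "(LINT x|I11. f x) = (LINT x|lborel. indicator {-1<..<1} x *\<^sub>R (f x :: complex))"
  by (simp add: interval_measure_11_def integral_restrict_space)

lemma nn_integral_I11: "(\<integral>\<^sup>+x. f x \<partial>I11) = (\<integral>\<^sup>+x. f x * indicator {-1<..<1} x \<partial>lborel)"
  by (simp add: interval_measure_11_def nn_integral_restrict_space)

text \<open>The change of variables as an equality of measures, verified on boxes. Both kinds of
  integral and almost everywhere statements then transfer without separate arguments.\<close>

lemma distr_gamma_map: "distr (density I11 (\<lambda>x. ennreal (dgamma x))) borel gamma_map = lborel"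
proof (rule lborel_eqI[symmetric])
  note [measurable] = borel_measurable_I11[OF gamma_map_measurable] borel_measurable_I11[OF dgamma_measurable]
  fix l u :: real assume "\<And>b. b \<in> Basis \<Longrightarrow> l \<bullet> b \<le> u \<bullet> b"
  then have "l \<le> u" by simp
  then have lu: "tanh_a l \<le> tanh_a u" using acon_pos by (simp add: tanh_a_def)
  have S: "gamma_map -` box l u \<inter> {-1<..<1} \<in> sets I11"
    using measurable_sets[OF borel_measurable_I11[OF gamma_map_measurable], of "box l u"] by simp
  have "emeasure (distr (density I11 (\<lambda>x. ennreal (dgamma x))) borel gamma_map) (box l u)
     = emeasure (density I11 (\<lambda>x. ennreal (dgamma x))) (gamma_map -` box l u \<inter> {-1<..<1})"
    by (subst emeasure_distr) auto
  also have "\<dots> = (\<integral>\<^sup>+x. ennreal (dgamma x) * indicator (gamma_map -` box l u \<inter> {-1<..<1}) x \<partial>I11)"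
    by (rule emeasure_density) (use S in auto)
  also have "\<dots> = (\<integral>\<^sup>+x. ennreal (dgamma x) * indicator {tanh_a l..tanh_a u} x \<partial>lborel)"
    unfolding nn_integral_I11
  proof (rule nn_integral_cong_AE)
    show "AE x in lborel. ennreal (dgamma x) * indicator (gamma_map -` box l u \<inter> {-1<..<1}) x * indicator {-1<..<1} x
       = ennreal (dgamma x) * indicator {tanh_a l..tanh_a u} x"
      \<comment> \<open>The open box pulls back to an open interval; the endpoints added by the
        closed interval are null.\<close>
      using AE_lborel_singleton[of "tanh_a l"] AE_lborel_singleton[of "tanh_a u"]
    proof eventually_elim
      case (elim x)
      then have "x \<in> gamma_map -` box l u \<inter> {-1<..<1} \<and> x \<in> {-1<..<1} \<longleftrightarrow> x \<in> {tanh_a l..tanh_a u}"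
        using tanh_a_bounds[of l] tanh_a_bounds[of u] gamma_map_less_iff[of x] by (auto simp: box_real)
      then show ?case by (auto simp: indicator_def)
    qed
  qed
  also have "\<dots> = ennreal (gamma_map (tanh_a u) - gamma_map (tanh_a l))"
  proof (rule nn_integral_FTC_Icc[OF _ _ _ lu])
    fix x assume "x \<in> {tanh_a l..tanh_a u}"
    then have x: "-1 < x" "x < 1" using tanh_a_bounds[of l] tanh_a_bounds[of u] by auto
    show "(gamma_map has_real_derivative dgamma x) (at x)"
      by (rule DERIV_gamma_map[OF x])
    show "0 \<le> dgamma x" using dgamma_pos[OF x] by simp
  qed simp
  finally show "emeasure (distr (density I11 (\<lambda>x. ennreal (dgamma x))) borel gamma_map) (box l u) = (\<Prod>b\<in>Basis. (u - l) \<bullet> b)"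
    by simp
qed simp

lemma nn_integral_gamma:
  assumes [measurable]: "F \<in> borel_measurable borel"
  shows "(\<integral>\<^sup>+s. F s \<partial>lborel) = (\<integral>\<^sup>+x. ennreal (dgamma x) * F (gamma_map x) \<partial>I11)"
proof -
  note [measurable] = borel_measurable_I11[OF gamma_map_measurable] borel_measurable_I11[OF dgamma_measurable]
  have "(\<integral>\<^sup>+s. F s \<partial>lborel) = (\<integral>\<^sup>+s. F s \<partial>distr (density I11 (\<lambda>x. ennreal (dgamma x))) borel gamma_map)"
    by (simp only: distr_gamma_map)
  also have "\<dots> = (\<integral>\<^sup>+x. ennreal (dgamma x) * F (gamma_map x) \<partial>I11)"
    by (subst nn_integral_distr) (auto simp: nn_integral_density)
  finally show ?thesis .
qed

lemma integral_gamma: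
  fixes F :: "real \<Rightarrow> complex"
  assumes [measurable]: "F \<in> borel_measurable borel"
  shows "(LINT s|lborel. F s) = (LINT x|I11. dgamma x *\<^sub>R F (gamma_map x))"
proof -
  note [measurable] = borel_measurable_I11[OF gamma_map_measurable] borel_measurable_I11[OF dgamma_measurable]
  have "(LINT s|lborel. F s) = (LINT s|distr (density I11 (\<lambda>x. ennreal (dgamma x))) borel gamma_map. F s)"
    by (simp only: distr_gamma_map)
  also have "\<dots> = (LINT x|density I11 (\<lambda>x. ennreal (dgamma x)). F (gamma_map x))"
    by (rule integral_distr) auto
  also have "\<dots> = (LINT x|I11. dgamma x *\<^sub>R F (gamma_map x))"
    by (rule integral_density) (auto intro!: AE_I2 less_imp_le dgamma_pos)
  finally show ?thesis .
qed

text \<open>Null sets of the weighted measure are null for the interval measure because the density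
  is positive on the whole interval.\<close>

lemma AE_gamma:
  assumes "AE s in lborel. P s" shows "AE x in I11. P (gamma_map x)"
proof -
  note [measurable] = borel_measurable_I11[OF gamma_map_measurable] borel_measurable_I11[OF dgamma_measurable]
  from assms have "AE s in distr (density I11 (\<lambda>x. ennreal (dgamma x))) borel gamma_map. P s"
    by (simp only: distr_gamma_map)
  then have "AE x in density I11 (\<lambda>x. ennreal (dgamma x)). P (gamma_map x)"
    by (rule AE_distrD[rotated]) simp
  then have "AE x in I11. 0 < ennreal (dgamma x) \<longrightarrow> P (gamma_map x)"
    by (subst (asm) AE_density) auto
  moreover have "AE x in I11. 0 < ennreal (dgamma x)" by (intro AE_I2) (auto intro: dgamma_pos)
  ultimately show ?thesis by eventually_elim simp
qed

section \<open>The weighted substitution on representatives\<close>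

definition gam :: "(real \<Rightarrow> complex) \<Rightarrow> real \<Rightarrow> complex" where
  "gam f x = complex_of_real (sqrt \<bar>deriv gamma_map x\<bar>) * f (gamma_map x)"

definition gaminv :: "(real \<Rightarrow> complex) \<Rightarrow> real \<Rightarrow> complex" where
  "gaminv g s = g (tanh_a s) / complex_of_real (sqrt (dgamma (tanh_a s)))"

lemma gam_eq: "-1 < x \<Longrightarrow> x < 1 \<Longrightarrow> gam f x = complex_of_real (sqrt (dgamma x)) * f (gamma_map x)"
  using dgamma_pos[of x] by (simp add: gam_def deriv_gamma_map)

lemma gam_gaminv: assumes "-1 < x" "x < 1" shows "gam (gaminv g) x = g x"
  using dgamma_pos[OF assms] by (simp add: gam_eq[OF assms] gaminv_def tanh_a_gamma[OF assms])

lemma gam_sq: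
  assumes f: "f \<in> sq_integrable lborel"
  shows "gam f \<in> sq_integrable I11" "sqn I11 (gam f) = sqn lborel f"
proof -
  note [measurable] = borel_measurable_I11[OF gamma_map_measurable] borel_measurable_I11[OF dgamma_measurable]
  have [measurable]: "f \<in> borel_measurable borel" using sq_integrableD(1)[OF f] by simp
  have "(\<lambda>x. complex_of_real (sqrt (dgamma x)) * f (gamma_map x)) \<in> borel_measurable I11" by measurable
  then have m: "gam f \<in> borel_measurable I11"
    by (rule measurable_cong[THEN iffD1, rotated]) (auto simp: gam_eq)
  have nn: "(\<integral>\<^sup>+x. ennreal ((cmod (gam f x))\<^sup>2) \<partial>I11) = ennreal (sqn lborel f)"
  proof -
    have "(\<integral>\<^sup>+x. ennreal ((cmod (gam f x))\<^sup>2) \<partial>I11) = (\<integral>\<^sup>+x. ennreal (dgamma x) * ennreal ((cmod (f (gamma_map x)))\<^sup>2) \<partial>I11)"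
    proof (intro nn_integral_cong)
      fix x assume "x \<in> space I11"
      then have x: "-1 < x" "x < 1" by auto
      show "ennreal ((cmod (gam f x))\<^sup>2) = ennreal (dgamma x) * ennreal ((cmod (f (gamma_map x)))\<^sup>2)"
        using dgamma_pos[OF x] by (simp add: gam_eq[OF x] norm_mult power_mult_distrib ennreal_mult[symmetric])
    qed
    then show ?thesis using nn_integral_gamma[of "\<lambda>s. ennreal ((cmod (f s))\<^sup>2)"] nn_integral_sqn[OF f] by simp
  qed
  then show sq: "gam f \<in> sq_integrable I11" using m by (intro sq_integrableI) auto
  show "sqn I11 (gam f) = sqn lborel f" using nn unfolding nn_integral_sqn[OF sq] by (simp add: sqn_nonneg)
qed

lemma gaminv_sq:
  assumes g: "g \<in> sq_integrable I11" shows "gaminv g \<in> sq_integrable lborel"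
proof (rule sq_integrableI)
  have "(\<lambda>s. g (tanh_a s)) \<in> borel_measurable borel"
    by (rule measurable_compose[OF measurable_tanh_a_I11]) (use sq_integrableD(1)[OF g] in simp)
  then have [measurable]: "gaminv g \<in> borel_measurable borel"
    unfolding gaminv_def[abs_def] by measurable
  then show "gaminv g \<in> borel_measurable lborel" by simp
  have "(\<integral>\<^sup>+s. ennreal ((cmod (gaminv g s))\<^sup>2) \<partial>lborel) = (\<integral>\<^sup>+x. ennreal (dgamma x) * ennreal ((cmod (gaminv g (gamma_map x)))\<^sup>2) \<partial>I11)"
    by (rule nn_integral_gamma) simp
  also have "\<dots> = (\<integral>\<^sup>+x. ennreal ((cmod (g x))\<^sup>2) \<partial>I11)"
  proof (intro nn_integral_cong)
    fix x assume "x \<in> space I11"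
    then have x: "-1 < x" "x < 1" by auto
    show "ennreal (dgamma x) * ennreal ((cmod (gaminv g (gamma_map x)))\<^sup>2) = ennreal ((cmod (g x))\<^sup>2)"
      using dgamma_pos[OF x] by (simp add: gaminv_def tanh_a_gamma[OF x] norm_divide power_divide ennreal_mult[symmetric])
  qed
  finally show "(\<integral>\<^sup>+s. ennreal ((cmod (gaminv g s))\<^sup>2) \<partial>lborel) < \<infinity>"
    by (simp add: nn_integral_sqn[OF g])
qed

lemma gam_cong:
  assumes "AE s in lborel. f s = g s" shows "AE x in I11. gam f x = gam g x"
  using AE_gamma[OF assms] by eventually_elim (simp add: gam_def)

lemma gam_inj:
  assumes f: "f \<in> sq_integrable lborel" and g: "g \<in> sq_integrable lborel" and "AE x in I11. gam f x = gam g x"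
  shows "AE s in lborel. f s = g s"
proof -
  have d: "gam (\<lambda>s. f s - g s) = (\<lambda>x. gam f x - gam g x)" by (simp add: gam_def fun_eq_iff right_diff_distrib)
  have "sqn lborel (\<lambda>s. f s - g s) = sqn I11 (\<lambda>x. gam f x - gam g x)"
    using gam_sq(2)[OF sq_integrable_diff[OF f g]] unfolding d by simp
  also have "\<dots> = sqn I11 (\<lambda>x::real. 0)"
    using sq_integrableD(1)[OF gam_sq(1)[OF f]] sq_integrableD(1)[OF gam_sq(1)[OF g]] assms(3)
    by (intro sqn_cong_AE) auto
  finally have "sqn lborel (\<lambda>s. f s - g s) \<le> 0" by (simp add: sqn_def)
  from sqn_eq_0D[OF sq_integrable_diff[OF f g] this] show ?thesis by simp
qed

text \<open>The union over representatives is a union of copies of one class, since the substitution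
  respects equality almost everywhere.\<close>

lemma Gamma_op_class:
  assumes f: "f \<in> sq_integrable lborel"
  shows "Gamma_op (L2_class lborel f) = L2_class I11 (gam f)"
proof -
  have "L2_class I11 (gam f') = L2_class I11 (gam f)" if "f' \<in> L2_class lborel f" for f'
    using that f unfolding mem_L2_class_iff
    by (intro L2_class_eqI gam_sq gam_cong) (auto elim: eventually_mono)
  then have "(\<Union>f'\<in>L2_class lborel f. L2_class I11 (gam f')) = (\<Union>f'\<in>L2_class lborel f. L2_class I11 (gam f))"
    by (intro SUP_cong refl)
  moreover have "L2_class lborel f \<noteq> {}" using L2_class_self[OF f] by blast
  moreover have "Gamma_op (L2_class lborel f) = (\<Union>f'\<in>L2_class lborel f. L2_class I11 (gam f'))"
    by (simp add: Gamma_op_def gam_def[abs_def])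
  ultimately show ?thesis by simp
qed

lemma Gamma_op_inj: "inj_on Gamma_op (L2 lborel)"
proof (rule inj_onI)
  fix A B assume "A \<in> L2 lborel" "B \<in> L2 lborel" and eq: "Gamma_op A = Gamma_op B"
  then obtain f g where f: "f \<in> sq_integrable lborel" "A = L2_class lborel f"
    and g: "g \<in> sq_integrable lborel" "B = L2_class lborel g" by (metis L2_E)
  have "AE x in I11. gam f x = gam g x"
    using eq f g Gamma_op_class by (intro L2_class_eqD gam_sq) auto
  then show "A = B" unfolding f g by (intro L2_class_eqI[OF f(1) g(1)] gam_inj[OF f(1) g(1)])
qed

text \<open>Surjectivity of the substitution: every vector on the interval comes from the line,
  where the transform and the multiplier can be computed.\<close>

lemma L2_I11_E:
  assumes "A \<in> L2 I11" obtains f where "f \<in> sq_integrable lborel" "A = L2_class I11 (gam f)"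
proof -
  obtain g where g: "g \<in> sq_integrable I11" "A = L2_class I11 g" using assms by (rule L2_E)
  have "AE x in I11. g x = gam (gaminv g) x" by (intro AE_I2) (auto simp: gam_gaminv)
  then have "A = L2_class I11 (gam (gaminv g))"
    unfolding g(2) by (rule L2_class_eqI[OF g(1) gam_sq(1)[OF gaminv_sq[OF g(1)]]])
  then show ?thesis using that gaminv_sq[OF g(1)] by blast
qed

text \<open>Both inverses are given by \<open>inv_into\<close>; each is evaluated by exhibiting a
  preimage and using injectivity on the Hilbert space.\<close>

lemma U_op_class:
  assumes f: "f \<in> sq_integrable lborel"
  shows "U_op (L2_class I11 (gam f)) = L2_class I11 (gam (FTi f))"
proof -
  have "inv_into (L2 lborel) Gamma_op (L2_class I11 (gam f)) = L2_class lborel f"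
    using inv_into_f_f[OF Gamma_op_inj L2_class_in_L2[OF f]] by (simp add: Gamma_op_class[OF f])
  moreover have "FT_class (L2_class lborel (FTi f)) = L2_class lborel f"
    using FT_class_eq[OF FTi_sq[OF f]] L2_class_eqI[OF FT_sq[OF FTi_sq[OF f]] f FT_FTi[OF f]] by simp
  then have "inv_into (L2 lborel) fourier_L2 (L2_class lborel f) = L2_class lborel (FTi f)"
    unfolding fourier_L2_eq
    using inv_into_f_f[OF bij_betw_imp_inj_on[OF FT_class_bij] L2_class_in_L2[OF FTi_sq[OF f]]] by simp
  ultimately show ?thesis by (simp add: U_op_def Gamma_op_class[OF FTi_sq[OF f]])
qed

lemma U_op_inj: "inj_on U_op (L2 I11)"
proof (rule inj_onI)
  fix A B assume A: "A \<in> L2 I11" and B: "B \<in> L2 I11" and eq: "U_op A = U_op B"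
  from A obtain f where f: "f \<in> sq_integrable lborel" "A = L2_class I11 (gam f)" by (rule L2_I11_E)
  from B obtain g where g: "g \<in> sq_integrable lborel" "B = L2_class I11 (gam g)" by (rule L2_I11_E)
  have "L2_class I11 (gam (FTi f)) = L2_class I11 (gam (FTi g))"
    using eq U_op_class[OF f(1)] U_op_class[OF g(1)] f(2) g(2) by simp
  then have "AE x in I11. gam (FTi f) x = gam (FTi g) x"
    by (rule L2_class_eqD[OF _ gam_sq(1)[OF FTi_sq[OF f(1)]] gam_sq(1)[OF FTi_sq[OF g(1)]]])
  then have "AE x in lborel. FTi f x = FTi g x" by (rule gam_inj[OF FTi_sq[OF f(1)] FTi_sq[OF g(1)]])
  from FT_cong[OF FTi_sq[OF f(1)] FTi_sq[OF g(1)] this]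
  have "AE x in lborel. f x = g x" using FT_FTi[OF f(1)] FT_FTi[OF g(1)] by eventually_elim simp
  then show "A = B" unfolding f g by (rule L2_class_eqI[OF gam_sq(1)[OF f(1)] gam_sq(1)[OF g(1)] gam_cong])
qed

lemma inv_U_op_class:
  assumes f: "f \<in> sq_integrable lborel"
  shows "inv_into (L2 I11) U_op (L2_class I11 (gam f)) = L2_class I11 (gam (FT f))"
proof -
  have "U_op (L2_class I11 (gam (FT f))) = L2_class I11 (gam f)"
    by (rule trans[OF U_op_class[OF FT_sq[OF f]]], rule L2_class_eqI[OF gam_sq(1)[OF FTi_sq[OF FT_sq[OF f]]] gam_sq(1)[OF f] gam_cong[OF FTi_FT[OF f]]])
  then show ?thesis
    using inv_into_f_f[OF U_op_inj L2_class_in_L2[OF gam_sq(1)[OF FT_sq[OF f]]]] by simp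
qed

lemma tanh_mult_sq:
  assumes f: "f \<in> sq_integrable lborel"
  shows "(\<lambda>\<xi>. complex_of_real (tanh_a \<xi>) * f \<xi>) \<in> sq_integrable lborel"
proof (rule sq_integrable_bound[OF f, where C = 1])
  have [measurable]: "f \<in> borel_measurable borel" using sq_integrableD(1)[OF f] by simp
  show "(\<lambda>\<xi>. complex_of_real (tanh_a \<xi>) * f \<xi>) \<in> borel_measurable lborel" by simp
  have "\<bar>tanh_a \<xi>\<bar> \<le> 1" for \<xi> using tanh_a_bounds[of \<xi>] by simp
  then show "AE \<xi> in lborel. cmod (complex_of_real (tanh_a \<xi>) * f \<xi>) \<le> 1 * cmod (f \<xi>)"
    by (intro AE_I2) (simp add: norm_mult mult_left_le_one_le)
qed

lemma L2_mult_class: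
  assumes f: "f \<in> sq_integrable lborel"
  shows "L2_mult I11 complex_of_real (L2_class I11 (gam f)) = L2_class I11 (gam (\<lambda>\<xi>. complex_of_real (tanh_a \<xi>) * f \<xi>))"
proof -
  have eq: "complex_of_real x * gam f x = gam (\<lambda>\<xi>. complex_of_real (tanh_a \<xi>) * f \<xi>) x" if "-1 < x" "x < 1" for x
    by (simp add: gam_eq[OF that] tanh_a_gamma[OF that])
  have "L2_class I11 (\<lambda>t. complex_of_real t * k t) = L2_class I11 (gam (\<lambda>\<xi>. complex_of_real (tanh_a \<xi>) * f \<xi>))"
    if k: "k \<in> L2_class I11 (gam f)" for k
  proof (rule L2_class_eqI)
    have ks: "k \<in> sq_integrable I11" "AE x in I11. gam f x = k x" using k by (auto simp: mem_L2_class_iff)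
    show "gam (\<lambda>\<xi>. complex_of_real (tanh_a \<xi>) * f \<xi>) \<in> sq_integrable I11"
      by (rule gam_sq(1)[OF tanh_mult_sq[OF f]])
    have "AE x in I11. -1 < x \<and> x < 1" by (intro AE_I2) auto
    with ks(2) show ae: "AE x in I11. complex_of_real x * k x = gam (\<lambda>\<xi>. complex_of_real (tanh_a \<xi>) * f \<xi>) x"
      by eventually_elim (use eq in metis)
    note [measurable] = sq_integrableD(1)[OF ks(1)] borel_measurable_I11[OF measurable_ident_sets[OF refl], unfolded id_def]
    show "(\<lambda>t. complex_of_real t * k t) \<in> sq_integrable I11"
      by (rule sq_integrable_cong_AE[OF gam_sq(1)[OF tanh_mult_sq[OF f]] _ ae]) simp
  qed
  then show ?thesis unfolding L2_mult_def using L2_class_self[OF gam_sq(1)[OF f]] by blast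
qed

section \<open>The multiplier operator and the reduction to principal values\<close>

definition TT :: "(real \<Rightarrow> complex) \<Rightarrow> real \<Rightarrow> complex" where
  "TT f = FTi (\<lambda>\<xi>. complex_of_real (tanh_a \<xi>) * FT f \<xi>)"

lemma TT_sq: "f \<in> sq_integrable lborel \<Longrightarrow> TT f \<in> sq_integrable lborel"
  unfolding TT_def by (intro FTi_sq tanh_mult_sq FT_sq)

lemma TT_cong:
  assumes "f \<in> sq_integrable lborel" "g \<in> sq_integrable lborel" "AE s in lborel. f s = g s"
  shows "AE s in lborel. TT f s = TT g s"
  unfolding TT_def
proof (intro FTi_cong tanh_mult_sq FT_sq assms)
  show "AE \<xi> in lborel. complex_of_real (tanh_a \<xi>) * FT f \<xi> = complex_of_real (tanh_a \<xi>) * FT g \<xi>"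
    using FT_cong[OF assms] by eventually_elim simp
qed

lemma spectral_side:
  assumes f: "f \<in> sq_integrable lborel"
  shows "(U_op \<circ> L2_mult I11 complex_of_real \<circ> inv_into (L2 I11) U_op) (L2_class I11 (gam f)) = L2_class I11 (gam (TT f))"
  by (simp add: inv_U_op_class[OF f] L2_mult_class[OF FT_sq[OF f]] U_op_class[OF tanh_mult_sq[OF FT_sq[OF f]]] TT_def)

text \<open>Both sides are sets of functions, so two inclusions are needed. For the harder one, a
  member comes with some representative g' of the class. The principal value formula is applied to
  g' itself, limits are unique, and \<open>TT\<close> respects equality almost everywhere.\<close>

lemma finite_hilbert_reduction:
  assumes key: "\<And>g. g \<in> sq_integrable I11 \<Longrightarrow>
      AE x in I11. has_principal_value g x (\<i> * complex_of_real pi * gam (TT (gaminv g)) x)"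
    and g: "g \<in> sq_integrable I11"
  shows "finite_hilbert (L2_class I11 g) = L2_class I11 (gam (TT (gaminv g)))"
proof (rule set_eqI, rule iffI)
  let ?h = "gam (TT (gaminv g))"
  fix h assume h: "h \<in> L2_class I11 ?h"
  have "AE x in I11. \<exists>l. has_principal_value g x l \<and> h x = 1 / (\<i> * complex_of_real pi) * l"
    using key[OF g] h[unfolded mem_L2_class_iff, THEN conjunct2, THEN conjunct2]
    by eventually_elim (auto intro!: exI)
  then show "h \<in> finite_hilbert (L2_class I11 g)"
    using h L2_class_self[OF g] unfolding finite_hilbert_def mem_L2_class_iff[of h] by blast
next
  let ?h = "gam (TT (gaminv g))"
  fix h assume "h \<in> finite_hilbert (L2_class I11 g)"
  then obtain g' where h: "h \<in> sq_integrable I11" and g': "g' \<in> L2_class I11 g"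
    and pv: "AE x in I11. \<exists>l. has_principal_value g' x l \<and> h x = 1 / (\<i> * complex_of_real pi) * l"
    by (auto simp: finite_hilbert_def)
  have g's: "g' \<in> sq_integrable I11" "AE x in I11. g x = g' x" using g' by (auto simp: mem_L2_class_iff)
  have "AE x in I11. -1 < x \<and> x < 1" by (intro AE_I2) auto
  with g's(2) have "AE x in I11. gam (gaminv g) x = gam (gaminv g') x"
    by eventually_elim (simp add: gam_gaminv)
  then have "AE s in lborel. gaminv g s = gaminv g' s" by (rule gam_inj[OF gaminv_sq[OF g] gaminv_sq[OF g's(1)]])
  then have "AE x in I11. ?h x = gam (TT (gaminv g')) x"
    by (rule gam_cong[OF TT_cong[OF gaminv_sq[OF g] gaminv_sq[OF g's(1)]]])
  with pv key[OF g's(1)] have "AE x in I11. ?h x = h x"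
  proof eventually_elim
    case (elim x)
    then obtain l where l: "has_principal_value g' x l" "h x = 1 / (\<i> * complex_of_real pi) * l" by blast
    from l(1) elim(2) have "l = \<i> * complex_of_real pi * gam (TT (gaminv g')) x"
      unfolding has_principal_value_def by (rule tendsto_unique[OF trivial_limit_at_right_real])
    then show ?case using l(2) elim(3) by simp
  qed
  then show "h \<in> L2_class I11 ?h" using h by (auto simp: mem_L2_class_iff gam_sq(1)[OF TT_sq[OF gaminv_sq[OF g]]])
qed

section \<open>Partial fractions of the hyperbolic cosecant\<close>

text \<open>Isolates the terms of one parity: these are the terms of a series at half the argument,
  which relates the cosecant series to two cotangent series.\<close>

lemma sum_alternating_split:
  fixes f :: "nat \<Rightarrow> complex"
  shows "(\<Sum>n<2 * m. (-1) ^ n * f n) = 2 * (\<Sum>k<m. f (2 * k)) - (\<Sum>n<2 * m. f n)"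
    and "(\<Sum>n<2 * m. (-1) ^ n * f n) = (\<Sum>n<2 * m. f n) - 2 * (\<Sum>k<m. f (2 * k + 1))"
  by (induction m) (simp_all add: algebra_simps)

text \<open>The logarithmic derivative of the reflection formula for Gamma.\<close>

lemma Digamma_reflection:
  fixes z :: complex
  assumes z: "z \<notin> \<int>"
  shows "Digamma (1 - z) - Digamma z = pi * cos (pi * z) / sin (pi * z)"
proof -
  have nz: "w \<notin> \<int>\<^sub>\<le>\<^sub>0" "1 - w \<notin> \<int>\<^sub>\<le>\<^sub>0" "sin (pi * w) \<noteq> 0" if "w \<notin> \<int>" for w :: complex
  proof -
    show "w \<notin> \<int>\<^sub>\<le>\<^sub>0" using that nonpos_Ints_subset_Ints by blast
    have "1 - w \<notin> \<int>" using that Ints_diff[of 1 "1 - w"] by auto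
    then show "1 - w \<notin> \<int>\<^sub>\<le>\<^sub>0" using nonpos_Ints_subset_Ints by blast
    show "sin (pi * w) \<noteq> 0"
    proof
      assume "sin (pi * w) = 0"
      then obtain n :: int where "pi * w = of_real (real_of_int n * pi)" unfolding sin_eq_0 by blast
      then have "w = of_int n" by simp
      then show False using that by auto
    qed
  qed
  let ?F = "\<lambda>w::complex. Gamma w * Gamma (1 - w) * sin (pi * w)"
  have "(?F has_field_derivative (Gamma z * Digamma z * Gamma (1 - z) - Gamma z * (Gamma (1 - z) * Digamma (1 - z))) * sin (pi * z)
     + Gamma z * Gamma (1 - z) * (cos (pi * z) * pi)) (at z)"
    using nz[OF z] by (auto intro!: derivative_eq_intros simp: algebra_simps)
  moreover have "(?F has_field_derivative 0) (at z)"
  \<comment> \<open>The product is the constant pi off the integers, an open set, so it is constant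
    near z.\<close>
  proof (rule DERIV_cong_ev[THEN iffD1, OF refl _ refl DERIV_const])
    have "open (- \<int> :: complex set)" using closed_Ints by (simp add: open_Compl)
    then have "\<forall>\<^sub>F w in nhds z. w \<in> - \<int>" using z by (intro eventually_nhds_in_open) auto
    then show "\<forall>\<^sub>F w in nhds z. complex_of_real pi = ?F w"
      by eventually_elim (use nz Gamma_reflection_complex in simp)
  qed
  ultimately have "(Gamma z * Digamma z * Gamma (1 - z) - Gamma z * (Gamma (1 - z) * Digamma (1 - z))) * sin (pi * z)
     + Gamma z * Gamma (1 - z) * (cos (pi * z) * pi) = 0"
    by (rule DERIV_unique)
  then have "Gamma z * Gamma (1 - z) * ((Digamma z - Digamma (1 - z)) * sin (pi * z) + cos (pi * z) * pi) = 0"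
    by (simp add: algebra_simps)
  moreover have "Gamma z * Gamma (1 - z) \<noteq> 0" using nz[OF z] by (simp add: Gamma_eq_zero_iff)
  ultimately have "(Digamma z - Digamma (1 - z)) * sin (pi * z) + cos (pi * z) * pi = 0" by simp
  then show ?thesis using nz(3)[OF z] by (simp add: divide_simps) (simp add: algebra_simps add_eq_0_iff)
qed

text \<open>The logarithmic terms in the two Digamma limits cancel.\<close>

lemma cot_partial_fractions:
  fixes z :: complex
  assumes z: "z \<notin> \<int>"
  shows "(\<lambda>m. (\<Sum>n<m. inverse (z + of_nat n)) - (\<Sum>n<m. inverse (1 - z + of_nat n))) \<longlonglongrightarrow> pi * cos (pi * z) / sin (pi * z)"
proof -
  have "z \<noteq> 0" "1 - z \<noteq> 0" using z by auto
  from tendsto_diff[OF Digamma_LIMSEQ[OF this(2)] Digamma_LIMSEQ[OF this(1)]]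
  show ?thesis by (simp add: Digamma_reflection[OF z])
qed

text \<open>The identity cot t - cot (2 * t) = 1 / sin (2 * t) with t = pi * z / 2, read off from
  partial sums: the terms of even index in z and of odd index in 1 - z form the cotangent series at
  z / 2.\<close>

lemma csc_partial_fractions:
  fixes z :: complex
  assumes z: "z \<notin> \<int>"
  shows "(\<lambda>m. \<Sum>n<2 * m. (-1) ^ n * (inverse (z + of_nat n) + inverse (1 - z + of_nat n))) \<longlonglongrightarrow> pi / sin (pi * z)"
proof -
  let ?S = "\<lambda>z m. (\<Sum>n<m. inverse (z + of_nat n)) - (\<Sum>n<m. inverse (1 - z + of_nat n))"
  have z2: "z / 2 \<notin> \<int>"
  proof
    assume "z / 2 \<in> \<int>"
    then have "2 * (z / 2) \<in> \<int>" by (intro Ints_mult) auto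
    then show False using z by simp
  qed
  have half: "2 * inverse (w + of_nat (2 * k)) = inverse (w / 2 + of_nat k)" for w :: complex and k
    by (cases "w + of_nat (2 * k) = 0") (auto simp: field_simps)
  have "(\<Sum>n<2 * m. (-1) ^ n * (inverse (z + of_nat n) + inverse (1 - z + of_nat n))) = ?S (z / 2) m - ?S z (2 * m)" for m
  proof -
    have "2 * (\<Sum>k<m. inverse (z + of_nat (2 * k))) = (\<Sum>k<m. inverse (z / 2 + of_nat k))"
      unfolding sum_distrib_left half ..
    moreover have "2 * (\<Sum>k<m. inverse (1 - z + of_nat (2 * k + 1))) = (\<Sum>k<m. inverse (1 - z / 2 + of_nat k))"
      using half[of "2 - z"] by (simp add: sum_distrib_left algebra_simps diff_divide_distrib)
    ultimately show ?thesis
      using sum_alternating_split(1)[of "\<lambda>n. inverse (z + of_nat n)" m]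
        sum_alternating_split(2)[of "\<lambda>n. inverse (1 - z + of_nat n)" m]
      by (simp add: distrib_left sum.distrib)
  qed
  moreover have "(\<lambda>m. ?S (z / 2) m - ?S z (2 * m)) \<longlonglongrightarrow> pi * cos (pi * (z / 2)) / sin (pi * (z / 2)) - pi * cos (pi * z) / sin (pi * z)"
    by (intro tendsto_diff cot_partial_fractions z2 filterlim_compose[OF cot_partial_fractions[OF z]])
       (auto intro!: filterlim_subseq strict_monoI)
  moreover have "pi * cos (pi * (z / 2)) / sin (pi * (z / 2)) - pi * cos (pi * z) / sin (pi * z) = pi / sin (pi * z)"
  proof -
    define t where "t = pi * (z / 2)"
    have t2: "pi * z = 2 * t" by (simp add: t_def)
    have "sin (2 * t) \<noteq> 0"
    proof
      assume "sin (2 * t) = 0"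
      then obtain n :: int where "pi * z = of_real (real_of_int n * pi)" unfolding t2[symmetric] sin_eq_0 by blast
      then have "z = of_int n" by simp
      then show False using z by auto
    qed
    then have st: "sin t \<noteq> 0" "cos t \<noteq> 0" by (auto simp: sin_double)
    have "cos t / sin t - cos (2 * t) / sin (2 * t) = 1 / sin (2 * t)"
    proof -
      have "cos t / sin t = 2 * (cos t)\<^sup>2 / sin (2 * t)"
        using st by (simp add: sin_double power2_eq_square)
      then have "cos t / sin t - cos (2 * t) / sin (2 * t) = (2 * (cos t)\<^sup>2 - cos (2 * t)) / sin (2 * t)"
        by (simp add: diff_divide_distrib)
      also have "2 * (cos t)\<^sup>2 - cos (2 * t) = 1"
        by (simp add: cos_double_cos)
      finally show ?thesis .
    qed
    then have "pi * (cos t / sin t - cos (2 * t) / sin (2 * t)) = pi * (1 / sin (2 * t))" by simp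
    then show ?thesis unfolding t2 t_def[symmetric] by (simp add: right_diff_distrib)
  qed
  ultimately show ?thesis by simp
qed

text \<open>The cosecant series at the imaginary point \<i> * w, with the pole at 0 removed and the
  terms of index k and -k paired.\<close>

lemma csch_partial_fractions:
  fixes w :: real assumes "w \<noteq> 0"
  shows "(\<lambda>m. \<Sum>k\<in>{1..2 * m}. (-1) ^ k * (inverse (of_nat k - \<i> * w) - inverse (of_nat k + \<i> * w)))
     \<longlonglongrightarrow> \<i> * complex_of_real (pi / sinh (pi * w) - 1 / w)"
proof -
  let ?z = "\<i> * complex_of_real w"
  have z: "?z \<notin> \<int>"
  proof
    assume "?z \<in> \<int>"
    then obtain n where "?z = of_int n" by (auto simp: Ints_def)
    then have "Im ?z = 0" by simp
    then show False using assms by simp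
  qed
  \<comment> \<open>Re-indexing: 1 - z + n is k - z with k = n + 1, while the other half starts at
    the pole 1 / z and ends one index earlier. The mismatch is the boundary term, which tends to
    0.\<close>
  have reg: "(\<Sum>k\<in>{1..N}. (-1) ^ k * (inverse (of_nat k - ?z) - inverse (of_nat k + ?z))) =
     - ((\<Sum>n<N. (-1) ^ n * (inverse (?z + of_nat n) + inverse (1 - ?z + of_nat n))) - inverse ?z + (-1) ^ N * inverse (?z + of_nat N))" for N
    by (induction N) (simp_all add: algebra_simps)
  have "(\<lambda>m. - ((\<Sum>n<2*m. (-1) ^ n * (inverse (?z + of_nat n) + inverse (1 - ?z + of_nat n))) - inverse ?z + inverse (?z + of_nat (2 * m))))
     \<longlonglongrightarrow> - (pi / sin (pi * ?z) - inverse ?z + 0)"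
  proof (intro tendsto_intros csc_partial_fractions[OF z])
    have "filterlim (\<lambda>m. ?z + of_nat (2 * m)) at_infinity sequentially"
      by (intro tendsto_add_filterlim_at_infinity[OF tendsto_const] filterlim_compose[OF tendsto_of_nat])
         (auto intro!: filterlim_subseq strict_monoI)
    then show "(\<lambda>m. inverse (?z + of_nat (2 * m))) \<longlonglongrightarrow> 0"
      by (rule filterlim_compose[OF tendsto_inverse_0])
  qed
  moreover have "- (pi / sin (pi * ?z) - inverse ?z + 0) = \<i> * complex_of_real (pi / sinh (pi * w) - 1 / w)"
  proof -
    have "sin (pi * ?z) = \<i> * complex_of_real (sinh (pi * w))"
    proof -
      have "pi * ?z = \<i> * complex_of_real (pi * w)" by simp
      moreover have "exp (complex_of_real (pi * w)) - inverse (exp (complex_of_real (pi * w))) = 2 * complex_of_real (sinh (pi * w))"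
        unfolding exp_minus[symmetric] of_real_minus[symmetric] exp_of_real by (simp add: sinh_field_def exp_minus)
      ultimately show ?thesis using sin_i_times[of "complex_of_real (pi * w)"] by (simp only:) simp
    qed
    moreover have "sinh (pi * w) \<noteq> 0" using assms by simp
    ultimately show ?thesis using assms by (simp add: field_simps)
  qed
  ultimately show ?thesis unfolding reg by (simp add: power_mult)
qed

section \<open>The conjugate Poisson kernel\<close>

definition rho :: "real \<Rightarrow> real" where "rho \<xi> = tanh_a \<xi> - sgn \<xi>"

lemma rho_measurable [measurable]: "rho \<in> borel_measurable borel"
  unfolding rho_def[abs_def] by measurable

lemma rho_minus: "rho (- \<xi>) = - rho \<xi>"
  by (simp add: rho_def tanh_a_def sgn_minus)

lemma rho_pos:
  assumes "\<xi> > 0"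
  shows "rho \<xi> = - 2 * exp (- (2 * acon * \<xi>)) / (1 + exp (- (2 * acon * \<xi>)))"
proof -
  have "1 + exp (- (2 * acon * \<xi>)) > 0" by (simp add: add_pos_pos)
  then show ?thesis using assms
    by (simp add: rho_def tanh_a_def tanh_real_altdef field_simps)
qed

lemma rho_bound: "\<bar>rho \<xi>\<bar> \<le> 2 * abel (2 * acon) \<xi>"
proof -
  have pos: "\<bar>rho \<xi>\<bar> \<le> 2 * abel (2 * acon) \<xi>" if "\<xi> > 0" for \<xi>
  proof -
    have "\<bar>rho \<xi>\<bar> = 2 * exp (- (2 * acon * \<xi>)) / (1 + exp (- (2 * acon * \<xi>)))"
      using rho_pos[OF that] by (simp add: add_pos_pos)
    also have "\<dots> \<le> 2 * exp (- (2 * acon * \<xi>)) / 1"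
      by (intro divide_left_mono) (auto intro: add_pos_pos)
    finally show ?thesis using that by (simp add: abel_def)
  qed
  consider "\<xi> > 0" | "\<xi> = 0" | "- \<xi> > 0" by linarith
  then show ?thesis
  proof cases
    case 3
    from pos[OF this] show ?thesis by (simp add: rho_minus abel_def)
  qed (use pos abel_pos[of "2 * acon" 0] in \<open>auto simp: rho_def tanh_a_def\<close>)
qed

text \<open>Stopping after an even number of terms matches the cosecant sums and, for q \<le> 1,
  keeps all partial sums nonpositive and bounded by q in modulus.\<close>

lemma alternating_geometric:
  fixes q :: real assumes "q > 0"
  shows "(\<Sum>k\<in>{1..2 * m}. (-1) ^ k * q ^ k) = - q * (1 - q ^ (2 * m)) / (1 + q)"
proof (induction m)
  case (Suc m)
  have "(\<Sum>k\<in>{1..2 * Suc m}. (-1) ^ k * q ^ k) = (\<Sum>k\<in>{1..2 * m}. (-1) ^ k * q ^ k) - q ^ (2 * m) * q + q ^ (2 * m) * q * q"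
    by simp
  also have "\<dots> = - q * (1 - q ^ (2 * Suc m)) / (1 + q)"
    unfolding Suc using assms by (simp add: field_simps)
  finally show ?case .
qed simp

lemma integrable_exp_real:
  fixes \<beta> :: "real \<Rightarrow> real"
  assumes "integrable lborel \<beta>"
  shows "integrable lborel (\<lambda>\<xi>. exp (\<i> * complex_of_real (v * \<xi>)) * complex_of_real (\<beta> \<xi>))"
  using assms by (intro integrable_bounded_mult[where C=1]) auto

lemma integrable_rho: "integrable lborel rho"
proof (rule Bochner_Integration.integrable_bound)
  show "integrable lborel (\<lambda>\<xi>. 2 * abel (2 * acon) \<xi>)" using integrable_abel[of "2 * acon"] acon_pos by simp
  show "AE \<xi> in lborel. norm (rho \<xi>) \<le> norm (2 * abel (2 * acon) \<xi>)"
  proof (rule AE_I2)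
    fix \<xi> show "norm (rho \<xi>) \<le> norm (2 * abel (2 * acon) \<xi>)"
      using rho_bound[of \<xi>] abel_pos[of "2 * acon" \<xi>] by simp
  qed
qed simp

text \<open>The sign is odd, so folding gives a difference of two half-line integrals, hence the
  conjugate Poisson kernel in place of the Poisson kernel.\<close>

lemma sgn_kernel:
  assumes "\<epsilon> > 0"
  shows "(LINT \<xi>|lborel. exp (\<i> * complex_of_real (v * \<xi>)) * complex_of_real (sgn \<xi> * abel \<epsilon> \<xi>)) = 2 * \<i> * complex_of_real (v / (\<epsilon>\<^sup>2 + v\<^sup>2))"
proof -
  let ?w = "Complex \<epsilon> (-v)" and ?w' = "Complex \<epsilon> v"
  let ?h = "\<lambda>\<xi>. exp (\<i> * complex_of_real (v * \<xi>)) * complex_of_real (sgn \<xi> * abel \<epsilon> \<xi>)"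
  have "integrable lborel (\<lambda>\<xi>. sgn \<xi> * abel \<epsilon> \<xi>)"
    by (rule Bochner_Integration.integrable_bound[OF integrable_abel[OF assms]]) (auto simp: sgn_if)
  from lborel_integral_fold[OF integrable_exp_real[OF this]]
  have "(LINT \<xi>|lborel. ?h \<xi>) = (LINT \<xi>|lborel. indicator {0..} \<xi> *\<^sub>R (?h \<xi> + ?h (- \<xi>)))" .
  also have "\<dots> = (LINT \<xi>|lborel. indicator {0..} \<xi> *\<^sub>R exp (- (?w * complex_of_real \<xi>)) - indicator {0..} \<xi> *\<^sub>R exp (- (?w' * complex_of_real \<xi>)))"
  proof (intro Bochner_Integration.integral_cong refl)
    fix \<xi> :: real
    consider "\<xi> > 0" | "\<xi> = 0" | "\<xi> < 0" by linarith
    then show "indicator {0..} \<xi> *\<^sub>R (?h \<xi> + ?h (- \<xi>)) =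
         indicator {0..} \<xi> *\<^sub>R exp (- (?w * complex_of_real \<xi>)) - indicator {0..} \<xi> *\<^sub>R exp (- (?w' * complex_of_real \<xi>))"
    proof cases
      case 1
      have "exp (\<i> * complex_of_real (v * \<xi>)) * complex_of_real (abel \<epsilon> \<xi>) = exp (- (?w * complex_of_real \<xi>))"
        using 1 unfolding abel_def exp_of_real[symmetric] exp_add[symmetric]
        by (intro arg_cong[where f=exp]) (simp add: complex_eq_iff)
      moreover have "exp (\<i> * complex_of_real (v * (-\<xi>))) * complex_of_real (abel \<epsilon> (-\<xi>)) = exp (- (?w' * complex_of_real \<xi>))"
        using 1 unfolding abel_def exp_of_real[symmetric] exp_add[symmetric]
        by (intro arg_cong[where f=exp]) (simp add: complex_eq_iff)
      ultimately show ?thesis using 1 by simp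
    qed auto
  qed
  also have "\<dots> = 1 / ?w - 1 / ?w'"
    using exp_integral_half_line[of ?w] exp_integral_half_line[of ?w'] assms by simp
  also have "\<dots> = 2 * \<i> * complex_of_real (v / (\<epsilon>\<^sup>2 + v\<^sup>2))"
    using assms sum_sq_pos[OF assms, of v]
    by (simp add: complex_eq_iff Re_divide Im_divide power2_eq_square)
  finally show ?thesis .
qed

text \<open>For positive arguments \<open>rho\<close> is an alternating geometric series in \<open>exp (- 2 acon \<xi>)\<close>;
  integrating it term by term gives the partial fractions of the hyperbolic cosecant.\<close>

lemma rho_kernel:
  assumes "v \<noteq> 0"
  shows "(LINT \<xi>|lborel. exp (\<i> * complex_of_real (v * \<xi>)) * complex_of_real (rho \<xi>)) = 2 * \<i> * complex_of_real (acon / sinh (acon * v) - 1 / v)"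
proof -
  let ?h = "\<lambda>\<xi>. exp (\<i> * complex_of_real (v * \<xi>)) * complex_of_real (rho \<xi>)"
  let ?q = "\<lambda>\<xi>. exp (- (2 * acon * \<xi>))"
  let ?e = "\<lambda>\<xi>. exp (\<i> * complex_of_real (v * \<xi>)) - exp (- (\<i> * complex_of_real (v * \<xi>)))"
  define P where "P = (\<lambda>m \<xi>. 2 * (\<Sum>k\<in>{1..2 * m}. (-1) ^ k * ?q \<xi> ^ k))"
  define w where "w = (\<lambda>k::nat. Complex (2 * acon * k) (- v))"
  define w' where "w' = (\<lambda>k::nat. Complex (2 * acon * k) v)"
  have [measurable]: "P m \<in> borel_measurable borel" for m unfolding P_def by measurable
  have Peq: "P m \<xi> = - 2 * ?q \<xi> * (1 - ?q \<xi> ^ (2 * m)) / (1 + ?q \<xi>)" for m \<xi>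
    unfolding P_def by (subst alternating_geometric) auto
  have "(LINT \<xi>|lborel. ?h \<xi>) = (LINT \<xi>|lborel. indicator {0..} \<xi> *\<^sub>R (?h \<xi> + ?h (- \<xi>)))"
    by (rule lborel_integral_fold[OF integrable_exp_real[OF integrable_rho]])
  also have "\<dots> = (LINT \<xi>|lborel. indicator {0..} \<xi> *\<^sub>R (?e \<xi> * complex_of_real (rho \<xi>)))"
    by (simp add: rho_minus algebra_simps)
  finally have fold: "(LINT \<xi>|lborel. ?h \<xi>) = (LINT \<xi>|lborel. indicator {0..} \<xi> *\<^sub>R (?e \<xi> * complex_of_real (rho \<xi>)))" .
  have "(\<lambda>m. LINT \<xi>|lborel. indicator {0..} \<xi> *\<^sub>R (?e \<xi> * complex_of_real (P m \<xi>))) \<longlonglongrightarrow>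
     (LINT \<xi>|lborel. indicator {0..} \<xi> *\<^sub>R (?e \<xi> * complex_of_real (rho \<xi>)))"
  proof (rule integral_dominated_convergence[where w = "\<lambda>\<xi>. 4 * abel (2 * acon) \<xi>"])
    show "integrable lborel (\<lambda>\<xi>. 4 * abel (2 * acon) \<xi>)" using integrable_abel[of "2 * acon"] acon_pos by simp
    show "AE \<xi> in lborel. (\<lambda>m. indicator {0..} \<xi> *\<^sub>R (?e \<xi> * complex_of_real (P m \<xi>))) \<longlonglongrightarrow> indicator {0..} \<xi> *\<^sub>R (?e \<xi> * complex_of_real (rho \<xi>))"
    proof (intro AE_I2)
      fix \<xi> :: real
      consider "\<xi> > 0" | "\<xi> = 0" | "\<xi> < 0" by linarith
      then show "(\<lambda>m. indicator {0..} \<xi> *\<^sub>R (?e \<xi> * complex_of_real (P m \<xi>))) \<longlonglongrightarrow> indicator {0..} \<xi> *\<^sub>R (?e \<xi> * complex_of_real (rho \<xi>))"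
      proof cases
        case 1
        have "(\<lambda>m. ?q \<xi> ^ (2 * m)) \<longlonglongrightarrow> 0"
          using 1 acon_pos by (intro filterlim_compose[OF LIMSEQ_realpow_zero]) (auto intro!: filterlim_subseq strict_monoI)
        then have "(\<lambda>m. - 2 * ?q \<xi> * (1 - ?q \<xi> ^ (2 * m)) / (1 + ?q \<xi>)) \<longlonglongrightarrow> - 2 * ?q \<xi> * (1 - 0) / (1 + ?q \<xi>)"
          by (intro tendsto_intros) (auto intro!: less_imp_neq[symmetric] add_pos_pos)
        then have "(\<lambda>m. P m \<xi>) \<longlonglongrightarrow> rho \<xi>" unfolding Peq rho_pos[OF 1] by simp
        then show ?thesis by (intro tendsto_intros)
      qed auto
    qed
    show "AE \<xi> in lborel. norm (indicator {0..} \<xi> *\<^sub>R (?e \<xi> * complex_of_real (P m \<xi>))) \<le> 4 * abel (2 * acon) \<xi>" for m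
    proof (intro AE_I2)
      fix \<xi> :: real
      show "norm (indicator {0..} \<xi> *\<^sub>R (?e \<xi> * complex_of_real (P m \<xi>))) \<le> 4 * abel (2 * acon) \<xi>"
      proof (cases "\<xi> \<ge> 0")
        case True
        have "norm (?e \<xi>) \<le> 2"
          using norm_triangle_ineq4[of "exp (\<i> * complex_of_real (v * \<xi>))" "exp (- (\<i> * complex_of_real (v * \<xi>)))"]
          by (simp add: norm_exp_eq_Re)
        moreover have "\<bar>P m \<xi>\<bar> \<le> 2 * ?q \<xi>"
        proof -
          \<comment> \<open>The closed form with an even number of terms gives a majorant
            independent of m; absolute values of the single terms would sum to something like 1 /
            \<xi> near 0.\<close>
          have q1: "?q \<xi> ^ (2 * m) \<le> 1" using True acon_pos by (intro power_le_one) auto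
          have "\<bar>P m \<xi>\<bar> = 2 * ?q \<xi> * (1 - ?q \<xi> ^ (2 * m)) / (1 + ?q \<xi>)"
            unfolding Peq using q1 by (simp add: abs_mult add_pos_pos)
          also have "\<dots> \<le> 2 * ?q \<xi> * 1 / 1"
            using q1 by (intro frac_le mult_left_mono) auto
          finally show ?thesis by simp
        qed
        ultimately have "norm (?e \<xi>) * \<bar>P m \<xi>\<bar> \<le> 2 * (2 * ?q \<xi>)" by (intro mult_mono) auto
        then show ?thesis using True by (simp add: norm_mult abel_def)
      qed (use abel_pos[of "2 * acon" \<xi>] in simp)
    qed
  qed auto
  moreover have "(LINT \<xi>|lborel. indicator {0..} \<xi> *\<^sub>R (?e \<xi> * complex_of_real (P m \<xi>))) =
     complex_of_real (1 / acon) * (\<Sum>k\<in>{1..2 * m}. (-1) ^ k * (inverse (of_nat k - \<i> * complex_of_real (v / (2 * acon))) - inverse (of_nat k + \<i> * complex_of_real (v / (2 * acon)))))" for m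
  proof -
    have term_eq: "indicator {0..} \<xi> *\<^sub>R (?e \<xi> * complex_of_real (P m \<xi>)) =
      (\<Sum>k\<in>{1..2 * m}. (2 * (-1) ^ k) * (indicator {0..} \<xi> *\<^sub>R exp (- (w k * complex_of_real \<xi>)) - indicator {0..} \<xi> *\<^sub>R exp (- (w' k * complex_of_real \<xi>))))" for \<xi>
    proof -
      have "exp (\<i> * complex_of_real (v * \<xi>)) * complex_of_real (?q \<xi> ^ k) = exp (- (w k * complex_of_real \<xi>))"
        "exp (- (\<i> * complex_of_real (v * \<xi>))) * complex_of_real (?q \<xi> ^ k) = exp (- (w' k * complex_of_real \<xi>))" for k
        unfolding exp_of_nat_mult[symmetric] exp_of_real[symmetric] exp_add[symmetric] w_def w'_def
        by (intro arg_cong[where f=exp], simp add: complex_eq_iff)+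
      then have "?e \<xi> * complex_of_real (?q \<xi> ^ k) = exp (- (w k * complex_of_real \<xi>)) - exp (- (w' k * complex_of_real \<xi>))" for k
        by (simp add: left_diff_distrib)
      then have "?e \<xi> * complex_of_real (P m \<xi>) = (\<Sum>k\<in>{1..2 * m}. (2 * (-1) ^ k) * (exp (- (w k * complex_of_real \<xi>)) - exp (- (w' k * complex_of_real \<xi>))))"
        unfolding P_def of_real_mult of_real_sum sum_distrib_left by (intro sum.cong refl) (simp add: mult_ac)
      then show ?thesis by (cases "\<xi> \<ge> 0") simp_all
    qed
    have i: "integrable lborel (\<lambda>\<xi>. indicator {0..} \<xi> *\<^sub>R exp (- (w k * complex_of_real \<xi>)))"
      "integrable lborel (\<lambda>\<xi>. indicator {0..} \<xi> *\<^sub>R exp (- (w' k * complex_of_real \<xi>)))"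
      "(LINT \<xi>|lborel. indicator {0..} \<xi> *\<^sub>R exp (- (w k * complex_of_real \<xi>))) = 1 / w k"
      "(LINT \<xi>|lborel. indicator {0..} \<xi> *\<^sub>R exp (- (w' k * complex_of_real \<xi>))) = 1 / w' k" if "k \<ge> 1" for k
      using that acon_pos by (auto intro!: exp_integral_half_line simp: w_def w'_def)
    have "(LINT \<xi>|lborel. indicator {0..} \<xi> *\<^sub>R (?e \<xi> * complex_of_real (P m \<xi>))) = (\<Sum>k\<in>{1..2 * m}. (2 * (-1) ^ k) * (1 / w k - 1 / w' k))"
      unfolding term_eq by (subst Bochner_Integration.integral_sum) (auto simp: i intro!: sum.cong)
    also have "\<dots> = (\<Sum>k\<in>{1..2 * m}. complex_of_real (1 / acon) * ((-1) ^ k * (inverse (of_nat k - \<i> * complex_of_real (v / (2 * acon))) - inverse (of_nat k + \<i> * complex_of_real (v / (2 * acon))))))"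
    proof (intro sum.cong refl)
      fix k :: nat
      let ?I = "inverse (of_nat k - \<i> * complex_of_real (v / (2 * acon)))"
      let ?J = "inverse (of_nat k + \<i> * complex_of_real (v / (2 * acon)))"
      \<comment> \<open>Factoring out 2 * acon produces the cosecant series at v / (2 *
        acon).\<close>
      have w: "w k = complex_of_real (2 * acon) * (of_nat k - \<i> * complex_of_real (v / (2 * acon)))"
        "w' k = complex_of_real (2 * acon) * (of_nat k + \<i> * complex_of_real (v / (2 * acon)))"
        using acon_pos by (simp_all add: w_def w'_def complex_eq_iff)
      have inv: "1 / (c * x) = (1 / c) * inverse x" for c x :: complex by (simp add: divide_inverse)
      have "(2 * s) * ((1 / complex_of_real (2 * acon)) * I - (1 / complex_of_real (2 * acon)) * J) = complex_of_real (1 / acon) * (s * (I - J))" for s I J :: complex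
        using acon_pos by (simp add: field_simps)
      then show "(2 * (-1) ^ k) * (1 / w k - 1 / w' k) = complex_of_real (1 / acon) * ((-1) ^ k * (?I - ?J))"
        unfolding w inv .
    qed
    finally show ?thesis by (simp only: sum_distrib_left)
  qed
  ultimately have "(\<lambda>m. complex_of_real (1 / acon) * (\<Sum>k\<in>{1..2 * m}. (-1) ^ k * (inverse (of_nat k - \<i> * complex_of_real (v / (2 * acon))) - inverse (of_nat k + \<i> * complex_of_real (v / (2 * acon)))))) \<longlonglongrightarrow> (LINT \<xi>|lborel. ?h \<xi>)"
    unfolding fold by simp
  moreover have "(\<lambda>m. complex_of_real (1 / acon) * (\<Sum>k\<in>{1..2 * m}. (-1) ^ k * (inverse (of_nat k - \<i> * complex_of_real (v / (2 * acon))) - inverse (of_nat k + \<i> * complex_of_real (v / (2 * acon))))))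
     \<longlonglongrightarrow> complex_of_real (1 / acon) * (\<i> * complex_of_real (pi / sinh (pi * (v / (2 * acon))) - 1 / (v / (2 * acon))))"
    using assms acon_pos by (intro tendsto_mult[OF tendsto_const] csch_partial_fractions) auto
  ultimately have L: "(LINT \<xi>|lborel. ?h \<xi>) = complex_of_real (1 / acon) * (\<i> * complex_of_real (pi / sinh (pi * (v / (2 * acon))) - 1 / (v / (2 * acon))))"
    by (rule LIMSEQ_unique)
  \<comment> \<open>The scale pi / (2 * acon) of the series equals \<open>acon\<close>: kernel and
    multiplier share the same constant.\<close>
  have "pi = 2 * acon * acon" using acon_sq by simp
  then have "pi * (v / (2 * acon)) = acon * v" "pi / acon = 2 * acon" using acon_pos by (auto simp: field_simps)
  then have XY: "(1 / acon) * (pi / sinh (pi * (v / (2 * acon))) - 1 / (v / (2 * acon))) = 2 * (acon / sinh (acon * v) - 1 / v)" (is "_ * ?X = 2 * ?Y")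
    using acon_pos assms by (simp add: right_diff_distrib)
  have "complex_of_real (1 / acon) * (\<i> * complex_of_real ?X) = \<i> * complex_of_real ((1 / acon) * ?X)" by simp
  also have "\<dots> = 2 * \<i> * complex_of_real ?Y" unfolding XY by simp
  finally show ?thesis unfolding L .
qed

section \<open>Pairings with modulated weights\<close>

lemma FTi_modulated:
  fixes \<beta> :: "real \<Rightarrow> real" and s :: real
  assumes \<beta>: "integrable lborel \<beta>" "\<And>\<xi>. \<bar>\<beta> \<xi>\<bar> \<le> C"
  defines "B \<equiv> (\<lambda>\<xi>. exp (- (\<i> * complex_of_real (s * \<xi>))) * complex_of_real (\<beta> \<xi>) / complex_of_real (sqrt (2 * pi)))"
  shows "B \<in> sq_integrable lborel"
    and "AE t in lborel. FTi B t = (LINT \<xi>|lborel. exp (\<i> * complex_of_real ((t - s) * \<xi>)) * complex_of_real (\<beta> \<xi>)) / (2 * pi)"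
proof -
  have [measurable]: "\<beta> \<in> borel_measurable borel" using borel_measurable_integrable[OF \<beta>(1)] by simp
  have normB: "cmod (B \<xi>) = \<bar>\<beta> \<xi>\<bar> / sqrt (2 * pi)" for \<xi>
    by (simp add: B_def norm_mult norm_divide norm_exp_eq_Re)
  have Bi: "integrable lborel B"
    unfolding B_def using integrable_exp_real[OF \<beta>(1), of "- s"] by simp
  have "integrable lborel (\<lambda>\<xi>. C * \<bar>\<beta> \<xi>\<bar>)" using \<beta>(1) by simp
  then have "integrable lborel (\<lambda>\<xi>. (cmod (B \<xi>))\<^sup>2)"
  proof (rule Bochner_Integration.integrable_bound)
    show "AE \<xi> in lborel. norm ((cmod (B \<xi>))\<^sup>2) \<le> norm (C * \<bar>\<beta> \<xi>\<bar>)"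
    proof (rule AE_I2)
      fix \<xi>
      have "C \<ge> 0" using order_trans[OF abs_ge_zero \<beta>(2)] .
      have "1 \<le> sqrt (2 * pi)" using pi_gt3 by simp
      then have "\<bar>\<beta> \<xi>\<bar> / sqrt (2 * pi) \<le> \<bar>\<beta> \<xi>\<bar> / 1" by (intro divide_left_mono) auto
      then have "(cmod (B \<xi>))\<^sup>2 \<le> \<bar>\<beta> \<xi>\<bar>\<^sup>2" unfolding normB by (intro power_mono) auto
      also have "\<dots> \<le> C * \<bar>\<beta> \<xi>\<bar>" unfolding power2_eq_square using \<beta>(2) by (intro mult_right_mono) auto
      finally show "norm ((cmod (B \<xi>))\<^sup>2) \<le> norm (C * \<bar>\<beta> \<xi>\<bar>)" using \<open>C \<ge> 0\<close> by simp
    qed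
  qed (use borel_measurable_integrable[OF Bi] in simp)
  then show Bs: "B \<in> sq_integrable lborel"
    using borel_measurable_integrable[OF Bi] by (simp add: sq_integrable_def)
  have "fourier_integral B (- t) = (LINT \<xi>|lborel. exp (\<i> * complex_of_real ((t - s) * \<xi>)) * complex_of_real (\<beta> \<xi>)) / (2 * pi)" for t
  proof -
    have "exp (- (\<i> * complex_of_real (- t * \<xi>))) * B \<xi> = exp (\<i> * complex_of_real ((t - s) * \<xi>)) * complex_of_real (\<beta> \<xi>) / complex_of_real (sqrt (2 * pi))" for \<xi>
    proof -
      have "exp (- (\<i> * complex_of_real (- t * \<xi>))) * exp (- (\<i> * complex_of_real (s * \<xi>))) = exp (\<i> * complex_of_real ((t - s) * \<xi>))"
        unfolding exp_add[symmetric] by (simp add: algebra_simps)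
      then show ?thesis unfolding B_def by (metis mult.assoc times_divide_eq_right)
    qed
    then have "fourier_integral B (- t) = complex_of_real (1 / sqrt (2 * pi)) * ((LINT \<xi>|lborel. exp (\<i> * complex_of_real ((t - s) * \<xi>)) * complex_of_real (\<beta> \<xi>)) / complex_of_real (sqrt (2 * pi)))"
      by (simp only: fourier_integral_def Bochner_Integration.integral_divide_zero)
    also have "\<dots> = (LINT \<xi>|lborel. exp (\<i> * complex_of_real ((t - s) * \<xi>)) * complex_of_real (\<beta> \<xi>)) / (complex_of_real (sqrt (2 * pi)) * complex_of_real (sqrt (2 * pi)))"
      by simp
    also have "complex_of_real (sqrt (2 * pi)) * complex_of_real (sqrt (2 * pi)) = 2 * pi"
      by (simp flip: of_real_mult)
    finally show ?thesis .
  qed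
  with FTi_integrable[OF Bs Bi]
  show "AE t in lborel. FTi B t = (LINT \<xi>|lborel. exp (\<i> * complex_of_real ((t - s) * \<xi>)) * complex_of_real (\<beta> \<xi>)) / (2 * pi)"
    by simp
qed

text \<open>Parseval: pairing with the weight modulated by s is integration against its kernel
  \<kappa> centred at s. This holds for each individual s, so it can be used at a prescribed
  Lebesgue point. The kernel formula is asked only off 0 because \<open>rho_kernel\<close> is only
  available there, and one point is null.\<close>

lemma pairing_modulated:
  fixes \<beta> :: "real \<Rightarrow> real" and s :: real
  assumes \<beta>: "integrable lborel \<beta>" "\<And>\<xi>. \<bar>\<beta> \<xi>\<bar> \<le> C" and H: "H \<in> sq_integrable lborel"
    and \<kappa>: "\<And>v. v \<noteq> 0 \<Longrightarrow> (LINT \<xi>|lborel. exp (\<i> * complex_of_real (v * \<xi>)) * complex_of_real (\<beta> \<xi>)) = \<kappa> v"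
    and [measurable]: "\<kappa> \<in> borel_measurable borel"
  defines "B \<equiv> (\<lambda>\<xi>. exp (- (\<i> * complex_of_real (s * \<xi>))) * complex_of_real (\<beta> \<xi>) / complex_of_real (sqrt (2 * pi)))"
  shows "l2inner lborel B H = (LINT t|lborel. cnj (\<kappa> (t - s)) * FTi H t) / (2 * pi)"
    and "(\<lambda>t. \<kappa> (t - s)) \<in> sq_integrable lborel"
proof -
  have B: "B \<in> sq_integrable lborel" unfolding B_def by (rule FTi_modulated(1)[OF \<beta>])
  have "AE t in lborel. FTi B t = (LINT \<xi>|lborel. exp (\<i> * complex_of_real ((t - s) * \<xi>)) * complex_of_real (\<beta> \<xi>)) / (2 * pi)"
    unfolding B_def by (rule FTi_modulated(2)[OF \<beta>])
  then have ae: "AE t in lborel. FTi B t = \<kappa> (t - s) / (2 * pi)"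
    using AE_lborel_singleton[of s]
  proof eventually_elim
    case (elim t)
    then have "t - s \<noteq> 0" by simp
    show ?case unfolding elim(1) \<kappa>[OF \<open>t - s \<noteq> 0\<close>] ..
  qed
  note [measurable] = sq_integrableD(1)[OF FTi_sq[OF B], simplified] sq_integrableD(1)[OF FTi_sq[OF H], simplified]
  have "l2inner lborel B H = l2inner lborel (FTi B) (FTi H)" by (rule FTi_inner[OF B H, symmetric])
  also have "\<dots> = l2inner lborel (\<lambda>t. \<kappa> (t - s) / (2 * pi)) (FTi H)"
    by (intro l2inner_cong_AE ae) auto
  also have "\<dots> = (LINT t|lborel. cnj (\<kappa> (t - s)) * FTi H t / (2 * pi))"
    by (simp add: l2inner_def)
  finally show "l2inner lborel B H = (LINT t|lborel. cnj (\<kappa> (t - s)) * FTi H t) / (2 * pi)"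
    by simp
  have "AE t in lborel. \<kappa> (t - s) = complex_of_real (2 * pi) * FTi B t"
    using ae by eventually_elim simp
  then show "(\<lambda>t. \<kappa> (t - s)) \<in> sq_integrable lborel"
    by (intro sq_integrable_cong_AE[OF sq_integrable_scale[OF FTi_sq[OF B]]]) auto
qed

lemma abel_weights:
  assumes "\<epsilon> > 0" shows "integrable lborel (\<lambda>\<xi>. sgn \<xi> * abel \<epsilon> \<xi>)" "\<bar>sgn \<xi> * abel \<epsilon> \<xi>\<bar> \<le> 1" "\<bar>abel \<epsilon> \<xi>\<bar> \<le> 1"
    "integrable lborel (\<lambda>\<xi>. rho \<xi> * abel \<epsilon> \<xi>)" "\<bar>rho \<xi> * abel \<epsilon> \<xi>\<bar> \<le> 2"
proof -
  have a: "0 < abel \<epsilon> \<xi>" "abel \<epsilon> \<xi> \<le> 1" for \<xi> using abel_pos abel_le_1[of \<epsilon>] assms by auto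
  have r: "\<bar>rho \<xi>\<bar> \<le> 2" for \<xi> using rho_bound[of \<xi>] abel_le_1[of "2 * acon" \<xi>] acon_pos by simp
  show "integrable lborel (\<lambda>\<xi>. sgn \<xi> * abel \<epsilon> \<xi>)"
    by (rule Bochner_Integration.integrable_bound[OF integrable_abel[OF assms]]) (auto simp: sgn_if)
  show "integrable lborel (\<lambda>\<xi>. rho \<xi> * abel \<epsilon> \<xi>)"
    by (rule Bochner_Integration.integrable_bound[OF integrable_rho]) (use a in \<open>auto simp: abs_mult less_imp_le mult_left_le\<close>)
  show "\<bar>sgn \<xi> * abel \<epsilon> \<xi>\<bar> \<le> 1" "\<bar>abel \<epsilon> \<xi>\<bar> \<le> 1" using a[of \<xi>] by (auto simp: sgn_if)
  show "\<bar>rho \<xi> * abel \<epsilon> \<xi>\<bar> \<le> 2"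
    using a[of \<xi>] r[of \<xi>] mult_mono[OF r[of \<xi>] a(2)[of \<xi>]] by (simp add: abs_mult)
qed

text \<open>The conjugate Poisson kernel, again without the factor 1 / pi.\<close>

definition qker :: "real \<Rightarrow> real \<Rightarrow> real" where "qker \<epsilon> v = v / (\<epsilon>\<^sup>2 + v\<^sup>2)"

text \<open>The hyperbolic cosecant kernel with its pole at 0 removed; up to the factor 2 * \<i> it
  is the kernel of \<open>rho\<close>.\<close>

definition r0 :: "real \<Rightarrow> real" where "r0 v = acon / sinh (acon * v) - 1 / v"

lemma qker_measurable [measurable]: "qker \<epsilon> \<in> borel_measurable borel"
  unfolding qker_def[abs_def] by measurable

lemma r0_measurable [measurable]: "r0 \<in> borel_measurable borel"
proof -
  have "(\<lambda>v. sinh (acon * v)) \<in> borel_measurable borel"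
    by (intro borel_measurable_continuous_onI continuous_intros)
  then show ?thesis unfolding r0_def[abs_def] by measurable
qed

lemma integral_abel_pairing:
  assumes "H \<in> sq_integrable lborel" "\<epsilon> > 0"
  shows "l2inner lborel (\<lambda>\<xi>. exp (- (\<i> * complex_of_real (s * \<xi>))) * complex_of_real (abel \<epsilon> \<xi>) / complex_of_real (sqrt (2 * pi))) H
     = (LINT t|lborel. complex_of_real (pker \<epsilon> (t - s)) * FTi H t) / pi"
  using pairing_modulated(1)[OF integrable_abel[OF assms(2)] abel_weights(3)[OF assms(2)] assms(1) integral_abel_exp[OF assms(2)], of s]
  by (simp add: mult.assoc)

text \<open>The factor - \<i> / pi is the conjugate of 2 * \<i> divided by 2 * pi.\<close>

lemma integral_sgn_pairing:
  assumes "H \<in> sq_integrable lborel" "\<epsilon> > 0"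
  shows "l2inner lborel (\<lambda>\<xi>. exp (- (\<i> * complex_of_real (s * \<xi>))) * complex_of_real (sgn \<xi> * abel \<epsilon> \<xi>) / complex_of_real (sqrt (2 * pi))) H
     = - \<i> / pi * (LINT t|lborel. complex_of_real (qker \<epsilon> (t - s)) * FTi H t)"
    and "(\<lambda>t. complex_of_real (qker \<epsilon> (t - s))) \<in> sq_integrable lborel"
proof -
  note * = pairing_modulated[OF abel_weights(1)[OF assms(2)] abel_weights(2)[OF assms(2)] assms(1) sgn_kernel[OF assms(2), folded qker_def], of s]
  show "l2inner lborel (\<lambda>\<xi>. exp (- (\<i> * complex_of_real (s * \<xi>))) * complex_of_real (sgn \<xi> * abel \<epsilon> \<xi>) / complex_of_real (sqrt (2 * pi))) H
     = - \<i> / pi * (LINT t|lborel. complex_of_real (qker \<epsilon> (t - s)) * FTi H t)"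
    using *(1) by (simp add: mult.assoc)
  show "(\<lambda>t. complex_of_real (qker \<epsilon> (t - s))) \<in> sq_integrable lborel"
    using sq_integrable_scale[OF *(2), of "- \<i> / 2"] by simp
qed

lemma integral_rho_pairing:
  assumes "H \<in> sq_integrable lborel"
  shows "l2inner lborel (\<lambda>\<xi>. exp (- (\<i> * complex_of_real (s * \<xi>))) * complex_of_real (rho \<xi>) / complex_of_real (sqrt (2 * pi))) H
     = - \<i> / pi * (LINT t|lborel. complex_of_real (r0 (t - s)) * FTi H t)"
    and "(\<lambda>t. complex_of_real (r0 (t - s))) \<in> sq_integrable lborel"
proof -
  have r: "\<bar>rho \<xi>\<bar> \<le> 2" for \<xi> using rho_bound[of \<xi>] abel_le_1[of "2 * acon" \<xi>] acon_pos by simp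
  note * = pairing_modulated[OF integrable_rho r assms rho_kernel[folded r0_def], of s]
  show "l2inner lborel (\<lambda>\<xi>. exp (- (\<i> * complex_of_real (s * \<xi>))) * complex_of_real (rho \<xi>) / complex_of_real (sqrt (2 * pi))) H
     = - \<i> / pi * (LINT t|lborel. complex_of_real (r0 (t - s)) * FTi H t)"
    using *(1) by (simp add: mult.assoc)
  show "(\<lambda>t. complex_of_real (r0 (t - s))) \<in> sq_integrable lborel"
    using sq_integrable_scale[OF *(2), of "- \<i> / 2"] by simp
qed

text \<open>The conjugate Poisson integral of \<open>G\<close> differs from the Poisson integral of \<open>TT G\<close>
  only by the contribution of \<open>rho = tanh_a - sgn\<close>, whose kernel needs no regularisation.\<close>

lemma conjugate_poisson_tendsto:
  assumes G: "G \<in> sq_integrable lborel" and pt: "lebesgue_pt (TT G) s"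
  shows "((\<lambda>\<epsilon>. LINT t|lborel. complex_of_real (qker \<epsilon> (t - s)) * G t) \<longlongrightarrow>
     \<i> * pi * TT G s - (LINT t|lborel. complex_of_real (r0 (t - s)) * G t)) (at_right 0)"
proof -
  let ?E = "\<lambda>\<beta> \<xi>. exp (- (\<i> * complex_of_real (s * \<xi>))) * complex_of_real (\<beta> \<xi>) / complex_of_real (sqrt (2 * pi))"
  have FG: "FT G \<in> sq_integrable lborel" by (rule FT_sq[OF G])
  have r: "\<bar>rho \<xi>\<bar> \<le> 2" for \<xi> using rho_bound[of \<xi>] abel_le_1[of "2 * acon" \<xi>] acon_pos by simp
  have Gae: "AE t in lborel. FTi (FT G) t = G t" by (rule FTi_FT[OF G])
  have [measurable]: "G \<in> borel_measurable borel" "FTi (FT G) \<in> borel_measurable borel" "FT G \<in> borel_measurable borel"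
    using sq_integrableD(1)[OF G] sq_integrableD(1)[OF FTi_sq[OF FG]] sq_integrableD(1)[OF FG] by auto
  \<comment> \<open>The pairings produce the inverse transform of \<open>FT G\<close>; under an
    integral it may be replaced by G.\<close>
  have repl: "(LINT t|lborel. complex_of_real (k (t - s)) * FTi (FT G) t) = (LINT t|lborel. complex_of_real (k (t - s)) * G t)"
    if [measurable]: "k \<in> borel_measurable borel" for k
    by (intro integral_cong_AE) (use Gae in \<open>auto elim: eventually_mono\<close>)
  define J where "J = (\<lambda>\<epsilon>. l2inner lborel (?E (\<lambda>\<xi>. rho \<xi> * abel \<epsilon> \<xi>)) (FT G))"
  \<comment> \<open>For each \<epsilon> this is exact: tanh_a = sgn + rho under the Abel factor,
    paired with \<open>FT G\<close>. \<open>J\<close> collects the part of \<open>rho\<close>, still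
    damped.\<close>
  have eq: "(LINT t|lborel. complex_of_real (qker \<epsilon> (t - s)) * G t) =
     \<i> * (LINT t|lborel. complex_of_real (pker \<epsilon> (t - s)) * TT G t) - \<i> * pi * J \<epsilon>" if "\<epsilon> > 0" for \<epsilon>
  proof -
    let ?K = "\<lambda>\<xi>. complex_of_real (tanh_a \<xi>) * FT G \<xi>"
    have K: "?K \<in> sq_integrable lborel" by (rule tanh_mult_sq[OF FG])
    have "(LINT t|lborel. complex_of_real (pker \<epsilon> (t - s)) * TT G t) / pi = l2inner lborel (?E (abel \<epsilon>)) ?K"
      using integral_abel_pairing[OF K that, of s] by (simp add: TT_def)
    also have "\<dots> = (LINT \<xi>|lborel. cnj (?E (\<lambda>\<xi>. sgn \<xi> * abel \<epsilon> \<xi>) \<xi>) * FT G \<xi> + cnj (?E (\<lambda>\<xi>. rho \<xi> * abel \<epsilon> \<xi>) \<xi>) * FT G \<xi>)"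
      unfolding l2inner_def
    proof (intro Bochner_Integration.integral_cong refl)
      fix \<xi>
      have "tanh_a \<xi> = sgn \<xi> + rho \<xi>" by (simp add: rho_def)
      then show "cnj (?E (abel \<epsilon>) \<xi>) * ?K \<xi> = cnj (?E (\<lambda>\<xi>. sgn \<xi> * abel \<epsilon> \<xi>) \<xi>) * FT G \<xi> + cnj (?E (\<lambda>\<xi>. rho \<xi> * abel \<epsilon> \<xi>) \<xi>) * FT G \<xi>"
        by (simp add: add_divide_distrib distrib_left distrib_right mult_ac)
    qed
    also have "\<dots> = l2inner lborel (?E (\<lambda>\<xi>. sgn \<xi> * abel \<epsilon> \<xi>)) (FT G) + J \<epsilon>"
      unfolding J_def l2inner_def
      by (intro Bochner_Integration.integral_add integrable_l2inner FG
          FTi_modulated(1)[OF abel_weights(1)[OF that] abel_weights(2)[OF that]]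
          FTi_modulated(1)[OF abel_weights(4)[OF that] abel_weights(5)[OF that]])
    also have "l2inner lborel (?E (\<lambda>\<xi>. sgn \<xi> * abel \<epsilon> \<xi>)) (FT G) = - \<i> / pi * (LINT t|lborel. complex_of_real (qker \<epsilon> (t - s)) * G t)"
      unfolding integral_sgn_pairing(1)[OF FG that] repl[OF qker_measurable] ..
    finally have "(LINT t|lborel. complex_of_real (pker \<epsilon> (t - s)) * TT G t) / pi =
       - \<i> / pi * (LINT t|lborel. complex_of_real (qker \<epsilon> (t - s)) * G t) + J \<epsilon>" .
    moreover have "Q = \<i> * X - \<i> * pi * j" if "X / pi = - \<i> / pi * Q + j" for X Q j :: complex
    proof -
      have "X = pi * (X / pi)" by simp
      also have "\<dots> = - \<i> * Q + pi * j" unfolding that by (simp add: distrib_left right_diff_distrib)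
      finally have "\<i> * X = Q + \<i> * pi * j" by (simp add: distrib_left right_diff_distrib mult.assoc[symmetric])
      then show ?thesis by simp
    qed
    ultimately show ?thesis by blast
  qed
  have Jlim: "(J \<longlongrightarrow> - \<i> / pi * (LINT t|lborel. complex_of_real (r0 (t - s)) * G t)) (at_right 0)"
  proof -
    \<comment> \<open>For \<open>rho\<close> the Abel factor can be removed: its undamped pairing is
      already absolutely integrable and dominates.\<close>
    have "(J \<longlongrightarrow> l2inner lborel (?E rho) (FT G)) (at_right 0)"
      unfolding tendsto_at_iff_sequentially
    proof (intro allI impI)
      fix X :: "nat \<Rightarrow> real" assume X: "\<forall>i. X i \<in> {0<..} - {0}" "X \<longlonglongrightarrow> 0"
      have Xp: "X n > 0" for n using X(1) by auto
      show "(J \<circ> X) \<longlonglongrightarrow> l2inner lborel (?E rho) (FT G)"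
        unfolding o_def J_def l2inner_def
      proof (rule integral_dominated_convergence[where w = "\<lambda>\<xi>. cmod (cnj (?E rho \<xi>) * FT G \<xi>)"])
        show "integrable lborel (\<lambda>\<xi>. cmod (cnj (?E rho \<xi>) * FT G \<xi>))"
          by (intro integrable_norm integrable_l2inner FG FTi_modulated(1)[OF integrable_rho r])
        show "AE \<xi> in lborel. (\<lambda>n. cnj (?E (\<lambda>\<xi>. rho \<xi> * abel (X n) \<xi>) \<xi>) * FT G \<xi>) \<longlonglongrightarrow> cnj (?E rho \<xi>) * FT G \<xi>"
        proof (rule AE_I2)
          fix \<xi>
          have "(\<lambda>n. exp (- (X n * \<bar>\<xi>\<bar>))) \<longlonglongrightarrow> exp (- (0 * \<bar>\<xi>\<bar>))"
            by (intro tendsto_intros X)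
          then have "(\<lambda>n. abel (X n) \<xi>) \<longlonglongrightarrow> 1" by (simp add: abel_def)
          then have "(\<lambda>n. cnj (?E (\<lambda>\<xi>. rho \<xi> * abel (X n) \<xi>) \<xi>) * FT G \<xi>) \<longlonglongrightarrow> cnj (?E (\<lambda>\<xi>. rho \<xi> * 1) \<xi>) * FT G \<xi>"
            by (intro tendsto_intros) auto
          then show "(\<lambda>n. cnj (?E (\<lambda>\<xi>. rho \<xi> * abel (X n) \<xi>) \<xi>) * FT G \<xi>) \<longlonglongrightarrow> cnj (?E rho \<xi>) * FT G \<xi>" by simp
        qed
        show "AE \<xi> in lborel. norm (cnj (?E (\<lambda>\<xi>. rho \<xi> * abel (X n) \<xi>) \<xi>) * FT G \<xi>) \<le> cmod (cnj (?E rho \<xi>) * FT G \<xi>)" for n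
        proof (rule AE_I2)
          fix \<xi>
          have "\<bar>rho \<xi>\<bar> * abel (X n) \<xi> \<le> \<bar>rho \<xi>\<bar> * 1"
            using abel_le_1[of "X n" \<xi>] Xp[of n] by (intro mult_left_mono) auto
          then show "norm (cnj (?E (\<lambda>\<xi>. rho \<xi> * abel (X n) \<xi>) \<xi>) * FT G \<xi>) \<le> cmod (cnj (?E rho \<xi>) * FT G \<xi>)"
            using abel_pos[of "X n" \<xi>]
            by (simp add: norm_mult norm_divide norm_exp_eq_Re abs_mult divide_right_mono mult_right_mono)
        qed
      qed measurable
    qed
    also have "l2inner lborel (?E rho) (FT G) = - \<i> / pi * (LINT t|lborel. complex_of_real (r0 (t - s)) * G t)"
      unfolding integral_rho_pairing(1)[OF FG] repl[OF r0_measurable] ..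
    finally show ?thesis .
  qed
  have "((\<lambda>\<epsilon>. \<i> * (LINT t|lborel. complex_of_real (pker \<epsilon> (t - s)) * TT G t) - \<i> * pi * J \<epsilon>) \<longlongrightarrow>
     \<i> * (pi * TT G s) - \<i> * pi * (- \<i> / pi * (LINT t|lborel. complex_of_real (r0 (t - s)) * G t))) (at_right 0)"
    by (intro tendsto_diff tendsto_mult[OF tendsto_const] poisson_tendsto[OF TT_sq[OF G] pt] Jlim)
  moreover have "\<i> * (pi * TT G s) - \<i> * pi * (- \<i> / pi * (LINT t|lborel. complex_of_real (r0 (t - s)) * G t)) =
      \<i> * pi * TT G s - (LINT t|lborel. complex_of_real (r0 (t - s)) * G t)"
    by simp
  moreover have "\<forall>\<^sub>F \<epsilon> in at_right 0. \<i> * (LINT t|lborel. complex_of_real (pker \<epsilon> (t - s)) * TT G t) - \<i> * pi * J \<epsilon> =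
      (LINT t|lborel. complex_of_real (qker \<epsilon> (t - s)) * G t)"
    using eventually_at_right_less[of "0::real"] by eventually_elim (simp add: eq)
  ultimately show ?thesis by (simp add: filterlim_cong[OF refl refl] mult.assoc)
qed

section \<open>Principal values\<close>

definition tker :: "real \<Rightarrow> real \<Rightarrow> real" where
  "tker \<epsilon> v = (if \<bar>v\<bar> > \<epsilon> then 1 / v else 0)"

lemma tker_measurable [measurable]: "tker \<epsilon> \<in> borel_measurable borel"
  unfolding tker_def[abs_def] by measurable

text \<open>Outside the cut the difference is \<epsilon> / v times the Poisson kernel; inside only
  the conjugate kernel remains, and its numerator is at most \<epsilon> in modulus.\<close>

lemma tker_qker_bound:
  assumes "\<epsilon> > 0" shows "\<bar>tker \<epsilon> v - qker \<epsilon> v\<bar> \<le> pker \<epsilon> v"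
proof (cases "\<bar>v\<bar> > \<epsilon>")
  case True
  then have v: "v \<noteq> 0" using assms by auto
  have pos: "\<epsilon>\<^sup>2 + v\<^sup>2 > 0" by (rule sum_sq_pos[OF assms])
  have "tker \<epsilon> v - qker \<epsilon> v = (\<epsilon> / v) * pker \<epsilon> v"
    using True v pos by (simp add: tker_def qker_def pker_def field_simps power2_eq_square)
  then have "\<bar>tker \<epsilon> v - qker \<epsilon> v\<bar> = (\<epsilon> / \<bar>v\<bar>) * pker \<epsilon> v"
    using assms by (simp add: abs_mult pker_nonneg)
  also have "\<dots> \<le> 1 * pker \<epsilon> v"
    using True assms by (intro mult_right_mono) (auto simp: pker_nonneg)
  finally show ?thesis by simp
next
  case False
  then show ?thesis
    using sum_sq_pos[OF assms, of v] by (simp add: tker_def qker_def pker_def divide_right_mono)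
qed

lemma kernel_difference_sq:
  assumes "\<epsilon> > 0"
  shows "(\<lambda>t. complex_of_real (tker \<epsilon> (t - s) - qker \<epsilon> (t - s))) \<in> sq_integrable lborel"
  by (rule sq_integrable_bound[OF pker_sq_integrable[OF assms, of s], where C = 1])
     (use tker_qker_bound[OF assms] assms in \<open>auto simp: pker_nonneg simp flip: of_real_diff\<close>)

text \<open>The difference kernel is odd and integrable, so its integral is 0 and subtracting G s
  from G is free. Domination by the Poisson kernel then gives the limit.\<close>

lemma kernel_difference_tendsto:
  assumes G: "G \<in> sq_integrable lborel" and pt: "lebesgue_pt G s"
  shows "((\<lambda>\<epsilon>. LINT t|lborel. complex_of_real (tker \<epsilon> (t - s) - qker \<epsilon> (t - s)) * G t) \<longlongrightarrow> 0) (at_right 0)"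
proof -
  have [measurable]: "G \<in> borel_measurable borel" using sq_integrableD(1)[OF G] by simp
  let ?k = "\<lambda>\<epsilon> t. complex_of_real (tker \<epsilon> (t - s) - qker \<epsilon> (t - s))"
  have "((\<lambda>\<epsilon>. LINT t|lborel. ?k \<epsilon> t * (G t - G s)) \<longlongrightarrow> 0) (at_right 0)"
  proof (rule pker_dominated_tendsto[OF _ _ pt])
    show "cmod (?k \<epsilon> t) \<le> pker \<epsilon> (t - s)" if "\<epsilon> > 0" for \<epsilon> t
      using tker_qker_bound[OF that] by (simp flip: of_real_diff)
  qed (use nn_integral_sqn[OF G] in auto)
  moreover have "\<forall>\<^sub>F \<epsilon> in at_right 0. (LINT t|lborel. ?k \<epsilon> t * (G t - G s)) = (LINT t|lborel. ?k \<epsilon> t * G t)"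
    using eventually_at_right_less[of "0::real"]
  proof eventually_elim
    case (elim \<epsilon>)
    have int: "integrable lborel (\<lambda>t. tker \<epsilon> (t - s) - qker \<epsilon> (t - s))"
      by (rule Bochner_Integration.integrable_bound[OF integrable_pker_shift(1)[OF elim, of s]])
         (use tker_qker_bound[OF elim] elim in \<open>auto simp: pker_nonneg\<close>)
    have "(LINT t|lborel. tker \<epsilon> (t - s) - qker \<epsilon> (t - s)) = (LINT v|lborel. tker \<epsilon> v - qker \<epsilon> v)"
      using lborel_integral_real_affine[of 1 "\<lambda>v. tker \<epsilon> v - qker \<epsilon> v" "- s"] by simp
    moreover have "(LINT v|lborel. tker \<epsilon> (- v) - qker \<epsilon> (- v)) = (LINT v|lborel. - (tker \<epsilon> v - qker \<epsilon> v))"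
      by (intro Bochner_Integration.integral_cong refl) (simp add: tker_def qker_def)
    then have "(LINT v|lborel. tker \<epsilon> v - qker \<epsilon> v) = 0"
      using lborel_integral_uminus[of "\<lambda>v. tker \<epsilon> v - qker \<epsilon> v"] unfolding integral_minus by linarith
    ultimately have "(LINT t|lborel. ?k \<epsilon> t) = 0" by (simp del: of_real_diff)
    moreover have "integrable lborel (\<lambda>t. ?k \<epsilon> t * G t)"
      by (intro integrable_l2mult kernel_difference_sq[OF elim] G)
    moreover have "integrable lborel (\<lambda>t. ?k \<epsilon> t * G s)"
      using int by (intro integrable_mult_left integrable_of_real)
    ultimately show ?case
      unfolding right_diff_distrib by (subst Bochner_Integration.integral_diff) auto
  qed
  ultimately show ?thesis by (simp add: filterlim_cong[OF refl refl])
qed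

lemma truncation_kernel_diff_le: "\<bar>indicator A t / v - tker \<epsilon> v\<bar> \<le> 1 / \<bar>v\<bar>"
  by (cases "t \<in> A"; cases "\<bar>v\<bar> > \<epsilon>") (simp_all add: tker_def)

text \<open>The asymmetric cut is compared with the symmetric cut of radius \<beta>. They differ
  only to the left of s, at distances between the smaller and the larger radius. There the kernel is
  at most the inverse of the smaller radius and the shell is short; G is split into G - G s,
  controlled by averages, and the constant G s.\<close>

lemma asymmetric_truncation_bound:
  fixes G :: "real \<Rightarrow> complex"
  assumes [measurable]: "G \<in> borel_measurable borel"
    and ab: "\<alpha> > 0" "\<beta> > 0" and \<eta>: "\<eta> > 0" "\<alpha> \<le> (1 + \<eta>) * \<beta>" "\<beta> \<le> (1 + \<eta>) * \<alpha>" and "e > 0"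
    and av: "\<And>h. 0 < h \<Longrightarrow> h \<le> max \<alpha> \<beta> \<Longrightarrow>
       (\<integral>\<^sup>+t. ennreal (cmod (G t - G s)) * indicator {s-h..s+h} t \<partial>lborel) \<le> ennreal (e * h)"
  shows "cmod (LINT t|lborel. complex_of_real (indicator (- {s-\<alpha>..s+\<beta>}) t / (t - s) - tker \<beta> (t - s)) * G t)
     \<le> e * (1 + \<eta>) + cmod (G s) * \<eta>"
proof -
  define m where "m = min \<alpha> \<beta>"
  define M where "M = max \<alpha> \<beta>"
  have m: "m > 0" "m \<le> M" "M \<le> (1 + \<eta>) * m"
    using ab \<eta> mult_right_mono[of 1 "1 + \<eta>"] by (auto simp: m_def M_def min_def max_def)
  let ?D = "\<lambda>t. complex_of_real (indicator (- {s-\<alpha>..s+\<beta>}) t / (t - s) - tker \<beta> (t - s)) * G t"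
  have pw: "cmod (?D t) \<le> (1 / m) * (cmod (G t - G s) * indicator {s-M..s+M} t + cmod (G s) * indicator {s-M..s-m} t)" for t
  proof (cases "t \<in> {s-M..s-m}")
    case True
    then have t: "t - s \<le> - m" "\<bar>t - s\<bar> \<ge> m" using m by auto
    have "\<bar>indicator (- {s-\<alpha>..s+\<beta>}) t / (t - s) - tker \<beta> (t - s)\<bar> \<le> 1 / \<bar>t - s\<bar>"
      by (rule truncation_kernel_diff_le)
    also have "\<dots> \<le> 1 / m" using t m by (intro divide_left_mono) auto
    finally have "cmod (?D t) \<le> (1 / m) * cmod (G t)"
      unfolding norm_mult norm_of_real by (intro mult_right_mono) auto
    also have "\<dots> \<le> (1 / m) * (cmod (G t - G s) + cmod (G s))"
      using m norm_triangle_ineq[of "G t - G s" "G s"] by (intro mult_left_mono) auto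
    finally show ?thesis using True m by (simp add: indicator_def)
  next
    case False
    have "indicator (- {s-\<alpha>..s+\<beta>}) t / (t - s) = tker \<beta> (t - s)"
      using False ab by (auto simp: indicator_def tker_def m_def M_def min_def max_def split: if_splits)
    then show ?thesis using m by simp
  qed
  have gen: "ennreal ((1 / m) * (a + b)) = ennreal (1 / m) * (ennreal a + ennreal b)" if "a \<ge> 0" "b \<ge> 0" for a b
    using that m by (subst ennreal_mult) auto
  have "ennreal (cmod (LINT t|lborel. ?D t)) \<le> (\<integral>\<^sup>+t. ennreal (cmod (?D t)) \<partial>lborel)"
    by (cases "integrable lborel ?D") (auto simp: integral_norm_bound_ennreal not_integrable_integral_eq)
  also have "\<dots> \<le> (\<integral>\<^sup>+t. ennreal (1 / m) * (ennreal (cmod (G t - G s)) * indicator {s-M..s+M} t + ennreal (cmod (G s)) * indicator {s-M..s-m} t) \<partial>lborel)"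
  proof (intro nn_integral_mono)
    fix t
    have "ennreal (cmod (?D t)) \<le> ennreal ((1 / m) * (cmod (G t - G s) * indicator {s-M..s+M} t + cmod (G s) * indicator {s-M..s-m} t))"
      by (rule ennreal_leI[OF pw])
    also have "\<dots> = ennreal (1 / m) * (ennreal (cmod (G t - G s)) * indicator {s-M..s+M} t + ennreal (cmod (G s)) * indicator {s-M..s-m} t)"
    proof -
      have "ennreal (c * indicator X t) = ennreal c * indicator X t" for c X
        by (simp add: indicator_def)
      then show ?thesis by (subst gen) auto
    qed
    finally show "ennreal (cmod (?D t)) \<le> ennreal (1 / m) * (ennreal (cmod (G t - G s)) * indicator {s-M..s+M} t + ennreal (cmod (G s)) * indicator {s-M..s-m} t)" .
  qed
  also have "\<dots> = ennreal (1 / m) * ((\<integral>\<^sup>+t. ennreal (cmod (G t - G s)) * indicator {s-M..s+M} t \<partial>lborel) + ennreal (cmod (G s)) * ennreal (M - m))"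
    using m by (subst nn_integral_cmult, simp, subst nn_integral_add) (auto simp: nn_integral_cmult)
  also have "\<dots> \<le> ennreal (1 / m) * (ennreal (e * M) + ennreal (cmod (G s)) * ennreal (M - m))"
    using m av[of M] by (intro mult_left_mono add_mono) (auto simp: M_def[symmetric])
  also have "\<dots> = ennreal ((1 / m) * (e * M + cmod (G s) * (M - m)))"
    using m \<open>e > 0\<close> by (subst gen) (auto simp: ennreal_mult)
  also have "\<dots> \<le> ennreal (e * (1 + \<eta>) + cmod (G s) * \<eta>)"
  proof (rule ennreal_leI)
    have "M - m \<le> \<eta> * m" using m(3) by (simp add: algebra_simps)
    then have "e * M + cmod (G s) * (M - m) \<le> e * ((1 + \<eta>) * m) + cmod (G s) * (\<eta> * m)"
      using m \<open>e > 0\<close> by (intro add_mono mult_left_mono) auto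
    then have "(1 / m) * (e * M + cmod (G s) * (M - m)) \<le> (1 / m) * (e * ((1 + \<eta>) * m) + cmod (G s) * (\<eta> * m))"
      using m by (intro mult_left_mono) auto
    also have "\<dots> = e * (1 + \<eta>) + cmod (G s) * \<eta>" using m by (simp add: field_simps)
    finally show "(1 / m) * (e * M + cmod (G s) * (M - m)) \<le> e * (1 + \<eta>) + cmod (G s) * \<eta>" .
  qed
  finally show ?thesis
    using \<eta> \<open>e > 0\<close> by (subst (asm) ennreal_le_iff) auto
qed

lemma asymmetric_truncation_tendsto:
  assumes G: "G \<in> sq_integrable lborel" and pt: "lebesgue_pt G s"
    and pos: "\<forall>\<^sub>F \<delta> in F. \<alpha> \<delta> > 0 \<and> \<beta> \<delta> > 0"
    and lim: "(\<alpha> \<longlongrightarrow> 0) F" "(\<beta> \<longlongrightarrow> 0) F" "((\<lambda>\<delta>. \<alpha> \<delta> / \<beta> \<delta>) \<longlongrightarrow> 1) F"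
  shows "((\<lambda>\<delta>. LINT t|lborel. complex_of_real (indicator (- {s-\<alpha> \<delta>..s+\<beta> \<delta>}) t / (t - s) - tker (\<beta> \<delta>) (t - s)) * G t) \<longlongrightarrow> 0) F"
proof (rule tendstoI)
  have [measurable]: "G \<in> borel_measurable borel" using sq_integrableD(1)[OF G] by simp
  fix e :: real assume "e > 0"
  \<comment> \<open>Since \<eta> \<le> 1, the first part of the bound is at most 2 * e' = e / 4. The
    second is at most e / 2, where the summand 1 in the denominator of \<eta> allows G s =
    0.\<close>
  define e' where "e' = e / 8"
  define \<eta> where "\<eta> = min 1 (e / (2 * (cmod (G s) + 1)))"
  have e': "e' > 0" using \<open>e > 0\<close> by (simp add: e'_def)
  have "cmod (G s) + 1 > 0" by (simp add: add_nonneg_pos)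
  then have \<eta>: "\<eta> > 0" "\<eta> \<le> 1" using \<open>e > 0\<close> by (simp_all add: \<eta>_def)
  have G\<eta>: "cmod (G s) * \<eta> \<le> e / 2"
  proof -
    have "cmod (G s) * \<eta> \<le> (cmod (G s) + 1) * (e / (2 * (cmod (G s) + 1)))"
      using \<open>e > 0\<close> \<eta> by (intro mult_mono) (auto simp: \<eta>_def)
    also have "\<dots> = e / 2"
    proof -
      have "c * (e / (2 * c)) = e / 2" if "c > 0" for c :: real using that by simp
      from this[OF \<open>cmod (G s) + 1 > 0\<close>] show ?thesis .
    qed
    finally show ?thesis .
  qed
  obtain d where d: "d > 0" "\<And>h. 0 < h \<Longrightarrow> h < d \<Longrightarrow>
     (\<integral>\<^sup>+t. ennreal (cmod (G t - G s)) * indicator {s-h..s+h} t \<partial>lborel) \<le> ennreal (e' * h)"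
    using pt e' unfolding lebesgue_pt_def by meson
  have "1 / (1 + \<eta>) < 1" using \<eta> by simp
  have "\<forall>\<^sub>F \<delta> in F. 1 / (1 + \<eta>) < \<alpha> \<delta> / \<beta> \<delta>" "\<forall>\<^sub>F \<delta> in F. \<alpha> \<delta> / \<beta> \<delta> < 1 + \<eta>"
    using order_tendstoD[OF lim(3)] \<eta> \<open>1 / (1 + \<eta>) < 1\<close> by auto
  moreover have "\<forall>\<^sub>F \<delta> in F. \<alpha> \<delta> < d" "\<forall>\<^sub>F \<delta> in F. \<beta> \<delta> < d"
    using order_tendstoD(2)[OF lim(1)] order_tendstoD(2)[OF lim(2)] d(1) by auto
  ultimately show "\<forall>\<^sub>F \<delta> in F. dist (LINT t|lborel. complex_of_real (indicator (- {s-\<alpha> \<delta>..s+\<beta> \<delta>}) t / (t - s) - tker (\<beta> \<delta>) (t - s)) * G t) 0 < e"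
    using pos
  proof eventually_elim
    case (elim \<delta>)
    have "\<alpha> \<delta> \<le> (1 + \<eta>) * \<beta> \<delta>" using elim(2,5) by (simp add: pos_divide_less_eq)
    moreover have "\<beta> \<delta> \<le> (1 + \<eta>) * \<alpha> \<delta>"
      using elim(1,5) \<eta> by (simp add: divide_simps mult.commute split: if_splits)
    ultimately have "cmod (LINT t|lborel. complex_of_real (indicator (- {s-\<alpha> \<delta>..s+\<beta> \<delta>}) t / (t - s) - tker (\<beta> \<delta>) (t - s)) * G t)
       \<le> e' * (1 + \<eta>) + cmod (G s) * \<eta>"
      using elim \<eta> e' d(2) by (intro asymmetric_truncation_bound) auto
    also have "\<dots> \<le> e' * 2 + e / 2"
      using G\<eta> e' \<eta> by (intro add_mono mult_left_mono) auto
    also have "\<dots> < e" using \<open>e > 0\<close> by (simp add: e'_def)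
    finally show ?case by simp
  qed
qed

lemma integral_punctured_tendsto:
  fixes h :: "real \<Rightarrow> complex"
  assumes h: "integrable lborel h" and lim: "(\<alpha> \<longlongrightarrow> 0) (at_right 0)" "(\<beta> \<longlongrightarrow> 0) (at_right (0::real))"
  shows "((\<lambda>\<delta>. LINT t|lborel. complex_of_real (indicator (- {s-\<alpha> \<delta>..s+\<beta> \<delta>}) t) * h t) \<longlongrightarrow> (LINT t|lborel. h t)) (at_right 0)"
  unfolding tendsto_at_iff_sequentially
proof (intro allI impI)
  have [measurable]: "h \<in> borel_measurable borel" using borel_measurable_integrable[OF h] by simp
  fix X :: "nat \<Rightarrow> real" assume X: "\<forall>i. X i \<in> {0<..} - {0}" "X \<longlonglongrightarrow> 0"
  have XF: "filterlim X (at_right 0) sequentially"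
  proof -
    have "X n > 0" for n using X(1) by auto
    moreover from this have "X n \<noteq> 0" for n by (metis less_irrefl)
    ultimately show ?thesis using X(2) by (simp add: filterlim_at)
  qed
  have aX: "(\<lambda>n. \<alpha> (X n)) \<longlonglongrightarrow> 0" and bX: "(\<lambda>n. \<beta> (X n)) \<longlonglongrightarrow> 0"
    using filterlim_compose[OF lim(1) XF] filterlim_compose[OF lim(2) XF] by auto
  show "((\<lambda>\<delta>. LINT t|lborel. complex_of_real (indicator (- {s-\<alpha> \<delta>..s+\<beta> \<delta>}) t) * h t) \<circ> X) \<longlonglongrightarrow> (LINT t|lborel. h t)"
    unfolding o_def
  proof (rule integral_dominated_convergence[where w = "\<lambda>t. cmod (h t)"])
    show "AE t in lborel. (\<lambda>n. complex_of_real (indicator (- {s-\<alpha> (X n)..s+\<beta> (X n)}) t) * h t) \<longlonglongrightarrow> h t"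
      using AE_lborel_singleton[of s]
    proof eventually_elim
      case (elim t)
      then have "0 < \<bar>t - s\<bar>" by simp
      then have "\<forall>\<^sub>F n in sequentially. \<alpha> (X n) < \<bar>t - s\<bar>" "\<forall>\<^sub>F n in sequentially. \<beta> (X n) < \<bar>t - s\<bar>"
        using order_tendstoD(2)[OF aX] order_tendstoD(2)[OF bX] by auto
      then have "\<forall>\<^sub>F n in sequentially. complex_of_real (indicator (- {s-\<alpha> (X n)..s+\<beta> (X n)}) t) * h t = h t"
        by eventually_elim (auto simp: indicator_def)
      then show ?case by (rule tendsto_eventually)
    qed
  qed (use h in \<open>auto simp: norm_mult indicator_def\<close>)
qed

text \<open>The cut cosecant kernel telescopes into four pieces: the cut regular part, the
  correction for asymmetry, symmetric cut minus conjugate Poisson kernel, and the conjugate Poisson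
  kernel. The regular part enters the first and last limits with opposite signs and cancels.\<close>

lemma truncated_csch_tendsto:
  assumes G: "G \<in> sq_integrable lborel" and pt: "lebesgue_pt G s" "lebesgue_pt (TT G) s"
    and pos: "\<forall>\<^sub>F \<delta> in at_right 0. \<alpha> \<delta> > 0 \<and> \<beta> \<delta> > 0"
    and lim: "(\<alpha> \<longlongrightarrow> 0) (at_right 0)" "(\<beta> \<longlongrightarrow> 0) (at_right 0)" "((\<lambda>\<delta>. \<alpha> \<delta> / \<beta> \<delta>) \<longlongrightarrow> 1) (at_right (0::real))"
  shows "((\<lambda>\<delta>. LINT t|lborel. complex_of_real (indicator (- {s-\<alpha> \<delta>..s+\<beta> \<delta>}) t * (acon / sinh (acon * (t - s)))) * G t) \<longlongrightarrow> \<i> * pi * TT G s) (at_right 0)"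
proof -
  have [measurable]: "G \<in> borel_measurable borel" using sq_integrableD(1)[OF G] by simp
  let ?r = "\<lambda>t. complex_of_real (r0 (t - s)) * G t"
  let ?I1 = "\<lambda>\<delta> t. complex_of_real (indicator (- {s-\<alpha> \<delta>..s+\<beta> \<delta>}) t) * ?r t"
  let ?I2 = "\<lambda>\<delta> t. complex_of_real (indicator (- {s-\<alpha> \<delta>..s+\<beta> \<delta>}) t / (t - s) - tker (\<beta> \<delta>) (t - s)) * G t"
  let ?I3 = "\<lambda>\<delta> t. complex_of_real (tker (\<beta> \<delta>) (t - s) - qker (\<beta> \<delta>) (t - s)) * G t"
  let ?I4 = "\<lambda>\<delta> t. complex_of_real (qker (\<beta> \<delta>) (t - s)) * G t"
  have FG: "FT G \<in> sq_integrable lborel" by (rule FT_sq[OF G])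
  have r: "integrable lborel ?r" by (intro integrable_l2mult integral_rho_pairing(2)[OF FG] G)
  \<comment> \<open>Positivity of \<beta> makes it tend to 0 from the right, so the limits in
    \<epsilon> may be taken along it.\<close>
  have bF: "filterlim \<beta> (at_right 0) (at_right 0)"
    using lim(2) pos by (auto simp: filterlim_at elim: eventually_mono)
  have L1: "((\<lambda>\<delta>. LINT t|lborel. ?I1 \<delta> t) \<longlongrightarrow> (LINT t|lborel. ?r t)) (at_right 0)"
    by (rule integral_punctured_tendsto[OF r lim(1,2)])
  have L2: "((\<lambda>\<delta>. LINT t|lborel. ?I2 \<delta> t) \<longlongrightarrow> 0) (at_right 0)"
    by (rule asymmetric_truncation_tendsto[OF G pt(1) pos lim])
  have L3: "((\<lambda>\<delta>. LINT t|lborel. ?I3 \<delta> t) \<longlongrightarrow> 0) (at_right 0)"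
    by (rule filterlim_compose[OF kernel_difference_tendsto[OF G pt(1)] bF])
  have L4: "((\<lambda>\<delta>. LINT t|lborel. ?I4 \<delta> t) \<longlongrightarrow> \<i> * pi * TT G s - (LINT t|lborel. ?r t)) (at_right 0)"
    by (rule filterlim_compose[OF conjugate_poisson_tendsto[OF G pt(2)] bF])
  have "((\<lambda>\<delta>. (LINT t|lborel. ?I1 \<delta> t) + (LINT t|lborel. ?I2 \<delta> t) + (LINT t|lborel. ?I3 \<delta> t) + (LINT t|lborel. ?I4 \<delta> t)) \<longlongrightarrow>
     (LINT t|lborel. ?r t) + 0 + 0 + (\<i> * pi * TT G s - (LINT t|lborel. ?r t))) (at_right 0)"
    by (intro tendsto_add L1 L2 L3 L4)
  moreover have "\<forall>\<^sub>F \<delta> in at_right 0. (LINT t|lborel. ?I1 \<delta> t) + (LINT t|lborel. ?I2 \<delta> t) + (LINT t|lborel. ?I3 \<delta> t) + (LINT t|lborel. ?I4 \<delta> t) =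
     (LINT t|lborel. complex_of_real (indicator (- {s-\<alpha> \<delta>..s+\<beta> \<delta>}) t * (acon / sinh (acon * (t - s)))) * G t)"
    using pos
  proof eventually_elim
    case (elim \<delta>)
    have i1: "integrable lborel (?I1 \<delta>)"
      by (rule integrable_bounded_mult[OF r, where C = 1]) (auto simp: indicator_def)
    have i4: "integrable lborel (?I4 \<delta>)"
      using elim by (intro integrable_l2mult integral_sgn_pairing(2)[OF FG] G) simp
    have i3: "integrable lborel (?I3 \<delta>)"
      using elim by (intro integrable_l2mult kernel_difference_sq G) simp
    have i2: "integrable lborel (?I2 \<delta>)"
    \<comment> \<open>The difference of the two cuts vanishes both near s and far from s, so it is
      bounded with bounded support.\<close>
    proof (rule integrable_l2mult[OF bc_sq G])
      let ?m = "min (\<alpha> \<delta>) (\<beta> \<delta>)" and ?M = "max (\<alpha> \<delta>) (\<beta> \<delta>)"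
      let ?f = "\<lambda>t. indicator (- {s-\<alpha> \<delta>..s+\<beta> \<delta>}) t / (t - s) - tker (\<beta> \<delta>) (t - s)"
      have m: "?m > 0" "?M > 0" using elim by auto
      have f0: "?f t = 0" if "\<bar>t - s\<bar> > ?M" for t
        using that elim by (auto simp: indicator_def tker_def abs_if split: if_splits)
      have f1: "\<bar>?f t\<bar> \<le> 1 / ?m" for t
      proof (cases "\<bar>t - s\<bar> < ?m")
        case True
        then have "?f t = 0" using elim by (auto simp: indicator_def tker_def abs_if split: if_splits)
        then show ?thesis using m by simp
      next
        case False
        then have "\<bar>t - s\<bar> \<ge> ?m" by (simp only: not_less)
        have "\<bar>?f t\<bar> \<le> 1 / \<bar>t - s\<bar>" by (rule truncation_kernel_diff_le)
        also have "\<dots> \<le> 1 / ?m" using \<open>\<bar>t - s\<bar> \<ge> ?m\<close> m by (intro divide_left_mono mult_pos_pos) auto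
        finally show ?thesis .
      qed
      have "cmod (complex_of_real (?f t)) \<le> 1 / ?m + \<bar>s\<bar> + ?M \<and> (1 / ?m + \<bar>s\<bar> + ?M < \<bar>t\<bar> \<longrightarrow> complex_of_real (?f t) = 0)" for t
      proof -
        have "1 / ?m > 0" using m by simp
        moreover have "?f t = 0" if "1 / ?m + \<bar>s\<bar> + ?M < \<bar>t\<bar>"
          using that \<open>1 / ?m > 0\<close> by (intro f0) linarith
        ultimately show ?thesis using f1[of t] m unfolding norm_of_real by auto
      qed
      moreover have "(\<lambda>t. complex_of_real (?f t)) \<in> borel_measurable borel" by measurable
      ultimately show "(\<lambda>t. complex_of_real (?f t)) \<in> bc" unfolding bc_def by blast
    qed
    have "(LINT t|lborel. ?I1 \<delta> t) + (LINT t|lborel. ?I2 \<delta> t) + (LINT t|lborel. ?I3 \<delta> t) + (LINT t|lborel. ?I4 \<delta> t)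
        = (LINT t|lborel. ?I1 \<delta> t + ?I2 \<delta> t + ?I3 \<delta> t + ?I4 \<delta> t)"
      using i1 i2 i3 i4 by (simp only: Bochner_Integration.integral_add Bochner_Integration.integrable_add)
    also have "\<dots> = (LINT t|lborel. complex_of_real (indicator (- {s-\<alpha> \<delta>..s+\<beta> \<delta>}) t * (acon / sinh (acon * (t - s)))) * G t)"
    proof (intro Bochner_Integration.integral_cong refl)
      fix t
      have "indicator (- {s-\<alpha> \<delta>..s+\<beta> \<delta>}) t * r0 (t - s) + (indicator (- {s-\<alpha> \<delta>..s+\<beta> \<delta>}) t / (t - s) - tker (\<beta> \<delta>) (t - s)) +
          (tker (\<beta> \<delta>) (t - s) - qker (\<beta> \<delta>) (t - s)) + qker (\<beta> \<delta>) (t - s) = indicator (- {s-\<alpha> \<delta>..s+\<beta> \<delta>}) t * (acon / sinh (acon * (t - s)))"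
        by (simp add: r0_def indicator_def)
      from arg_cong[OF this, of "\<lambda>x. complex_of_real x * G t"]
      show "?I1 \<delta> t + ?I2 \<delta> t + ?I3 \<delta> t + ?I4 \<delta> t = complex_of_real (indicator (- {s-\<alpha> \<delta>..s+\<beta> \<delta>}) t * (acon / sinh (acon * (t - s)))) * G t"
        by (simp only: of_real_add of_real_mult distrib_right mult.assoc)
    qed
    finally show ?case .
  qed
  ultimately show ?thesis by (simp add: filterlim_cong[OF refl refl])
qed

text \<open>The difference of tanh values is sinh of the difference over two cosh factors, and the
  root of the Jacobian is cosh over sqrt acon. The cosh at t cancels; the one at s becomes the
  weight at the image point.\<close>

lemma csch_change_of_variables:
  assumes "t \<noteq> s"
  shows "1 / (sqrt (dgamma (tanh_a t)) * (tanh_a t - tanh_a s)) = sqrt (dgamma (tanh_a s)) * (acon / sinh (acon * (t - s)))"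
proof -
  have c: "cosh (acon * u) > 0" for u by simp
  have d: "sqrt (dgamma (tanh_a u)) = cosh (acon * u) / sqrt acon" for u
  proof -
    have "1 - (tanh_a u)\<^sup>2 = 1 / (cosh (acon * u))\<^sup>2"
      using c[of u] hyperbolic_pythagoras[of "acon * u"]
      by (simp add: tanh_a_def tanh_def power_divide divide_simps)
    then have "dgamma (tanh_a u) = (cosh (acon * u))\<^sup>2 / acon" by (simp add: dgamma_def)
    then show ?thesis using c[of u] by (simp add: real_sqrt_divide)
  qed
  have diff: "tanh_a t - tanh_a s = sinh (acon * (t - s)) / (cosh (acon * t) * cosh (acon * s))"
    using c[of t] c[of s] by (simp add: tanh_a_def tanh_def right_diff_distrib sinh_diff divide_simps)
  have "sinh (acon * (t - s)) \<noteq> 0" using assms acon_pos by simp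
  moreover have "sqrt acon * sqrt acon = acon" using acon_pos by simp
  ultimately show ?thesis
    unfolding d diff using c[of t] c[of s] acon_pos by (simp add: field_simps)
qed

lemma principal_value_substitution:
  assumes g: "g \<in> sq_integrable I11" and \<delta>: "0 < \<delta>" "-1 < x - \<delta>" "x + \<delta> < 1"
  shows "(LINT y : {-1<..<1} - {x - \<delta>..x + \<delta>} | lborel. g y / complex_of_real (y - x)) =
    complex_of_real (sqrt (dgamma x)) *
    (LINT t|lborel. complex_of_real (indicator (- {gamma_map (x - \<delta>)..gamma_map (x + \<delta>)}) t * (acon / sinh (acon * (t - gamma_map x)))) * gaminv g t)"
proof -
  have x: "-1 < x" "x < 1" using \<delta> by auto
  define s where "s = gamma_map x"
  have xs: "x = tanh_a s" using tanh_a_gamma[OF x] by (simp add: s_def)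
  define E where "E = {x - \<delta>..x + \<delta>}"
  have [measurable]: "E \<in> sets borel" by (simp add: E_def)
  have [measurable]: "(\<lambda>t. g (tanh_a t)) \<in> borel_measurable borel"
    by (rule measurable_compose[OF measurable_tanh_a_I11]) (use sq_integrableD(1)[OF g] in simp)
  \<comment> \<open>Division by \<open>dgamma\<close> prepares the integrand for the change of
    variables; the square root of that factor is absorbed by \<open>gaminv g\<close>.\<close>
  define F where "F = (\<lambda>t. (1 / dgamma (tanh_a t)) *\<^sub>R (indicator (- E) (tanh_a t) *\<^sub>R (g (tanh_a t) / complex_of_real (tanh_a t - x))))"
  have [measurable]: "F \<in> borel_measurable borel" unfolding F_def by measurable
  have "(LINT y : {-1<..<1} - E | lborel. g y / complex_of_real (y - x)) =
     (LINT y|lborel. indicator {-1<..<1} y *\<^sub>R (indicator (- E) y *\<^sub>R (g y / complex_of_real (y - x))))"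
    unfolding set_lebesgue_integral_def by (intro Bochner_Integration.integral_cong) (auto simp: indicator_def)
  also have "\<dots> = (LINT y|I11. indicator (- E) y *\<^sub>R (g y / complex_of_real (y - x)))"
    by (rule integral_I11[symmetric])
  also have "\<dots> = (LINT y|I11. dgamma y *\<^sub>R F (gamma_map y))"
  proof (intro Bochner_Integration.integral_cong refl)
    fix y assume "y \<in> space I11"
    then have y: "-1 < y" "y < 1" by auto
    show "indicator (- E) y *\<^sub>R (g y / complex_of_real (y - x)) = dgamma y *\<^sub>R F (gamma_map y)"
      using dgamma_pos[OF y] by (simp add: F_def tanh_a_gamma[OF y])
  qed
  also have "\<dots> = (LINT t|lborel. F t)" by (rule integral_gamma[symmetric]) simp
  also have "\<dots> = (LINT t|lborel. complex_of_real (sqrt (dgamma x)) * (complex_of_real (indicator (- {gamma_map (x - \<delta>)..gamma_map (x + \<delta>)}) t * (acon / sinh (acon * (t - s)))) * gaminv g t))"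
  proof (intro Bochner_Integration.integral_cong refl)
    fix t
    have "tanh_a t \<in> E \<longleftrightarrow> t \<in> {gamma_map (x - \<delta>)..gamma_map (x + \<delta>)}"
      using gamma_map_less_iff[of "x - \<delta>"] gamma_map_less_iff[of "x + \<delta>"] \<delta> by (auto simp: E_def not_less[symmetric])
    then have ind: "indicator (- E) (tanh_a t) = (indicator (- {gamma_map (x - \<delta>)..gamma_map (x + \<delta>)}) t :: real)"
      by (simp add: indicator_def)
    show "F t = complex_of_real (sqrt (dgamma x)) * (complex_of_real (indicator (- {gamma_map (x - \<delta>)..gamma_map (x + \<delta>)}) t * (acon / sinh (acon * (t - s)))) * gaminv g t)"
    \<comment> \<open>The cosecant identity is for t \<noteq> s; at t = s both sides carry a zero
      indicator, as x lies in the removed interval.\<close>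
    proof (cases "t = s")
      case True
      then have "tanh_a t \<in> E" using xs \<delta> by (simp add: E_def)
      then show ?thesis unfolding F_def ind[symmetric] by simp
    next
      case False
      have dp: "dgamma (tanh_a t) > 0" using tanh_a_bounds by (intro dgamma_pos)
      have "F t = complex_of_real (indicator (- E) (tanh_a t)) * complex_of_real (1 / (sqrt (dgamma (tanh_a t)) * (tanh_a t - tanh_a s))) * gaminv g t"
      proof -
        have "complex_of_real (dgamma (tanh_a t)) = complex_of_real (sqrt (dgamma (tanh_a t))) * complex_of_real (sqrt (dgamma (tanh_a t)))"
          using dp by (simp flip: of_real_mult)
        then show ?thesis
          by (simp add: F_def gaminv_def scaleR_conv_of_real xs)
      qed
      then show ?thesis unfolding csch_change_of_variables[OF False] ind xs by simp
    qed
  qed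
  also have "\<dots> = complex_of_real (sqrt (dgamma x)) * (LINT t|lborel. complex_of_real (indicator (- {gamma_map (x - \<delta>)..gamma_map (x + \<delta>)}) t * (acon / sinh (acon * (t - s)))) * gaminv g t)"
    by (rule integral_mult_right_zero)
  finally show ?thesis unfolding E_def s_def .
qed

text \<open>The good points x are those whose image is a Lebesgue point of both the transported
  function and its image under \<open>TT\<close>; the substitution preserves null sets.\<close>

lemma AE_has_principal_value:
  assumes g: "g \<in> sq_integrable I11"
  shows "AE x in I11. has_principal_value g x (\<i> * complex_of_real pi * gam (TT (gaminv g)) x)"
proof -
  let ?G = "gaminv g"
  have G: "?G \<in> sq_integrable lborel" by (rule gaminv_sq[OF g])
  have "AE s in lborel. lebesgue_pt ?G s \<and> lebesgue_pt (TT ?G) s"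
    using AE_lebesgue_pt_sq[OF G] AE_lebesgue_pt_sq[OF TT_sq[OF G]] by eventually_elim simp
  then have "AE x in I11. lebesgue_pt ?G (gamma_map x) \<and> lebesgue_pt (TT ?G) (gamma_map x)" by (rule AE_gamma)
  moreover have "AE x in I11. -1 < x \<and> x < 1" by (intro AE_I2) auto
  ultimately show ?thesis
  proof eventually_elim
    case (elim x)
    then have x: "-1 < x" "x < 1" and pt: "lebesgue_pt ?G (gamma_map x)" "lebesgue_pt (TT ?G) (gamma_map x)" by auto
    define s where "s = gamma_map x"
    \<comment> \<open>The two arms of the image of the symmetric cut. Divided by \<delta>, both tend
      to the derivative \<open>dgamma x\<close>, which is positive; so both are eventually positive
      and their ratio tends to 1.\<close>
    define \<alpha> where "\<alpha> = (\<lambda>\<delta>. s - gamma_map (x - \<delta>))"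
    define \<beta> where "\<beta> = (\<lambda>\<delta>. gamma_map (x + \<delta>) - s)"
    have D: "((\<lambda>h. (gamma_map (x + h) - gamma_map x) / h) \<longlongrightarrow> dgamma x) (at 0)"
      using DERIV_gamma_map[OF x] by (simp add: DERIV_def)
    have Db: "((\<lambda>\<delta>. \<beta> \<delta> / \<delta>) \<longlongrightarrow> dgamma x) (at_right 0)"
      using filterlim_mono[OF D order_refl at_le[of "{0<..}" UNIV]] by (simp add: \<beta>_def s_def)
    have "filterlim (\<lambda>\<delta>::real. - \<delta>) (at 0) (at_right 0)"
      by (auto simp: filterlim_at eventually_at_filter intro!: tendsto_eq_intros)
    from filterlim_compose[OF D this]
    have Da: "((\<lambda>\<delta>. \<alpha> \<delta> / \<delta>) \<longlongrightarrow> dgamma x) (at_right 0)"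
      by (simp add: \<alpha>_def s_def minus_divide_left[symmetric] minus_divide_right[symmetric] diff_divide_distrib)
    have dpos: "dgamma x > 0" by (rule dgamma_pos[OF x])
    have "\<forall>\<^sub>F \<delta> in at_right 0. 0 < \<alpha> \<delta> / \<delta>" "\<forall>\<^sub>F \<delta> in at_right 0. 0 < \<beta> \<delta> / \<delta>"
      using order_tendstoD(1)[OF Da dpos] order_tendstoD(1)[OF Db dpos] by auto
    then have pos: "\<forall>\<^sub>F \<delta> in at_right 0. \<alpha> \<delta> > 0 \<and> \<beta> \<delta> > 0"
      using eventually_at_right_less[of "0::real"] by eventually_elim (simp add: zero_less_divide_iff)
    have lima: "(\<alpha> \<longlongrightarrow> 0) (at_right 0)"
    proof (rule Lim_transform_eventually)
      show "((\<lambda>\<delta>. \<alpha> \<delta> / \<delta> * \<delta>) \<longlongrightarrow> 0) (at_right 0)"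
        using tendsto_mult[OF Da tendsto_ident_at] by simp
      show "\<forall>\<^sub>F \<delta> in at_right 0. \<alpha> \<delta> / \<delta> * \<delta> = \<alpha> \<delta>"
        using eventually_at_right_less[of "0::real"] by eventually_elim simp
    qed
    have limb: "(\<beta> \<longlongrightarrow> 0) (at_right 0)"
    proof (rule Lim_transform_eventually)
      show "((\<lambda>\<delta>. \<beta> \<delta> / \<delta> * \<delta>) \<longlongrightarrow> 0) (at_right 0)"
        using tendsto_mult[OF Db tendsto_ident_at] by simp
      show "\<forall>\<^sub>F \<delta> in at_right 0. \<beta> \<delta> / \<delta> * \<delta> = \<beta> \<delta>"
        using eventually_at_right_less[of "0::real"] by eventually_elim simp
    qed
    have limab: "((\<lambda>\<delta>. \<alpha> \<delta> / \<beta> \<delta>) \<longlongrightarrow> 1) (at_right 0)"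
    proof (rule Lim_transform_eventually)
      show "((\<lambda>\<delta>. (\<alpha> \<delta> / \<delta>) / (\<beta> \<delta> / \<delta>)) \<longlongrightarrow> 1) (at_right 0)"
        using tendsto_divide[OF Da Db] dpos by simp
      show "\<forall>\<^sub>F \<delta> in at_right 0. (\<alpha> \<delta> / \<delta>) / (\<beta> \<delta> / \<delta>) = \<alpha> \<delta> / \<beta> \<delta>"
        using eventually_at_right_less[of "0::real"] by eventually_elim simp
    qed
    let ?K = "\<lambda>\<delta>. LINT t|lborel. complex_of_real (indicator (- {s - \<alpha> \<delta>..s + \<beta> \<delta>}) t * (acon / sinh (acon * (t - s)))) * ?G t"
    have "(?K \<longlongrightarrow> \<i> * pi * TT ?G s) (at_right 0)"
      by (rule truncated_csch_tendsto[OF G pt[folded s_def] pos lima limb limab])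
    then have "((\<lambda>\<delta>. complex_of_real (sqrt (dgamma x)) * ?K \<delta>) \<longlongrightarrow> complex_of_real (sqrt (dgamma x)) * (\<i> * pi * TT ?G s)) (at_right 0)"
      by (rule tendsto_mult[OF tendsto_const])
    moreover have "complex_of_real (sqrt (dgamma x)) * (\<i> * pi * TT ?G s) = \<i> * complex_of_real pi * gam (TT ?G) x"
      by (simp add: gam_eq[OF x] s_def)
    moreover have "\<forall>\<^sub>F \<delta> in at_right 0. complex_of_real (sqrt (dgamma x)) * ?K \<delta> =
        (LINT y : {-1<..<1} - {x - \<delta>..x + \<delta>} | lborel. g y / complex_of_real (y - x))"
    proof -
      \<comment> \<open>Below this bound the removed interval stays inside the open interval, where
        \<open>gamma_map\<close> is increasing.\<close>
      have "0 < min (1 - x) (1 + x)" using x by simp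
      from eventually_at_right_real[OF this]
      show ?thesis
      proof eventually_elim
        case (elim \<delta>)
        then show ?case using principal_value_substitution[OF g, of \<delta> x] by (simp add: \<alpha>_def \<beta>_def s_def)
      qed
    qed
    ultimately show ?case unfolding has_principal_value_def by (simp add: filterlim_cong[OF refl refl])
  qed
qed

theorem mainTheorem8:
  fixes A :: "(real \<Rightarrow> complex) set"
  assumes "A \<in> L2 interval_measure_11"
  shows "finite_hilbert A =
    (U_op \<circ> L2_mult interval_measure_11 complex_of_real
       \<circ> inv_into (L2 interval_measure_11) U_op) A"
proof -
  obtain g where g: "g \<in> sq_integrable I11" "A = L2_class I11 g" using assms by (rule L2_E)
  have G: "gaminv g \<in> sq_integrable lborel" by (rule gaminv_sq[OF g(1)])
  have "AE x in I11. g x = gam (gaminv g) x" by (intro AE_I2) (auto simp: gam_gaminv)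
  then have A: "A = L2_class I11 (gam (gaminv g))"
    unfolding g(2) by (rule L2_class_eqI[OF g(1) gam_sq(1)[OF G]])
  have "finite_hilbert A = L2_class I11 (gam (TT (gaminv g)))"
    unfolding g(2) by (rule finite_hilbert_reduction[OF AE_has_principal_value g(1)])
  then show ?thesis unfolding A by (simp only: spectral_side[OF G])
qed

end
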